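(* Let $S$ be a surface with or without boundary with a finite polygonal cellular decomposition $(V,E,F)$, let $Y_f\in((2-N(f))\pi,2\pi)$ be given for each $f\in F$, and let $p>1$. Suppose $\hat L=(\hat L_i)_{i\in V}\in\mathbb R_{>0}^{|V|}$. The following statements are equivalent: 1. $\hat L\in\mathcal L$, where $$\mathcal L=\Big\{(L_v)_{v\in V}\in\mathbb R_{>0}^{|V|}\ \Big|\ \sum_{w\in W}L_w<\sum_{f\in F_W}\pi\min\Big\{N(f,W),\,N(f)-2+\frac{Y_f}{\pi}\Big\}\ \text{ for all nonempty } W\subset V\Big\};$$ 2. for any initial value $k(0)\in\mathbb R_{>0}^{|V|}$, the solution of the combinatorial $p$-th Calabi flow $$\frac{dk_i}{dt}=k_i(\Delta_p-K_i)(L_i-\hat L_i),\quad i\in V,$$ exists for all time $t\in[0,+\infty)$ and converges to a generalized circle packing metric (i.e. to some $k\in\mathbb R_{>0}^{|V|}$) with total geodesic curvature $\hat L$.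
   Context: For a face $f$, $V_f$ is its set of vertices and $N(f)=|V_f|$. For $W\subset V$, $F_W$ is the set of faces having at least one vertex in $W$, and $N(f,W)=|W\cap V_f|$. Put $\alpha_f=2\pi-Y_f\in(0,N(f)\pi)$. Generalized circles in $\mathbb H^2$: circles (geodesic curvature $>1$), horocycles (geodesic curvature $1$), hypercycles (geodesic curvature in $(0,1)$). For $k_0>1$, $x>0$ put $\theta(k_0,x)=2\arctan(\sqrt{k_0^2-1}/x)$, the angle at the center of a circle of geodesic curvature $k_0$ subtended by its arc cut off by a perpendicular generalized circle of geodesic curvature $x$. Given $k=(k_v)_{v\in V}\in\mathbb R_{>0}^{|V|}$, for each $f$ there is a unique $k_f=k_f(k)>1$ with $\sum_{v\in V_f}\theta(k_f,k_v)=\alpha_f$. Gluing the corresponding quadrilaterals around the center gives a conical polygon carrying generalized circles $C_v$ ($v\in V_f$) of geodesic curvature $k_v$, consecutive ones tangent, all perpendicular to the dual circle $C_f$ of geodesic curvature $k_f$ whose center is a cone point of angle $\alpha_f$. Gluing these polygons along edges gives the generalized circle packing metric determined by $k$; with $Y$ fixed, such metrics are identified with vectors $k\in\mathbb R_{>0}^{|V|}$. Let $C_{v,f}$ be the sub-arc of $C_v$ inside $C_f$, $l_{v,f}$ its length, $L_{v,f}=k_vl_{v,f}$, and $L_v=\sum_{f\in F_{\{v\}}}L_{v,f}$ (total geodesic curvature); these are smooth functions of $k$. Explicitly $L_{v,f}=\frac{2k_v}{\sqrt{k_v^2-1}}\arctan\frac{\sqrt{k_v^2-1}}{k_f}$ if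 $k_v>1$, $L_{v,f}=\frac{2}{k_f}$ if $k_v=1$, $L_{v,f}=\frac{2k_v}{\sqrt{1-k_v^2}}\operatorname{arctanh}\frac{\sqrt{1-k_v^2}}{k_f}$ if $0<k_v<1$. Let $\Omega_f$ be the region (containing the cone point) enclosed by the arcs $C_{v,f}$, $v\in V_f$; by Gauss–Bonnet its hyperbolic area is $\mathrm{Area}(\Omega_f)=N(f)\pi-\alpha_f-\sum_{v\in V_f}L_{v,f}$. For $g:V\to\mathbb R$, the discrete $p$-th Laplace operator is $\Delta_pg_i=\sum_{j\sim i}A_{ij}|g_j-g_i|^{p-2}(g_j-g_i)$, the sum being over vertices $j\neq i$ adjacent to $i$ (terms with $g_j=g_i$ are $0$), where $A_{ij}=-k_j\frac{\partial}{\partial k_j}\big(\sum_{f\in F_{\{i\}}}L_{i,f}\big)$. Also $K_i=-k_i\frac{\partial}{\partial k_i}\big(\sum_{f\in F_{\{i\}}}\mathrm{Area}(\Omega_f)\big)$, and $(\Delta_p-K_i)g_i$ means $\Delta_pg_i-K_ig_i$, here with $g=L-\hat L$. *)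

theory Defs
  imports "HOL-Analysis.Analysis"
begin

section \<open>Surfaces with a finite polygonal cellular decomposition\<close>

text \<open>
  A surface with (possibly empty) boundary: every point has an open neighbourhood homeomorphic
  to a relatively open subset of the closed half plane. Compactness follows from the existence of
  a finite polygonal decomposition; connectedness is not required.
\<close>

definition surface :: "'a topology \<Rightarrow> bool" where
  "surface S \<longleftrightarrow> Hausdorff_space S \<and> second_countable S \<and>
     (\<forall>x\<in>topspace S. \<exists>U H. openin S U \<and> x \<in> U \<and>
        openin (top_of_set {z::complex. 0 \<le> Im z}) H \<and>
        subtopology S U homeomorphic_space top_of_set H)"

text \<open>
  Edges and faces are open cells, given as subsets of the surface. Their characteristic maps are
  defined on the closed interval and on the closed unit disc. Since the surface is Hausdorff and
  cells are disjoint, these maps restrict to homeomorphisms onto the open cells.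
\<close>

definition open_edge :: "'a topology \<Rightarrow> 'a set \<Rightarrow> 'a set \<Rightarrow> bool" where
  "open_edge S V e \<longleftrightarrow> (\<exists>\<gamma>. continuous_map (top_of_set {0..1::real}) S \<gamma> \<and>
     \<gamma> 0 \<in> V \<and> \<gamma> 1 \<in> V \<and> inj_on \<gamma> {0<..<1} \<and> \<gamma> ` {0<..<1} = e)"

text \<open>
  The model \<open>n\<close>-gon is the closed unit disc with the \<open>n\<close>-th roots of unity as corners and the
  \<open>n\<close> open arcs between them as sides; this also covers monogons and bigons.
\<close>

definition polygon_side :: "nat \<Rightarrow> nat \<Rightarrow> complex set" where
  "polygon_side n j = cis ` {2 * pi * real j / real n <..< 2 * pi * real (Suc j) / real n}"

definition open_polygon :: "'a topology \<Rightarrow> 'a set \<Rightarrow> 'a set set \<Rightarrow> 'a set \<Rightarrow> bool" where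
  "open_polygon S V E f \<longleftrightarrow> (\<exists>n \<Phi>. 1 \<le> n \<and>
     continuous_map (top_of_set (cball (0::complex) 1)) S \<Phi> \<and>
     inj_on \<Phi> (ball 0 1) \<and> \<Phi> ` ball 0 1 = f \<and>
     (\<forall>j<n. \<Phi> (cis (2 * pi * real j / real n)) \<in> V \<and>
            inj_on \<Phi> (polygon_side n j) \<and> \<Phi> ` polygon_side n j \<in> E))"

definition polygonal_decomposition ::
    "'a topology \<Rightarrow> 'a set \<Rightarrow> 'a set set \<Rightarrow> 'a set set \<Rightarrow> bool" where
  "polygonal_decomposition S V E F \<longleftrightarrow>
     finite V \<and> finite E \<and> finite F \<and>
     V \<union> \<Union>E \<union> \<Union>F = topspace S \<and>
     V \<inter> \<Union>E = {} \<and> V \<inter> \<Union>F = {} \<and> \<Union>E \<inter> \<Union>F = {} \<and>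
     disjoint E \<and> disjoint F \<and>
     (\<forall>e\<in>E. open_edge S V e) \<and> (\<forall>f\<in>F. open_polygon S V E f)"

text \<open>The vertices on a (closed) cell \<open>c\<close>; for a face \<open>f\<close> this is \<open>V\<^sub>f\<close>.\<close>

definition cell_verts :: "'a topology \<Rightarrow> 'a set \<Rightarrow> 'a set \<Rightarrow> 'a set" where
  "cell_verts S V c = V \<inter> S closure_of c"

definition adjacent :: "'a topology \<Rightarrow> 'a set \<Rightarrow> 'a set set \<Rightarrow> 'a \<Rightarrow> 'a \<Rightarrow> bool" where
  "adjacent S V E i j \<longleftrightarrow> i \<noteq> j \<and> (\<exists>e\<in>E. cell_verts S V e = {i, j})"

text \<open>The numbers \<open>N(f)\<close> and \<open>N(f, W)\<close>, and the set \<open>F\<^sub>W\<close>.\<close>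

definition nverts :: "'a topology \<Rightarrow> 'a set \<Rightarrow> 'a set \<Rightarrow> nat" where
  "nverts S V f = card (cell_verts S V f)"

definition nverts_in :: "'a topology \<Rightarrow> 'a set \<Rightarrow> 'a set \<Rightarrow> 'a set \<Rightarrow> nat" where
  "nverts_in S V f W = card (W \<inter> cell_verts S V f)"

definition faces_at :: "'a topology \<Rightarrow> 'a set \<Rightarrow> 'a set set \<Rightarrow> 'a set \<Rightarrow> 'a set set" where
  "faces_at S V F W = {f \<in> F. cell_verts S V f \<inter> W \<noteq> {}}"


section \<open>Generalized circle packing metrics and total geodesic curvature\<close>

text \<open>
  Elements of \<open>\<real>\<^bsup>V\<^esup>\<close> are functions on the whole type; only their values on \<open>V\<close> matter. For a fixed
  \<open>Y\<close>, a generalized circle packing metric is identified with the vector \<open>k\<close> of geodesic curvatures.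
\<close>

definition packing_metrics :: "'a set \<Rightarrow> ('a \<Rightarrow> real) set" where
  "packing_metrics V = {k. \<forall>v\<in>V. 0 < k v}"

definition cone_angle :: "('a set \<Rightarrow> real) \<Rightarrow> 'a set \<Rightarrow> real" where
  "cone_angle Y f = 2 * pi - Y f"

definition theta :: "real \<Rightarrow> real \<Rightarrow> real" where
  "theta k0 x = 2 * arctan (sqrt (k0\<^sup>2 - 1) / x)"

text \<open>The geodesic curvature \<open>k\<^sub>f\<close> of the dual circle of the face \<open>f\<close>.\<close>

definition dual_curv ::
    "'a topology \<Rightarrow> 'a set \<Rightarrow> ('a set \<Rightarrow> real) \<Rightarrow> ('a \<Rightarrow> real) \<Rightarrow> 'a set \<Rightarrow> real" where
  "dual_curv S V Y k f =
     (THE \<kappa>. 1 < \<kappa> \<and> (\<Sum>v\<in>cell_verts S V f. theta \<kappa> (k v)) = cone_angle Y f)"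

text \<open>
  Length of the arc of a generalized circle of geodesic curvature \<open>x\<close> inside a perpendicular circle
  of geodesic curvature \<open>\<kappa> > 1\<close> (circle, horocycle and hypercycle case).
\<close>

definition arc_length :: "real \<Rightarrow> real \<Rightarrow> real" where
  "arc_length \<kappa> x =
     (if x > 1 then 2 / sqrt (x\<^sup>2 - 1) * arctan (sqrt (x\<^sup>2 - 1) / \<kappa>)
      else if x = 1 then 2 / \<kappa>
      else 2 / sqrt (1 - x\<^sup>2) * artanh (sqrt (1 - x\<^sup>2) / \<kappa>))"

definition face_geod_curv ::
    "'a topology \<Rightarrow> 'a set \<Rightarrow> ('a set \<Rightarrow> real) \<Rightarrow> ('a \<Rightarrow> real) \<Rightarrow> 'a \<Rightarrow> 'a set \<Rightarrow> real" where
  "face_geod_curv S V Y k v f = k v * arc_length (dual_curv S V Y k f) (k v)"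

definition total_geod_curv ::
    "'a topology \<Rightarrow> 'a set \<Rightarrow> 'a set set \<Rightarrow> ('a set \<Rightarrow> real) \<Rightarrow> ('a \<Rightarrow> real) \<Rightarrow> 'a \<Rightarrow> real" where
  "total_geod_curv S V F Y k v = (\<Sum>f\<in>faces_at S V F {v}. face_geod_curv S V Y k v f)"

text \<open>The hyperbolic area of \<open>\<Omega>\<^sub>f\<close>, by Gauss--Bonnet.\<close>

definition region_area ::
    "'a topology \<Rightarrow> 'a set \<Rightarrow> ('a set \<Rightarrow> real) \<Rightarrow> ('a \<Rightarrow> real) \<Rightarrow> 'a set \<Rightarrow> real" where
  "region_area S V Y k f = real (nverts S V f) * pi - cone_angle Y f
     - (\<Sum>v\<in>cell_verts S V f. face_geod_curv S V Y k v f)"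

text \<open>The set \<open>\<L>\<close>.\<close>

definition admissible_curvs ::
    "'a topology \<Rightarrow> 'a set \<Rightarrow> 'a set set \<Rightarrow> ('a set \<Rightarrow> real) \<Rightarrow> ('a \<Rightarrow> real) set" where
  "admissible_curvs S V F Y = {L. (\<forall>v\<in>V. 0 < L v) \<and>
     (\<forall>W. W \<subseteq> V \<and> W \<noteq> {} \<longrightarrow>
        (\<Sum>w\<in>W. L w) <
        (\<Sum>f\<in>faces_at S V F W.
           pi * min (real (nverts_in S V f W)) (real (nverts S V f) - 2 + Y f / pi)))}"


section \<open>The combinatorial \<open>p\<close>-th Calabi flow\<close>

definition partial_deriv :: "(('a \<Rightarrow> real) \<Rightarrow> real) \<Rightarrow> 'a \<Rightarrow> ('a \<Rightarrow> real) \<Rightarrow> real" where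
  "partial_deriv \<phi> j k = deriv (\<lambda>s. \<phi> (k(j := s))) (k j)"

definition weight ::
    "'a topology \<Rightarrow> 'a set \<Rightarrow> 'a set set \<Rightarrow> ('a set \<Rightarrow> real) \<Rightarrow> ('a \<Rightarrow> real) \<Rightarrow> 'a \<Rightarrow> 'a \<Rightarrow> real" where
  "weight S V F Y k i j = - k j * partial_deriv (\<lambda>k'. total_geod_curv S V F Y k' i) j k"

definition area_coeff ::
    "'a topology \<Rightarrow> 'a set \<Rightarrow> 'a set set \<Rightarrow> ('a set \<Rightarrow> real) \<Rightarrow> ('a \<Rightarrow> real) \<Rightarrow> 'a \<Rightarrow> real" where
  "area_coeff S V F Y k i =
     - k i * partial_deriv (\<lambda>k'. \<Sum>f\<in>faces_at S V F {i}. region_area S V Y k' f) i k"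

text \<open>As \<open>0 powr a = 0\<close> for every \<open>a\<close>, terms with \<open>g j = g i\<close> vanish also for \<open>p \<le> 2\<close>.\<close>

definition p_laplacian ::
    "real \<Rightarrow> 'a topology \<Rightarrow> 'a set \<Rightarrow> 'a set set \<Rightarrow> 'a set set \<Rightarrow> ('a set \<Rightarrow> real) \<Rightarrow>
     ('a \<Rightarrow> real) \<Rightarrow> ('a \<Rightarrow> real) \<Rightarrow> 'a \<Rightarrow> real" where
  "p_laplacian p S V E F Y k g i =
     (\<Sum>j\<in>{j \<in> V. adjacent S V E i j}.
        weight S V F Y k i j * \<bar>g j - g i\<bar> powr (p - 2) * (g j - g i))"

definition calabi_field ::
    "real \<Rightarrow> 'a topology \<Rightarrow> 'a set \<Rightarrow> 'a set set \<Rightarrow> 'a set set \<Rightarrow> ('a set \<Rightarrow> real) \<Rightarrow>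
     ('a \<Rightarrow> real) \<Rightarrow> ('a \<Rightarrow> real) \<Rightarrow> 'a \<Rightarrow> real" where
  "calabi_field p S V E F Y Lhat k i =
     (let g = (\<lambda>j. total_geod_curv S V F Y k j - Lhat j)
      in k i * (p_laplacian p S V E F Y k g i - area_coeff S V F Y k i * g i))"

definition time_interval :: "ereal \<Rightarrow> real set" where
  "time_interval T = {t. 0 \<le> t \<and> ereal t < T}"

text \<open>Solutions on \<open>[0, T)\<close>, where \<open>T = \<infinity>\<close> is allowed; the derivative at \<open>0\<close> is one-sided.\<close>

definition calabi_solution ::
    "real \<Rightarrow> 'a topology \<Rightarrow> 'a set \<Rightarrow> 'a set set \<Rightarrow> 'a set set \<Rightarrow> ('a set \<Rightarrow> real) \<Rightarrow>
     ('a \<Rightarrow> real) \<Rightarrow> ereal \<Rightarrow> (real \<Rightarrow> 'a \<Rightarrow> real) \<Rightarrow> bool" where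
  "calabi_solution p S V E F Y Lhat T x \<longleftrightarrow> 0 < T \<and>
     (\<forall>t\<in>time_interval T. x t \<in> packing_metrics V \<and>
        (\<forall>i\<in>V. ((\<lambda>s. x s i) has_real_derivative calabi_field p S V E F Y Lhat (x t) i)
                 (at t within time_interval T)))"

text \<open>
  ``The solution'' with a given initial value is a maximal (non-extendable) one, so that its
  existence for all times means that its interval of existence is \<open>[0, \<infinity>)\<close>. The vector field need
  not be Lipschitz for \<open>p < 2\<close>, hence uniqueness is not built in.
\<close>

definition maximal_calabi_solution ::
    "real \<Rightarrow> 'a topology \<Rightarrow> 'a set \<Rightarrow> 'a set set \<Rightarrow> 'a set set \<Rightarrow> ('a set \<Rightarrow> real) \<Rightarrow>
     ('a \<Rightarrow> real) \<Rightarrow> ('a \<Rightarrow> real) \<Rightarrow> ereal \<Rightarrow> (real \<Rightarrow> 'a \<Rightarrow> real) \<Rightarrow> bool" where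
  "maximal_calabi_solution p S V E F Y Lhat k0 T x \<longleftrightarrow>
     (\<forall>i\<in>V. x 0 i = k0 i) \<and> calabi_solution p S V E F Y Lhat T x \<and>
     \<not> (\<exists>T' y. T < T' \<and> calabi_solution p S V E F Y Lhat T' y \<and>
             (\<forall>t\<in>time_interval T. \<forall>i\<in>V. y t i = x t i))"

end

theory Submission
  imports Defs "HOL-Complex_Analysis.Great_Picard"
begin

text \<open>
  Put \<open>s\<^sub>i = ln k\<^sub>i\<close>. The total geodesic curvatures form a gradient field in these coordinates, so
  \<open>L - Lhat\<close> is the gradient \<open>g\<close> of an explicit potential \<open>\<Psi>\<close>. Since the matrix \<open>A\<^sub>i\<^sub>j\<close> is symmetric with
  nonnegative off-diagonal entries and \<open>K\<^sub>i > 0\<close>, every solution of the flow satisfies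
  \<open>d \<Psi> / dt = - 1/2 \<Sum> A\<^sub>i\<^sub>j \<bar>g\<^sub>j - g\<^sub>i\<bar>\<^sup>p - \<Sum> K\<^sub>i g\<^sub>i\<^sup>2 \<le> 0\<close>, with equality only where \<open>g = 0\<close>. The
  inequalities defining the admissible set make \<open>\<Psi>\<close> proper, and a maximum principle shows that \<open>\<Psi>\<close>
  has at most one critical point. Hence solutions stay in a compact set, can be continued by Peano's
  theorem (for \<open>p < 2\<close> the field is only continuous) and converge to the unique zero of \<open>L - Lhat\<close>.
  Conversely every vector of total geodesic curvatures is admissible: each arc contributes less than
  \<open>\<pi>\<close>, and every region \<open>\<Omega>\<^sub>f\<close> has positive area.
\<close>

text \<open>The min in the admissible set is a growth rate: when the coordinates in W tend to
  infinity together, the potential of a face grows at least at the rate min (pi N(f,W), \<beta>),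
  with \<beta> = N(f) pi - \<alpha>_f. Admissibility says that these rates together beat the linear
  term given by Lhat. The p-Laplacian runs over edges only, whereas L_i depends on k_j for any two
  vertices of a common face. The flow is therefore not built from the full Hessian of the potential,
  and the energy estimate relies on the sign and symmetry of the weights alone, with strict decay
  supplied by K_i. The dual radius is only implicitly defined by k. Introducing it as an extra
  variable, at which the potential is critical, keeps its derivative out of the gradient.\<close>

section \<open>An arc perpendicular to a circle\<close>

text \<open>\<open>atan_quot z\<close> is \<open>arctan (sqrt z) / sqrt z\<close>, continued analytically to \<open>z > -1\<close>; it covers circles,
  horocycles and hypercycles at once.\<close>

definition atan_quot :: "real \<Rightarrow> real" where
  "atan_quot z = integral {0..1} (\<lambda>u. 1 / (1 + z * u\<^sup>2))"

definition atan_quot' :: "real \<Rightarrow> real" where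
  "atan_quot' z = integral {0..1} (\<lambda>u. - u\<^sup>2 / (1 + z * u\<^sup>2)\<^sup>2)"

lemma one_plus_mult_square_pos:
  fixes z u :: real
  assumes "-1 < z" "0 \<le> u" "u \<le> 1"
  shows "0 < 1 + z * u\<^sup>2"
proof (cases "0 \<le> z")
  case True
  then show ?thesis by (simp add: add_pos_nonneg)
next
  case False
  have "u\<^sup>2 \<le> 1" using assms by (simp add: power_le_one)
  then have "z * u\<^sup>2 \<ge> z * 1" using False by (intro mult_left_mono_neg) auto
  then show ?thesis using assms by linarith
qed

lemma atan_quot_has_derivative_at:
  assumes "-1 < z"
  shows "(atan_quot has_real_derivative atan_quot' z) (at z)"
proof -
  have pos: "0 < 1 + x * u\<^sup>2" if "x \<in> {-1<..}" "u \<in> cbox 0 1" for x u :: real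
    using one_plus_mult_square_pos[of x u] that by auto
  have "((\<lambda>x. integral (cbox 0 1) (\<lambda>u. 1 / (1 + x * u\<^sup>2))) has_real_derivative
      integral (cbox 0 1) (\<lambda>u. - u\<^sup>2 / (1 + z * u\<^sup>2)\<^sup>2)) (at z within {-1<..})"
  proof (rule leibniz_rule_field_derivative)
    fix x t :: real assume xt: "x \<in> {-1<..}" "t \<in> cbox 0 1"
    show "((\<lambda>x. 1 / (1 + x * t\<^sup>2)) has_real_derivative - t\<^sup>2 / (1 + x * t\<^sup>2)\<^sup>2)
      (at x within {-1<..})"
      using pos[OF xt] by (auto intro!: derivative_eq_intros simp: power2_eq_square)
  next
    fix x :: real assume x: "x \<in> {-1<..}"
    have "1 + x * t\<^sup>2 \<noteq> 0" if "t \<in> cbox 0 1" for t using pos[OF x that] by simp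
    then show "(\<lambda>u. 1 / (1 + x * u\<^sup>2)) integrable_on cbox 0 1"
      by (intro integrable_continuous continuous_intros) auto
  next
    have "1 + fst p * (snd p)\<^sup>2 \<noteq> 0" if "p \<in> {-1<..} \<times> cbox 0 1" for p :: "real \<times> real"
      using pos[of "fst p" "snd p"] that by auto
    then show "continuous_on ({-1<..} \<times> cbox 0 1) (\<lambda>(x, u). - u\<^sup>2 / (1 + x * u\<^sup>2)\<^sup>2 :: real)"
      unfolding split_beta by (intro continuous_intros) auto
  qed (use assms in auto)
  then show ?thesis
    using assms unfolding atan_quot_def[abs_def] atan_quot'_def
    by (simp add: at_within_open[of z "{-1<..}"])
qed

lemma DERIV_atan_quot [derivative_intros]:
  assumes "(f has_real_derivative f') (at t within T)" "-1 < f t"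
  shows "((\<lambda>t. atan_quot (f t)) has_real_derivative atan_quot' (f t) * f') (at t within T)"
  using DERIV_chain2[OF atan_quot_has_derivative_at assms(1)] assms(2) by blast

lemma tendsto_atan_quot [tendsto_intros]:
  assumes "(f \<longlongrightarrow> l) A" "-1 < l"
  shows "((\<lambda>x. atan_quot (f x)) \<longlongrightarrow> atan_quot l) A"
  using isCont_tendsto_compose[OF DERIV_isCont[OF atan_quot_has_derivative_at] assms(1)] assms(2)
  by blast

lemma tendsto_atan_quot' [tendsto_intros]:
  assumes "(f \<longlongrightarrow> l) A" "-1 < l"
  shows "((\<lambda>x. atan_quot' (f x)) \<longlongrightarrow> atan_quot' l) A"
proof -
  have "1 + fst p * (snd p)\<^sup>2 \<noteq> 0" if "p \<in> {-1<..} \<times> cbox 0 1" for p :: "real \<times> real"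
    using one_plus_mult_square_pos[of "fst p" "snd p"] that by auto
  then have "continuous_on ({-1<..} \<times> cbox 0 1) (\<lambda>(x, u). - u\<^sup>2 / (1 + x * u\<^sup>2)\<^sup>2 :: real)"
    unfolding split_beta by (intro continuous_intros) auto
  from integral_continuous_on_param[OF this]
  have "continuous_on {-1<..} atan_quot'"
    by (simp add: atan_quot'_def[abs_def])
  then have "isCont atan_quot' l"
    using assms(2) by (simp add: continuous_on_eq_continuous_at)
  then show ?thesis using assms(1) by (rule isCont_tendsto_compose)
qed

lemma atan_quot_integrable:
  fixes z :: real
  assumes "-1 < z"
  shows "(\<lambda>u. 1 / (1 + z * u\<^sup>2)) integrable_on {0..1}"
    and "(\<lambda>u. - u\<^sup>2 / (1 + z * u\<^sup>2)\<^sup>2) integrable_on {0..1}"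
proof -
  have *: "1 + z * t\<^sup>2 \<noteq> 0" if "t \<in> {0..1}" for t
    using one_plus_mult_square_pos[of z t] that assms by auto
  show "(\<lambda>u. 1 / (1 + z * u\<^sup>2)) integrable_on {0..1}"
    using * by (intro integrable_continuous_real continuous_intros) auto
  show "(\<lambda>u. - u\<^sup>2 / (1 + z * u\<^sup>2)\<^sup>2) integrable_on {0..1}"
    using * by (intro integrable_continuous_real continuous_intros) auto
qed

text \<open>For z = w^2 the left side is the w-derivative of
  \<open>w * atan_quot (w\<^sup>2)\<close>, that is of arctan w. It persists for negative z because
  both sides integrate the u-derivative of u / (1 + z u^2) over [0, 1]. It serves to eliminate the
  transcendental \<open>atan_quot\<close> from derivatives.\<close>

lemma atan_quot_ode:
  assumes "-1 < z"
  shows "atan_quot z + 2 * z * atan_quot' z = 1 / (1 + z)"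
proof -
  have *: "1 + z * t\<^sup>2 > 0" if "t \<in> {0..1}" for t
    using one_plus_mult_square_pos[of z t] that assms by auto
  have "((\<lambda>u. (1 - z * u\<^sup>2) / (1 + z * u\<^sup>2)\<^sup>2) has_integral
      1 / (1 + z * 1\<^sup>2) - 0 / (1 + z * 0\<^sup>2)) {0..1}"
  proof (rule fundamental_theorem_of_calculus)
    fix u :: real assume "u \<in> {0..1}"
    from *[OF this] show "((\<lambda>u. u / (1 + z * u\<^sup>2)) has_vector_derivative
        (1 - z * u\<^sup>2) / (1 + z * u\<^sup>2)\<^sup>2) (at u within {0..1})"
      unfolding has_real_derivative_iff_has_vector_derivative[symmetric]
      by (auto intro!: derivative_eq_intros simp: field_simps power2_eq_square)
  qed auto
  then have 1: "((\<lambda>u. (1 - z * u\<^sup>2) / (1 + z * u\<^sup>2)\<^sup>2) has_integral 1 / (1 + z)) {0..1}"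
    by simp
  have "((\<lambda>u. 1 / (1 + z * u\<^sup>2) + (2 * z) * (- u\<^sup>2 / (1 + z * u\<^sup>2)\<^sup>2)) has_integral
      atan_quot z + 2 * z * atan_quot' z) {0..1}"
    unfolding atan_quot_def atan_quot'_def
    by (intro has_integral_add has_integral_mult_right integrable_integral
        atan_quot_integrable assms)
  then have "((\<lambda>u. (1 - z * u\<^sup>2) / (1 + z * u\<^sup>2)\<^sup>2) has_integral
      atan_quot z + 2 * z * atan_quot' z) {0..1}"
  proof (rule has_integral_eq[rotated])
    fix u :: real assume "u \<in> {0..1}"
    from *[OF this] show "1 / (1 + z * u\<^sup>2) + (2 * z) * (- u\<^sup>2 / (1 + z * u\<^sup>2)\<^sup>2) =
      (1 - z * u\<^sup>2) / (1 + z * u\<^sup>2)\<^sup>2"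
      by (simp add: divide_simps power2_eq_square)
  qed
  with 1 show ?thesis by (rule has_integral_unique[rotated])
qed

text \<open>Since 2u / (1 + z u^2)^2 is the derivative of u^2 / (1 + z u^2), its integral is 1 / (1
  + z), and the whole sum integrates 2u(1 - u) / (1 + z u^2)^2. This sign is what makes
  \<open>perp_curv_area\<close>, and with it K_i, positive.\<close>

lemma atan_quot'_gt:
  assumes "-1 < z"
  shows "0 < 1 / (1 + z) + 2 * atan_quot' z"
proof -
  have *: "1 + z * t\<^sup>2 > 0" if "t \<in> {0..1}" for t
    using one_plus_mult_square_pos[of z t] that assms by auto
  have ftc: "((\<lambda>u. 2 * u / (1 + z * u\<^sup>2)\<^sup>2) has_integral
      1\<^sup>2 / (1 + z * 1\<^sup>2) - 0\<^sup>2 / (1 + z * 0\<^sup>2)) {0..1}"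
  proof (rule fundamental_theorem_of_calculus)
    fix u :: real assume "u \<in> {0..1}"
    from *[OF this] show "((\<lambda>u. u\<^sup>2 / (1 + z * u\<^sup>2)) has_vector_derivative
        2 * u / (1 + z * u\<^sup>2)\<^sup>2) (at u within {0..1})"
      unfolding has_real_derivative_iff_has_vector_derivative[symmetric]
      by (auto intro!: derivative_eq_intros simp: field_simps power2_eq_square)
  qed auto
  let ?h = "\<lambda>u. 2 * u / (1 + z * u\<^sup>2)\<^sup>2 + 2 * (- u\<^sup>2 / (1 + z * u\<^sup>2)\<^sup>2)"
  have h: "(?h has_integral 1 / (1 + z) + 2 * atan_quot' z) {0..1}"
    using has_integral_add[OF ftc has_integral_mult_right[OF integrable_integral[OF
      atan_quot_integrable(2)[OF assms]], of 2]]
    by (simp add: atan_quot'_def)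
  have h_eq: "?h u = 2 * (u * (1 - u)) / (1 + z * u\<^sup>2)\<^sup>2" for u
    by (simp add: power2_eq_square diff_divide_distrib[symmetric] algebra_simps)
  have ge: "0 \<le> ?h u" if "u \<in> cbox 0 1" for u
    unfolding h_eq using that by auto
  have cont: "continuous_on (cbox 0 1) ?h"
    using * by (intro continuous_intros) (auto simp: less_imp_neq[THEN not_sym] power2_eq_square)
  have "1 / (1 + z) + 2 * atan_quot' z \<noteq> 0"
  proof
    assume "1 / (1 + z) + 2 * atan_quot' z = 0"
    with h have h0: "(?h has_integral 0) (cbox 0 1)" by simp
    have "?h (1/2) = 0"
      by (rule has_integral_0_cbox_imp_0[OF cont ge h0]) auto
    moreover have "?h (1/2) > 0"
      unfolding h_eq using *[of "1/2"] by (intro divide_pos_pos) auto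
    ultimately show False by linarith
  qed
  moreover have "0 \<le> 1 / (1 + z) + 2 * atan_quot' z"
    using has_integral_nonneg[OF h] ge by simp
  ultimately show ?thesis by linarith
qed

lemma atan_quot_pos:
  assumes "0 < z"
  shows "atan_quot z = arctan (sqrt z) / sqrt z"
proof -
  have "((\<lambda>u. 1 / (1 + z * u\<^sup>2)) has_integral
      arctan (sqrt z * 1) / sqrt z - arctan (sqrt z * 0) / sqrt z) {0..1}"
  proof (rule fundamental_theorem_of_calculus)
    fix u :: real
    show "((\<lambda>u. arctan (sqrt z * u) / sqrt z) has_vector_derivative 1 / (1 + z * u\<^sup>2))
        (at u within {0..1})"
      unfolding has_real_derivative_iff_has_vector_derivative[symmetric]
      using assms by (auto intro!: derivative_eq_intros simp: power_mult_distrib divide_simps)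
  qed auto
  then show ?thesis by (simp add: atan_quot_def integral_unique)
qed

lemma atan_quot_neg:
  assumes "-1 < z" "z < 0"
  shows "atan_quot z = artanh (sqrt (- z)) / sqrt (- z)"
proof -
  have "((\<lambda>u. 1 / (1 + z * u\<^sup>2)) has_integral
      artanh (sqrt (- z) * 1) / sqrt (- z) - artanh (sqrt (- z) * 0) / sqrt (- z)) {0..1}"
  proof (rule fundamental_theorem_of_calculus)
    fix u :: real assume u: "u \<in> {0..1}"
    have "sqrt (- z) < 1" using assms by simp
    moreover have "sqrt (- z) * u \<le> sqrt (- z)" "0 \<le> sqrt (- z) * u"
      using u assms by (auto intro: mult_left_le)
    ultimately have "\<bar>sqrt (- z) * u\<bar> < 1" by linarith
    then show "((\<lambda>u. artanh (sqrt (- z) * u) / sqrt (- z)) has_vector_derivative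
        1 / (1 + z * u\<^sup>2)) (at u within {0..1})"
      unfolding has_real_derivative_iff_has_vector_derivative[symmetric]
      using assms DERIV_cdivide[OF DERIV_chain2[OF artanh_real_has_field_derivative
        DERIV_cmult_Id[of "sqrt (- z)"]], where x = u and s = "{0..1}" and c = "sqrt (- z)"]
      by (simp add: power_mult_distrib mult.commute)
  qed auto
  then show ?thesis by (simp add: atan_quot_def integral_unique)
qed

lemma atan_quot_0: "atan_quot 0 = 1"
  by (simp add: atan_quot_def)

text \<open>
  The dual circle is described by \<open>y = sinh r\<close>, where \<open>r\<close> is its radius; its curvature is
  \<open>coth r = sqrt (1 + 1 / y\<^sup>2)\<close>. Then \<open>theta = pi - 2 arctan (x y)\<close>, and \<open>perp_curv x y\<close> is the total
  geodesic curvature of the arc of curvature \<open>x\<close>. The derivative of \<open>perp_curv\<close> along the vector field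
  \<open>x \<partial>\<^sub>x - y \<partial>\<^sub>y\<close>, which preserves the angle, is \<open>perp_curv_area\<close>.
\<close>

definition perp_curv :: "real \<Rightarrow> real \<Rightarrow> real" where
  "perp_curv x y =
     2 * x * (y / sqrt (1 + y\<^sup>2)) * atan_quot ((x\<^sup>2 - 1) * (y / sqrt (1 + y\<^sup>2))\<^sup>2)"

definition perp_curv_area :: "real \<Rightarrow> real \<Rightarrow> real" where
  "perp_curv_area x y =
     2 * x * (y / sqrt (1 + y\<^sup>2)) ^ 3 *
       ((1 + y\<^sup>2) / (1 + x\<^sup>2 * y\<^sup>2) + 2 * atan_quot' ((x\<^sup>2 - 1) * (y / sqrt (1 + y\<^sup>2))\<^sup>2))"

text \<open>\<open>y / sqrt (1 + y\<^sup>2)\<close> is tanh r, the reciprocal of the dual curvature.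
  The identity keeps the argument of \<open>atan_quot\<close> above -1 for all real x and y.\<close>

lemma one_plus_arg:
  fixes x y :: real
  shows "1 + (x\<^sup>2 - 1) * (y / sqrt (1 + y\<^sup>2))\<^sup>2 = (1 + x\<^sup>2 * y\<^sup>2) / (1 + y\<^sup>2)"
proof -
  have "1 + y\<^sup>2 > 0" by (simp add: add_pos_nonneg)
  then show ?thesis by (simp add: power_divide field_simps)
qed

lemma arg_gt:
  fixes x y :: real
  shows "-1 < (x\<^sup>2 - 1) * (y / sqrt (1 + y\<^sup>2))\<^sup>2"
proof -
  have "0 < (1 + x\<^sup>2 * y\<^sup>2) / (1 + y\<^sup>2)"
    by (intro divide_pos_pos add_pos_nonneg) auto
  then show ?thesis using one_plus_arg[of x y] by linarith
qed

lemma perp_curv_area_pos: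
  assumes "0 < x" "0 < y"
  shows "0 < perp_curv_area x y"
proof -
  have "0 < 1 / ((1 + x\<^sup>2 * y\<^sup>2) / (1 + y\<^sup>2)) + 2 * atan_quot' ((x\<^sup>2 - 1) * (y / sqrt (1 + y\<^sup>2))\<^sup>2)"
    using atan_quot'_gt[OF arg_gt[of x y]] unfolding one_plus_arg .
  moreover have "0 < y / sqrt (1 + y\<^sup>2)"
    using assms by (intro divide_pos_pos) (auto simp: add_pos_nonneg)
  ultimately show ?thesis
    unfolding perp_curv_area_def using assms by simp
qed

text \<open>The terms are grouped for later use: beside \<open>perp_curv_area\<close> stands 1 /
  cosh r = 1 / sqrt (1 + y^2) times the derivative of the angle 2 arctan (x y). In the direction x'
  = x, y' = -y the angle is constant and only the area term survives.\<close>

lemma DERIV_perp_curv: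
  fixes x y :: "real \<Rightarrow> real"
  assumes x: "(x has_real_derivative x') (at t within T)"
    and y: "(y has_real_derivative y') (at t within T)"
    and pos: "0 < x t"
  shows "((\<lambda>t. perp_curv (x t) (y t)) has_real_derivative
      (perp_curv_area (x t) (y t) + 2 * x t * y t / ((1 + (x t)\<^sup>2 * (y t)\<^sup>2) * sqrt (1 + (y t)\<^sup>2))) / x t * x'
      + 2 * x t / ((1 + (x t)\<^sup>2 * (y t)\<^sup>2) * sqrt (1 + (y t)\<^sup>2)) * y') (at t within T)"
proof -
  define X Y r e z where "X = x t" and "Y = y t" and "r = sqrt (1 + Y\<^sup>2)" and "e = Y / r"
    and "z = (X\<^sup>2 - 1) * e\<^sup>2"
  have r: "0 < r" "r\<^sup>2 = 1 + Y\<^sup>2" by (auto simp: r_def add_pos_nonneg)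
  have z: "1 + z = (1 + X\<^sup>2 * Y\<^sup>2) / r\<^sup>2" "-1 < z"
    using one_plus_arg[of X Y] arg_gt[of X Y] r(2) by (auto simp: z_def e_def r_def)
  have D: "0 < 1 + X\<^sup>2 * Y\<^sup>2" by (simp add: add_pos_nonneg)
  have ode: "atan_quot z = r\<^sup>2 / (1 + X\<^sup>2 * Y\<^sup>2) - 2 * z * atan_quot' z"
    using atan_quot_ode[OF z(2)] unfolding z(1) by simp
  have e: "((\<lambda>t. y t / sqrt (1 + (y t)\<^sup>2)) has_real_derivative y' / r ^ 3) (at t within T)"
  proof -
    have pos: "0 < 1 + (y t)\<^sup>2" by (simp add: add_pos_nonneg)
    have "((\<lambda>t. sqrt (1 + (y t)\<^sup>2)) has_real_derivative Y * y' / r) (at t within T)"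
    proof -
      have "((\<lambda>t. 1 + (y t)\<^sup>2) has_real_derivative 2 * Y * y') (at t within T)"
        by (rule derivative_eq_intros y refl)+ (simp add: Y_def)
      from DERIV_chain2[OF DERIV_real_sqrt[OF pos] this] show ?thesis
        by (simp add: Y_def[symmetric] r_def[symmetric] field_simps)
    qed
    from DERIV_divide[OF y this] have "((\<lambda>t. y t / sqrt (1 + (y t)\<^sup>2)) has_real_derivative
        (y' * r - Y * (Y * y' / r)) / (r * r)) (at t within T)"
      using r by (simp add: Y_def[symmetric] r_def[symmetric])
    moreover have "(y' * r - Y * (Y * y' / r)) / (r * r) = y' * (r\<^sup>2 - Y\<^sup>2) / r ^ 3"
      using r(1) by (simp add: field_simps power2_eq_square power3_eq_cube)
    ultimately show ?thesis using r(2) by simp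
  qed
  have "((\<lambda>t. perp_curv (x t) (y t)) has_real_derivative
      (2 * x') * e * atan_quot z + 2 * X * (y' / r ^ 3) * atan_quot z
      + 2 * X * e * (atan_quot' z * (2 * X * x' * e\<^sup>2 + (X\<^sup>2 - 1) * (2 * e * (y' / r ^ 3)))))
      (at t within T)"
  proof -
    define E where "E = (\<lambda>t. y t / sqrt (1 + (y t)\<^sup>2))"
    have E: "(E has_real_derivative y' / r ^ 3) (at t within T)" "E t = e"
      using e by (auto simp: E_def e_def Y_def r_def)
    have "((\<lambda>t. ((x t)\<^sup>2 - 1) * (E t)\<^sup>2) has_real_derivative
        2 * X * x' * e\<^sup>2 + (X\<^sup>2 - 1) * (2 * e * (y' / r ^ 3))) (at t within T)"
      by (rule derivative_eq_intros x E(1) refl)+ (simp add: E(2) X_def algebra_simps)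
    note DERIV_atan_quot[OF this]
    moreover have "((\<lambda>t. 2 * x t * E t) has_real_derivative (2 * x') * e + 2 * X * (y' / r ^ 3))
        (at t within T)"
      by (rule derivative_eq_intros x E(1) refl)+ (simp add: E(2) X_def algebra_simps)
    ultimately have "((\<lambda>t. 2 * x t * E t * atan_quot (((x t)\<^sup>2 - 1) * (E t)\<^sup>2)) has_real_derivative
        ((2 * x') * e + 2 * X * (y' / r ^ 3)) * atan_quot z
        + (atan_quot' z * (2 * X * x' * e\<^sup>2 + (X\<^sup>2 - 1) * (2 * e * (y' / r ^ 3)))) * (2 * X * e))
      (at t within T)"
      using z(2) DERIV_mult by (fastforce simp: E(2) z_def X_def)
    moreover have "(\<lambda>t. perp_curv (x t) (y t)) =
        (\<lambda>t. 2 * x t * E t * atan_quot (((x t)\<^sup>2 - 1) * (E t)\<^sup>2))"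
      by (simp add: perp_curv_def E_def)
    ultimately show ?thesis
      by (auto elim!: DERIV_cong simp: algebra_simps diff_divide_distrib)
  qed
  moreover have "(2 * x') * e * atan_quot z + 2 * X * (y' / r ^ 3) * atan_quot z
      + 2 * X * e * (atan_quot' z * (2 * X * x' * e\<^sup>2 + (X\<^sup>2 - 1) * (2 * e * (y' / r ^ 3)))) =
      2 * e * x' * (atan_quot z + 2 * X\<^sup>2 * e\<^sup>2 * atan_quot' z)
      + 2 * X * (y' / r ^ 3) * (atan_quot z + 2 * z * atan_quot' z)"
  proof -
    have "(2 * x') * e * a + 2 * X * w * a + 2 * X * e * (b * (2 * X * x' * e\<^sup>2 + (X\<^sup>2 - 1) * (2 * e * w))) =
      2 * e * x' * (a + 2 * X\<^sup>2 * e\<^sup>2 * b) + 2 * X * w * (a + 2 * ((X\<^sup>2 - 1) * e\<^sup>2) * b)" for a b w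
      by (simp add: algebra_simps power2_eq_square)
    then show ?thesis unfolding z_def by blast
  qed
  \<comment> \<open>Because \<open>X\<^sup>2 * e\<^sup>2 = z + e\<^sup>2\<close>, the multiple of z
    cancels against the one in \<open>ode\<close>.\<close>
  moreover have "atan_quot z + 2 * X\<^sup>2 * e\<^sup>2 * atan_quot' z = r\<^sup>2 / (1 + X\<^sup>2 * Y\<^sup>2) + 2 * e\<^sup>2 * atan_quot' z"
    unfolding ode by (simp add: z_def algebra_simps)
  moreover have "2 * e * x' * (r\<^sup>2 / (1 + X\<^sup>2 * Y\<^sup>2) + 2 * e\<^sup>2 * atan_quot' z) =
     (perp_curv_area X Y + 2 * X * Y / ((1 + X\<^sup>2 * Y\<^sup>2) * r)) / X * x'"
  proof -
    have pc: "perp_curv_area X Y = 2 * X * e ^ 3 * (r\<^sup>2 / (1 + X\<^sup>2 * Y\<^sup>2) + 2 * atan_quot' z)"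
      unfolding perp_curv_area_def r_def[symmetric] unfolding r(2)[symmetric] e_def[symmetric] z_def[symmetric] ..
    \<comment> \<open>This is cosh^2 = 1 + sinh^2 in the form r^2 = 1 + Y^2: it splits the factor
      \<open>e ^ 3\<close> of \<open>perp_curv_area\<close> off from the angle term.\<close>
    have "e * (r\<^sup>2 / (1 + X\<^sup>2 * Y\<^sup>2)) = e ^ 3 * (r\<^sup>2 / (1 + X\<^sup>2 * Y\<^sup>2)) + Y / ((1 + X\<^sup>2 * Y\<^sup>2) * r)"
    proof -
      have "e * r\<^sup>2 = e ^ 3 * r\<^sup>2 + Y / r"
      proof -
        have "Y * r\<^sup>2 = Y * Y\<^sup>2 + Y" by (simp add: r(2) algebra_simps)
        then show ?thesis using r(1) by (simp add: e_def field_simps power2_eq_square power3_eq_cube)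
      qed
      then have "e * r\<^sup>2 / (1 + X\<^sup>2 * Y\<^sup>2) = (e ^ 3 * r\<^sup>2 + Y / r) / (1 + X\<^sup>2 * Y\<^sup>2)"
        by simp
      then show ?thesis by (simp add: add_divide_distrib mult.commute)
    qed
    moreover have "2 * e * x' * (Q + 2 * e\<^sup>2 * m) = (2 * X * e ^ 3 * (Q + 2 * m) + 2 * X * Y / P) / X * x'"
      if "e * Q = e ^ 3 * Q + Y / P" for Q P m
    proof -
      have "X \<noteq> 0" using pos by (simp add: X_def)
      then have "(2 * X * e ^ 3 * (Q + 2 * m) + 2 * X * Y / P) / X * x' =
          2 * x' * (e ^ 3 * Q + Y / P) + 4 * x' * e ^ 3 * m"
        by (simp add: add_divide_distrib algebra_simps)
      then show ?thesis
        unfolding that[symmetric] by (simp add: algebra_simps power2_eq_square power3_eq_cube)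
    qed
    ultimately show ?thesis unfolding pc by blast
  qed
  moreover have "2 * X * (y' / r ^ 3) * (atan_quot z + 2 * z * atan_quot' z) =
      2 * X / ((1 + X\<^sup>2 * Y\<^sup>2) * r) * y'"
  proof -
    have "2 * X * (y' / r ^ 3) * (r\<^sup>2 / P) = 2 * X / (P * r) * y'" for P
      using r(1) by (simp add: power2_eq_square power3_eq_cube)
    then show ?thesis unfolding ode by simp
  qed
  ultimately have "((\<lambda>t. perp_curv (x t) (y t)) has_real_derivative
      (perp_curv_area X Y + 2 * X * Y / ((1 + X\<^sup>2 * Y\<^sup>2) * r)) / X * x'
      + 2 * X / ((1 + X\<^sup>2 * Y\<^sup>2) * r) * y') (at t within T)"
    by metis
  then show ?thesis
    unfolding X_def Y_def r_def by simp
qed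

lemma perp_curv_0 [simp]: "perp_curv x 0 = 0"
  by (simp add: perp_curv_def)

lemma DERIV_perp_curv_right:
  assumes "0 < x"
  shows "(perp_curv x has_real_derivative 2 * x / ((1 + x\<^sup>2 * y\<^sup>2) * sqrt (1 + y\<^sup>2))) (at y within T)"
  using DERIV_perp_curv[of "\<lambda>_. x" 0 y T "\<lambda>t. t" 1] assms by simp

lemma perp_curv_pos:
  assumes "0 < x" "0 < y"
  shows "0 < perp_curv x y"
proof -
  have "perp_curv x 0 < perp_curv x y"
  proof (rule DERIV_pos_imp_increasing[OF assms(2)])
    fix t :: real
    have "0 < 2 * x / ((1 + x\<^sup>2 * t\<^sup>2) * sqrt (1 + t\<^sup>2))"
      using assms by (intro divide_pos_pos mult_pos_pos) (auto simp: add_pos_nonneg)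
    then show "\<exists>d. (perp_curv x has_real_derivative d) (at t) \<and> 0 < d"
      using DERIV_perp_curv_right[OF assms(1)] by blast
  qed
  then show ?thesis by simp
qed

text \<open>Both sides vanish at y = 0, and the y-derivative of the left one is smaller by the
  factor 1 / sqrt (1 + y^2). The gap is the share of the arc in the area of \<Omega>_f.\<close>

lemma perp_curv_less:
  assumes "0 < x" "0 < y"
  shows "perp_curv x y < 2 * arctan (x * y)"
proof -
  have "2 * arctan (x * 0) - perp_curv x 0 < 2 * arctan (x * y) - perp_curv x y"
  proof (rule DERIV_pos_imp_increasing_open[OF assms(2)])
    fix t :: real assume "0 < t" "t < y"
    let ?d = "2 * (x / (1 + x\<^sup>2 * t\<^sup>2)) - 2 * x / ((1 + x\<^sup>2 * t\<^sup>2) * sqrt (1 + t\<^sup>2))"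
    have D: "0 < 1 + x\<^sup>2 * t\<^sup>2" by (simp add: add_pos_nonneg)
    have "1 < sqrt (1 + t\<^sup>2)" using \<open>0 < t\<close> by simp
    then have "x / ((1 + x\<^sup>2 * t\<^sup>2) * sqrt (1 + t\<^sup>2)) < x / ((1 + x\<^sup>2 * t\<^sup>2) * 1)"
      using D assms by (intro divide_strict_left_mono mult_strict_left_mono mult_pos_pos)
        (auto simp: add_pos_nonneg)
    then have "0 < ?d" by simp
    moreover have "((\<lambda>t. 2 * arctan (x * t) - perp_curv x t) has_real_derivative ?d) (at t)"
      by (rule derivative_eq_intros DERIV_perp_curv_right assms refl)+
        (simp add: power_mult_distrib field_simps)
    ultimately show "\<exists>d. ((\<lambda>t. 2 * arctan (x * t) - perp_curv x t) has_real_derivative d) (at t) \<and> 0 < d"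
      by blast
  next
    show "continuous_on {0..y} (\<lambda>t. 2 * arctan (x * t) - perp_curv x t)"
      by (intro continuous_intros DERIV_continuous_on[OF DERIV_perp_curv_right] assms)
  qed
  then show ?thesis by simp
qed

lemma tendsto_perp_curv [tendsto_intros]:
  assumes "(x \<longlongrightarrow> a) F" "(y \<longlongrightarrow> b) F"
  shows "((\<lambda>t. perp_curv (x t) (y t)) \<longlongrightarrow> perp_curv a b) F"
  unfolding perp_curv_def
  by (intro tendsto_intros assms arg_gt) (auto simp: add_nonneg_eq_0_iff)

lemma tendsto_perp_curv_area [tendsto_intros]:
  assumes "(x \<longlongrightarrow> a) F" "(y \<longlongrightarrow> b) F"
  shows "((\<lambda>t. perp_curv_area (x t) (y t)) \<longlongrightarrow> perp_curv_area a b) F"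
  unfolding perp_curv_area_def
  by (intro tendsto_intros assms arg_gt) (auto simp: add_nonneg_eq_0_iff)

text \<open>Along t -> (t x, y / t) the product x y, hence the angle, stays fixed, and the
  derivative is \<open>perp_curv_area\<close> divided by t. This comparison drives the maximum
  principle.\<close>

lemma perp_curv_scale_less:
  assumes "0 < x" "0 < y" "1 < c"
  shows "perp_curv x y < perp_curv (c * x) (y / c)"
proof -
  have "perp_curv (1 * x) (y / 1) < perp_curv (c * x) (y / c)"
  proof (rule DERIV_pos_imp_increasing[OF assms(3)])
    fix t :: real assume "1 \<le> t" "t \<le> c"
    then have t: "0 < t" by simp
    let ?A = "perp_curv_area (t * x) (y / t)"
    have D: "((\<lambda>t. perp_curv (t * x) (y / t)) has_real_derivative
        (?A + 2 * (t * x) * (y / t) / ((1 + (t * x)\<^sup>2 * (y / t)\<^sup>2) * sqrt (1 + (y / t)\<^sup>2)))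
          / (t * x) * x
        + 2 * (t * x) / ((1 + (t * x)\<^sup>2 * (y / t)\<^sup>2) * sqrt (1 + (y / t)\<^sup>2)) * (- y / t\<^sup>2)) (at t)"
      using t assms
      by (intro DERIV_perp_curv) (auto intro!: derivative_eq_intros simp: power2_eq_square)
    have "\<And>P. (?A + 2 * (t * x) * (y / t) / P) / (t * x) * x + 2 * (t * x) / P * (- y / t\<^sup>2) = ?A / t"
      using t assms by (simp add: add_divide_distrib power2_eq_square distrib_right)
    with D have "((\<lambda>t. perp_curv (t * x) (y / t)) has_real_derivative ?A / t) (at t)"
      by metis
    moreover have "0 < ?A / t" using t assms by (simp add: perp_curv_area_pos)
    ultimately show "\<exists>d. ((\<lambda>t. perp_curv (t * x) (y / t)) has_real_derivative d) (at t) \<and> 0 < d"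
      by blast
  qed
  then show ?thesis by simp
qed

lemma perp_curv_mono:
  assumes "0 < x" "y \<le> y'"
  shows "perp_curv x y \<le> perp_curv x y'"
proof (rule DERIV_nonneg_imp_nondecreasing[OF assms(2)])
  fix t :: real
  have "0 \<le> 2 * x / ((1 + x\<^sup>2 * t\<^sup>2) * sqrt (1 + t\<^sup>2))"
    using assms by (intro divide_nonneg_nonneg mult_nonneg_nonneg) auto
  then show "\<exists>d. (perp_curv x has_real_derivative d) (at t) \<and> 0 \<le> d"
    using DERIV_perp_curv_right[OF assms(1)] by blast
qed

section \<open>The potential of a single arc\<close>

text \<open>A potential in \<open>ln x\<close>: \<open>x \<partial>\<^sub>x perp_pot = perp_curv\<close>, while \<open>\<partial>\<^sub>y perp_pot\<close> is a multiple of the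
  angle \<open>2 arctan (x y)\<close>, so that the dual circle is a critical point of \<open>face_pot\<close> below.\<close>

definition perp_pot :: "real \<Rightarrow> real \<Rightarrow> real" where
  "perp_pot x y = integral {0..y} (\<lambda>t. 2 * x * atan_quot (x\<^sup>2 * t\<^sup>2) / sqrt (1 + t\<^sup>2))"

lemma sqrt_one_plus_square_pos [simp]: "0 < sqrt (1 + (t::real)\<^sup>2)"
  by (simp add: add_pos_nonneg)

lemma sqrt_one_plus_square_neq_0 [simp]: "sqrt (1 + (t::real)\<^sup>2) \<noteq> 0"
  using sqrt_one_plus_square_pos[of t] by linarith

lemma square_prod_gt [simp]: "-1 < (x::real)\<^sup>2 * t\<^sup>2"
  by (rule less_le_trans[of _ 0]) auto

lemma perp_pot_integrand_cont:
  "continuous_on T (\<lambda>t. 2 * x * atan_quot (x\<^sup>2 * t\<^sup>2) / sqrt (1 + t\<^sup>2))"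
  unfolding continuous_on_def by (auto intro!: tendsto_intros simp: add_nonneg_eq_0_iff)

text \<open>Identifies the integrand of \<open>perp_pot\<close> as 2 arctan (x t) / (t sqrt (1 +
  t^2)); writing it with \<open>atan_quot\<close> makes it continuous at t = 0.\<close>

lemma atan_quot_square:
  assumes "0 < w"
  shows "w * atan_quot (w\<^sup>2) = arctan w"
  using assms by (simp add: atan_quot_pos)

lemma perp_pot_has_derivative_right:
  assumes "0 < y"
  shows "(perp_pot x has_real_derivative 2 * x * atan_quot (x\<^sup>2 * y\<^sup>2) / sqrt (1 + y\<^sup>2)) (at y)"
proof -
  have "(perp_pot x has_real_derivative 2 * x * atan_quot (x\<^sup>2 * y\<^sup>2) / sqrt (1 + y\<^sup>2))
      (at y within {0..y + 1})"
    unfolding perp_pot_def[abs_def]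
    by (rule integral_has_real_derivative[OF perp_pot_integrand_cont]) (use assms in auto)
  then have "(perp_pot x has_real_derivative 2 * x * atan_quot (x\<^sup>2 * y\<^sup>2) / sqrt (1 + y\<^sup>2))
      (at y within {0<..<y + 1})"
    by (rule DERIV_subset) auto
  then show ?thesis
    using assms by (simp add: at_within_open[of y "{0<..<y + 1}"])
qed

text \<open>Under the integral sign, \<open>atan_quot_ode\<close> turns the x-derivative of the
  integrand into a rational factor over the square root, which is 1 / x times the y-derivative of
  \<open>perp_curv\<close>. As \<open>perp_curv x 0\<close> vanishes, the integral is
  \<open>perp_curv x y / x\<close>.\<close>

lemma perp_pot_has_derivative_left:
  assumes "0 < x" "0 < y"
  shows "((\<lambda>x. perp_pot x y) has_real_derivative perp_curv x y / x) (at x)"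
proof -
  have "((\<lambda>x. integral (cbox 0 y) (\<lambda>t. 2 * x * atan_quot (x\<^sup>2 * t\<^sup>2) / sqrt (1 + t\<^sup>2)))
      has_real_derivative integral (cbox 0 y) (\<lambda>t. 2 / ((1 + x\<^sup>2 * t\<^sup>2) * sqrt (1 + t\<^sup>2))))
      (at x within {0<..})"
  proof (rule leibniz_rule_field_derivative)
    fix x t :: real
    have ode: "atan_quot (x\<^sup>2 * t\<^sup>2) = 1 / (1 + x\<^sup>2 * t\<^sup>2) - 2 * (x\<^sup>2 * t\<^sup>2) * atan_quot' (x\<^sup>2 * t\<^sup>2)"
      using atan_quot_ode[OF square_prod_gt[of x t]] by linarith
    show "((\<lambda>x. 2 * x * atan_quot (x\<^sup>2 * t\<^sup>2) / sqrt (1 + t\<^sup>2)) has_real_derivative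
        2 / ((1 + x\<^sup>2 * t\<^sup>2) * sqrt (1 + t\<^sup>2))) (at x within {0<..})"
    proof -
      have "((\<lambda>x. x\<^sup>2 * t\<^sup>2) has_real_derivative 2 * x * t\<^sup>2) (at x within {0<..})"
        by (auto intro!: derivative_eq_intros)
      from DERIV_cdivide[OF DERIV_mult[OF DERIV_cmult_Id[of 2] DERIV_atan_quot[OF this square_prod_gt]],
          of "sqrt (1 + t\<^sup>2)"]
      show ?thesis
      proof (rule DERIV_cong)
        have "2 * atan_quot (x\<^sup>2 * t\<^sup>2) + atan_quot' (x\<^sup>2 * t\<^sup>2) * (2 * x * t\<^sup>2) * (2 * x) =
            2 / (1 + x\<^sup>2 * t\<^sup>2)"
          unfolding ode by (simp add: algebra_simps power2_eq_square)
        then show "(2 * atan_quot (x\<^sup>2 * t\<^sup>2) + atan_quot' (x\<^sup>2 * t\<^sup>2) * (2 * x * t\<^sup>2) * (2 * x)) /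
            sqrt (1 + t\<^sup>2) = 2 / ((1 + x\<^sup>2 * t\<^sup>2) * sqrt (1 + t\<^sup>2))"
          by simp
      qed
    qed
  next
    fix x :: real
    show "(\<lambda>t. 2 * x * atan_quot (x\<^sup>2 * t\<^sup>2) / sqrt (1 + t\<^sup>2)) integrable_on cbox 0 y"
      by (rule integrable_continuous[OF perp_pot_integrand_cont])
  next
    have "1 + (fst p)\<^sup>2 * (snd p)\<^sup>2 \<noteq> 0" for p :: "real \<times> real"
      using square_prod_gt[of "fst p" "snd p"] by linarith
    then show "continuous_on ({0<..} \<times> cbox 0 y) (\<lambda>(x, t). 2 / ((1 + x\<^sup>2 * t\<^sup>2) * sqrt (1 + t\<^sup>2)) :: real)"
      unfolding split_beta by (intro continuous_intros) (auto simp: add_nonneg_eq_0_iff)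
  qed (use assms in auto)
  moreover have "((\<lambda>t. 2 / ((1 + x\<^sup>2 * t\<^sup>2) * sqrt (1 + t\<^sup>2))) has_integral
      perp_curv x y / x - perp_curv x 0 / x) {0..y}"
  proof (rule fundamental_theorem_of_calculus)
    fix t :: real
    show "((\<lambda>y. perp_curv x y / x) has_vector_derivative
        2 / ((1 + x\<^sup>2 * t\<^sup>2) * sqrt (1 + t\<^sup>2))) (at t within {0..y})"
      using DERIV_cdivide[OF DERIV_perp_curv_right[OF assms(1)], where c = x] assms
      unfolding has_real_derivative_iff_has_vector_derivative[symmetric] by simp
  qed (use assms in auto)
  ultimately show ?thesis
    using assms unfolding perp_pot_def
    by (simp add: at_within_open[of x "{0<..}"] integral_unique)
qed

text \<open>Both arguments move when k changes, so a total derivative is required; joint continuity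
  of the y-partial derivative is enough to obtain it from the two partial ones.\<close>

lemma perp_pot_has_derivative:
  assumes pos: "0 < a" "0 < b"
  shows "((\<lambda>(x, y). perp_pot x y) has_derivative
      (\<lambda>(tx, ty). perp_curv a b / a * tx + 2 * a * atan_quot (a\<^sup>2 * b\<^sup>2) / sqrt (1 + b\<^sup>2) * ty))
      (at (a, b))"
proof -
  let ?fy = "\<lambda>x y. blinfun_mult_right (2 * x * atan_quot (x\<^sup>2 * y\<^sup>2) / sqrt (1 + y\<^sup>2)) :: real \<Rightarrow>\<^sub>L real"
  have "((\<lambda>(x, y). perp_pot x y) has_derivative
      (\<lambda>(tx, ty). perp_curv a b / a * tx + ?fy a b ty)) (at (a, b) within {0<..} \<times> {0<..})"
  proof (rule has_derivative_partialsI)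
    show "((\<lambda>x. perp_pot x b) has_derivative (*) (perp_curv a b / a)) (at a within {0<..})"
      using perp_pot_has_derivative_left[OF pos]
      unfolding has_field_derivative_def by (rule has_derivative_at_withinI)
  next
    fix x y :: real assume "x \<in> {0<..}" "y \<in> {0<..}"
    then show "((\<lambda>y. perp_pot x y) has_derivative blinfun_apply (?fy x y)) (at y within {0<..})"
      using perp_pot_has_derivative_right[of y x]
      unfolding has_field_derivative_def
      by (auto intro: has_derivative_at_withinI)
  next
    have "(fst \<longlongrightarrow> a) (at (a, b) within {0<..} \<times> {0<..})"
      "(snd \<longlongrightarrow> b) (at (a, b) within {0<..} \<times> {0<..})"
      using tendsto_fst[OF tendsto_ident_at, of "(a, b)"]
        tendsto_snd[OF tendsto_ident_at, of "(a, b)"] by simp_all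
    then have "((\<lambda>p. 2 * fst p * atan_quot ((fst p)\<^sup>2 * (snd p)\<^sup>2) / sqrt (1 + (snd p)\<^sup>2)) \<longlongrightarrow>
        2 * a * atan_quot (a\<^sup>2 * b\<^sup>2) / sqrt (1 + b\<^sup>2))
        (at (a, b) within {0<..} \<times> {0<..})"
      by (intro tendsto_intros square_prod_gt sqrt_one_plus_square_neq_0)
    from bounded_linear.tendsto[OF bounded_linear_blinfun_mult_right this]
    show "continuous (at (a, b) within {0<..} \<times> {0<..}) (\<lambda>(x, y). ?fy x y)"
      unfolding continuous_within split_beta by simp
  qed (use pos in auto)
  moreover have "at (a, b) within {0<..} \<times> {0<..} = at (a, b)"
    using pos by (intro at_within_open) (auto intro: open_Times)
  ultimately show ?thesis by simp
qed

lemma DERIV_perp_pot: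
  fixes x y :: "real \<Rightarrow> real"
  assumes x: "(x has_real_derivative x') (at t within T)"
    and y: "(y has_real_derivative y') (at t within T)"
    and pos: "0 < x t" "0 < y t"
  shows "((\<lambda>t. perp_pot (x t) (y t)) has_real_derivative
      perp_curv (x t) (y t) / x t * x'
      + 2 * arctan (x t * y t) / (y t * sqrt (1 + (y t)\<^sup>2)) * y') (at t within T)"
proof -
  have "((\<lambda>t. (x t, y t)) has_derivative (\<lambda>h. (x' * h, y' * h))) (at t within T)"
    using x y unfolding has_field_derivative_def by (rule has_derivative_Pair)
  from has_derivative_compose[OF this perp_pot_has_derivative[OF pos]]
  have "((\<lambda>t. perp_pot (x t) (y t)) has_real_derivative
      perp_curv (x t) (y t) / x t * x'
      + 2 * x t * atan_quot ((x t)\<^sup>2 * (y t)\<^sup>2) / sqrt (1 + (y t)\<^sup>2) * y') (at t within T)"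
    unfolding has_field_derivative_def split_conv
    by (rule has_derivative_eq_rhs) (simp add: fun_eq_iff algebra_simps)
  moreover have "2 * x t * atan_quot ((x t)\<^sup>2 * (y t)\<^sup>2) / sqrt (1 + (y t)\<^sup>2) =
      2 * arctan (x t * y t) / (y t * sqrt (1 + (y t)\<^sup>2))"
  proof -
    have "arctan (x t * y t) = x t * y t * atan_quot ((x t)\<^sup>2 * (y t)\<^sup>2)"
      using atan_quot_square[of "x t * y t"] pos by (simp add: power_mult_distrib)
    then show ?thesis using pos by simp
  qed
  ultimately show ?thesis by simp
qed

lemma tendsto_perp_pot [tendsto_intros]:
  assumes "(x \<longlongrightarrow> a) F" "(y \<longlongrightarrow> b) F" "0 < a" "0 < b"
  shows "((\<lambda>t. perp_pot (x t) (y t)) \<longlongrightarrow> perp_pot a b) F"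
  using isCont_tendsto_compose[OF has_derivative_continuous[OF perp_pot_has_derivative]
      tendsto_Pair[OF assms(1,2)]] assms(3,4) by simp

lemma perp_pot_nonneg:
  assumes "0 < x"
  shows "0 \<le> perp_pot x y"
  unfolding perp_pot_def
proof (rule integral_nonneg)
  show "(\<lambda>t. 2 * x * atan_quot (x\<^sup>2 * t\<^sup>2) / sqrt (1 + t\<^sup>2)) integrable_on {0..y}"
    by (rule integrable_continuous_real[OF perp_pot_integrand_cont])
next
  fix t assume "t \<in> {0..y}"
  then have "0 \<le> atan_quot (x\<^sup>2 * t\<^sup>2)"
    using assms by (cases "t = 0") (auto simp: atan_quot_0 atan_quot_pos zero_le_arctan_iff)
  then show "0 \<le> 2 * x * atan_quot (x\<^sup>2 * t\<^sup>2) / sqrt (1 + t\<^sup>2)" using assms by simp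
qed

text \<open>With \<open>y = 1 / sinh \<rho>\<close>, the function
  \<open>perp_pot x y - pi (ln x - \<rho>) - exp (\<rho> - ln x)\<close> is nonincreasing in \<open>\<rho>\<close>.\<close>

lemma perp_pot_ge:
  assumes "0 < \<rho>"
  shows "pi * max 0 (s - \<rho>) - 1 \<le> perp_pot (exp s) (1 / sinh \<rho>)"
proof (cases "s \<le> \<rho>")
  case True
  then show ?thesis using perp_pot_nonneg[of "exp s" "1 / sinh \<rho>"] by simp
next
  case False
  let ?h = "\<lambda>r. perp_pot (exp s) (1 / sinh r) - pi * (s - r) - exp (r - s)"
  have "?h s \<le> ?h \<rho>"
  proof (rule DERIV_nonpos_imp_nonincreasing[where f = ?h])
    show "\<rho> \<le> s" using False by simp
    fix r assume "\<rho> \<le> r" "r \<le> s"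
    then have r: "0 < r" "0 < sinh r" "cosh r \<noteq> 0" using assms by auto
    have inv: "((\<lambda>r. 1 / sinh r) has_real_derivative - cosh r / (sinh r)\<^sup>2) (at r)"
      using r by (auto intro!: derivative_eq_intros simp: power2_eq_square)
    have sq: "sqrt (1 + (1 / sinh r)\<^sup>2) = cosh r / sinh r"
    proof (rule real_sqrt_unique)
      show "(cosh r / sinh r)\<^sup>2 = 1 + (1 / sinh r)\<^sup>2"
        using r by (simp add: power_divide cosh_square_eq divide_simps)
    qed (use r in auto)
    have "((\<lambda>r. perp_pot (exp s) (1 / sinh r)) has_real_derivative
        - 2 * arctan (exp s / sinh r)) (at r)"
    proof (rule DERIV_cong[OF DERIV_perp_pot[OF DERIV_const inv]])
      show "perp_curv (exp s) (1 / sinh r) / exp s * 0 + 2 * arctan (exp s * (1 / sinh r)) /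
        (1 / sinh r * sqrt (1 + (1 / sinh r)\<^sup>2)) * (- cosh r / (sinh r)\<^sup>2) = - 2 * arctan (exp s / sinh r)"
        unfolding sq using r by (simp add: power2_eq_square)
    qed (use r in auto)
    then have "(?h has_real_derivative - 2 * arctan (exp s / sinh r) + pi - exp (r - s)) (at r)"
      by (auto intro!: derivative_eq_intros)
    \<comment> \<open>The angle falls short of pi by \<open>2 * arctan (sinh r / exp s)\<close>,
      which is at most \<open>exp (r - s)\<close>. The exponential in \<open>?h\<close> absorbs this
      error; its value at r = s is the 1 lost in the bound.\<close>
    moreover have "- 2 * arctan (exp s / sinh r) + pi - exp (r - s) \<le> 0"
    proof -
      have "arctan (exp s / sinh r) = pi / 2 - arctan (sinh r / exp s)"
        using arctan_inverse[of "sinh r / exp s"] r by simp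
      moreover have "arctan (sinh r / exp s) \<le> sinh r / exp s"
        using r by (intro arctan_le_self) auto
      moreover have "sinh r / exp s \<le> exp (r - s) / 2"
        by (simp add: sinh_def exp_diff divide_simps)
      ultimately show ?thesis by linarith
    qed
    ultimately show "\<exists>d. (?h has_real_derivative d) (at r) \<and> d \<le> 0" by blast
  qed
  moreover have "0 \<le> perp_pot (exp s) (1 / sinh s)" by (simp add: perp_pot_nonneg)
  moreover have "0 < exp (\<rho> - s)" by simp
  moreover have "max 0 (s - \<rho>) = s - \<rho>" using False by simp
  moreover have "pi * (s - s) = 0" "exp (s - s) = 1" by simp_all
  ultimately show ?thesis by linarith
qed

section \<open>A single face\<close>

text \<open>With \<open>\<beta> = N(f) pi - \<alpha>\<^sub>f\<close> the equation \<open>\<Sum> theta = \<alpha>\<^sub>f\<close> for the dual circle becomes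
  \<open>\<Sum> 2 arctan (k\<^sub>v y) = \<beta>\<close>.\<close>

definition dual_sinh :: "'a set \<Rightarrow> real \<Rightarrow> ('a \<Rightarrow> real) \<Rightarrow> real" where
  "dual_sinh B \<beta> k = (THE y. 0 < y \<and> (\<Sum>v\<in>B. 2 * arctan (k v * y)) = \<beta>)"

text \<open>The derivative of the angle 2 arctan (x y) with respect to ln x, and equally with
  respect to ln y.\<close>

definition angle_rate :: "real \<Rightarrow> real \<Rightarrow> real" where
  "angle_rate x y = 2 * x * y / (1 + x\<^sup>2 * y\<^sup>2)"

definition face_pot :: "'a set \<Rightarrow> real \<Rightarrow> ('a \<Rightarrow> real) \<Rightarrow> real" where
  "face_pot B \<beta> k =
     \<beta> * arsinh (1 / dual_sinh B \<beta> k) + (\<Sum>v\<in>B. perp_pot (k v) (dual_sinh B \<beta> k))"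

lemma angle_rate_pos: "0 < x \<Longrightarrow> 0 < y \<Longrightarrow> 0 < angle_rate x y"
  by (auto simp: angle_rate_def add_pos_nonneg)

lemma tendsto_angle_rate [tendsto_intros]:
  assumes "(x \<longlongrightarrow> a) F" "(y \<longlongrightarrow> b) F"
  shows "((\<lambda>t. angle_rate (x t) (y t)) \<longlongrightarrow> angle_rate a b) F"
proof -
  have "1 + a\<^sup>2 * b\<^sup>2 \<noteq> 0" using square_prod_gt[of a b] by linarith
  then show ?thesis unfolding angle_rate_def by (intro tendsto_intros assms)
qed

lemma dual_sinh_cong: "(\<And>v. v \<in> B \<Longrightarrow> k v = k' v) \<Longrightarrow> dual_sinh B \<beta> k = dual_sinh B \<beta> k'"
  unfolding dual_sinh_def by (simp cong: sum.cong)

lemma sum_arctan_strict_mono: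
  fixes k :: "'a \<Rightarrow> real"
  assumes "finite B" "B \<noteq> {}" "\<And>v. v \<in> B \<Longrightarrow> 0 < k v" "y < y'"
  shows "(\<Sum>v\<in>B. 2 * arctan (k v * y)) < (\<Sum>v\<in>B. 2 * arctan (k v * y'))"
  using assms by (intro sum_strict_mono) (auto simp: arctan_less_iff)

text \<open>For \<beta> = N(f) pi - \<alpha>_f = (N(f) - 2) pi + Y_f the two bounds are the
  conditions on Y_f. They are the limits of the angle sum as y tends to 0 and to infinity, so they
  guarantee the dual circle.\<close>

locale face_data =
  fixes B :: "'a set" and \<beta> :: real
  assumes finite_B: "finite B" and \<beta>_pos: "0 < \<beta>" and \<beta>_less: "\<beta> < pi * real (card B)"
begin

lemma B_nonempty: "B \<noteq> {}"
  using \<beta>_pos \<beta>_less by auto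

lemma dual_sinh_ex1:
  assumes "\<And>v. v \<in> B \<Longrightarrow> 0 < k v"
  shows "\<exists>!y. 0 < y \<and> (\<Sum>v\<in>B. 2 * arctan (k v * y)) = \<beta>"
proof -
  let ?h = "\<lambda>y. \<Sum>v\<in>B. 2 * arctan (k v * y)"
  have "(?h \<longlongrightarrow> (\<Sum>v\<in>B. 2 * (pi / 2))) at_top"
  proof (intro tendsto_sum tendsto_mult_left)
    fix v assume "v \<in> B"
    then have "filterlim (\<lambda>y. k v * y) at_top at_top"
      using assms by (intro filterlim_tendsto_pos_mult_at_top[OF tendsto_const _ filterlim_ident]) auto
    then show "((\<lambda>y. arctan (k v * y)) \<longlongrightarrow> pi / 2) at_top"
      by (rule filterlim_compose[OF tendsto_arctan_at_top])
  qed
  then have "\<forall>\<^sub>F y in at_top. \<beta> < ?h y"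
    by (rule order_tendstoD) (use \<beta>_less in \<open>simp add: mult.commute\<close>)
  with eventually_gt_at_top[of 0] have "\<forall>\<^sub>F y in at_top. 0 < y \<and> \<beta> < ?h y"
    by eventually_elim simp
  then obtain b where b: "0 < b" "\<beta> < ?h b"
    by (metis (no_types, lifting) eventually_happens trivial_limit_at_top_linorder)
  have "\<exists>y. 0 \<le> y \<and> y \<le> b \<and> ?h y = \<beta>"
    by (rule IVT') (use b \<beta>_pos in \<open>auto intro!: continuous_intros\<close>)
  then obtain y where y: "0 \<le> y" "?h y = \<beta>" by blast
  have "y \<noteq> 0" using y \<beta>_pos by auto
  moreover have "y1 = y2" if "?h y1 = \<beta>" "?h y2 = \<beta>" for y1 y2
    using sum_arctan_strict_mono[OF finite_B B_nonempty, of k y1 y2]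
      sum_arctan_strict_mono[OF finite_B B_nonempty, of k y2 y1] assms that
    by (metis linorder_neqE_linordered_idom less_irrefl)
  ultimately show ?thesis using y by (metis less_le)
qed

lemma
  assumes "\<And>v. v \<in> B \<Longrightarrow> 0 < k v"
  shows dual_sinh_pos: "0 < dual_sinh B \<beta> k"
    and dual_sinh_eq: "(\<Sum>v\<in>B. 2 * arctan (k v * dual_sinh B \<beta> k)) = \<beta>"
  using theI'[OF dual_sinh_ex1[of k]] assms unfolding dual_sinh_def by auto

lemma dual_sinh_unique:
  assumes "\<And>v. v \<in> B \<Longrightarrow> 0 < k v" "0 < y" "(\<Sum>v\<in>B. 2 * arctan (k v * y)) = \<beta>"
  shows "dual_sinh B \<beta> k = y"
  unfolding dual_sinh_def
  by (rule the1_equality[OF dual_sinh_ex1]) (use assms in auto)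

lemma dual_sinh_less_iff:
  assumes "\<And>v. v \<in> B \<Longrightarrow> 0 < k v"
  shows "dual_sinh B \<beta> k < y \<longleftrightarrow> \<beta> < (\<Sum>v\<in>B. 2 * arctan (k v * y))"
    and "y < dual_sinh B \<beta> k \<longleftrightarrow> (\<Sum>v\<in>B. 2 * arctan (k v * y)) < \<beta>"
  using sum_arctan_strict_mono[OF finite_B B_nonempty, of k y "dual_sinh B \<beta> k"]
    sum_arctan_strict_mono[OF finite_B B_nonempty, of k "dual_sinh B \<beta> k" y]
    dual_sinh_eq[of k] assms
  by (metis linorder_neqE_linordered_idom less_asym)+

text \<open>By monotonicity, comparing \<open>dual_sinh\<close> with a fixed y amounts to comparing
  the angle sum at y with \<beta>. For fixed y this is an open condition on k, so continuity follows
  without solving for y.\<close>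

lemma tendsto_dual_sinh:
  assumes k: "\<And>v. v \<in> B \<Longrightarrow> ((\<lambda>s. k s v) \<longlongrightarrow> l v) A"
    and pos: "\<And>v. v \<in> B \<Longrightarrow> 0 < l v"
  shows "((\<lambda>s. dual_sinh B \<beta> (k s)) \<longlongrightarrow> dual_sinh B \<beta> l) A"
proof -
  have ev: "\<forall>\<^sub>F s in A. \<forall>v\<in>B. 0 < k s v"
    using finite_B order_tendstoD(1)[OF k pos] by (simp add: eventually_ball_finite)
  have lim: "((\<lambda>s. \<Sum>v\<in>B. 2 * arctan (k s v * y)) \<longlongrightarrow> (\<Sum>v\<in>B. 2 * arctan (l v * y))) A" for y
    by (intro tendsto_intros k)
  show ?thesis
  proof (rule order_tendstoI)
    fix y assume "y < dual_sinh B \<beta> l"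
    then have "(\<Sum>v\<in>B. 2 * arctan (l v * y)) < \<beta>" using dual_sinh_less_iff(2) pos by blast
    from order_tendstoD(2)[OF lim this] ev show "\<forall>\<^sub>F s in A. y < dual_sinh B \<beta> (k s)"
      by eventually_elim (use dual_sinh_less_iff(2) in blast)
  next
    fix y assume "dual_sinh B \<beta> l < y"
    then have "\<beta> < (\<Sum>v\<in>B. 2 * arctan (l v * y))" using dual_sinh_less_iff(1) pos by blast
    from order_tendstoD(1)[OF lim this] ev show "\<forall>\<^sub>F s in A. dual_sinh B \<beta> (k s) < y"
      by eventually_elim (use dual_sinh_less_iff(1) in blast)
  qed
qed

lemma sum_angle_rate_pos:
  assumes "\<And>v. v \<in> B \<Longrightarrow> 0 < k v"
  shows "0 < (\<Sum>v\<in>B. angle_rate (k v) (dual_sinh B \<beta> k))"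
  using assms dual_sinh_pos[of k] finite_B B_nonempty by (intro sum_pos angle_rate_pos) auto

text \<open>Implicit differentiation of \<open>dual_sinh_eq\<close>, with Caratheodory's difference quotients of
  the arctangent.\<close>

lemma DERIV_dual_sinh:
  fixes k :: "real \<Rightarrow> 'a \<Rightarrow> real"
  assumes k: "\<And>v. v \<in> B \<Longrightarrow> ((\<lambda>s. k s v) has_real_derivative k' v) (at t within T)"
    and pos: "\<And>s v. s \<in> T \<Longrightarrow> v \<in> B \<Longrightarrow> 0 < k s v" and t: "t \<in> T"
  shows "((\<lambda>s. dual_sinh B \<beta> (k s)) has_real_derivative
      - dual_sinh B \<beta> (k t) *
        ((\<Sum>v\<in>B. angle_rate (k t v) (dual_sinh B \<beta> (k t)) * (k' v / k t v)) /
         (\<Sum>v\<in>B. angle_rate (k t v) (dual_sinh B \<beta> (k t))))) (at t within T)"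
proof -
  let ?y = "\<lambda>s. dual_sinh B \<beta> (k s)" and ?F = "at t within T"
  have post: "0 < k t v" if "v \<in> B" for v using pos t that by blast
  have yt: "0 < ?y t" using dual_sinh_pos post by blast
  have k_lim: "((\<lambda>s. k s v) \<longlongrightarrow> k t v) ?F" if "v \<in> B" for v
    using DERIV_continuous[OF k[OF that]] by (simp add: continuous_within)
  have y_lim: "(?y \<longlongrightarrow> ?y t) ?F"
    by (rule tendsto_dual_sinh) (auto intro: k_lim post)
  have "\<exists>g. (\<forall>z. arctan z - arctan w = g z * (z - w)) \<and> isCont g w \<and> g w = inverse (1 + w\<^sup>2)"
    for w :: real
    using DERIV_arctan[of w] unfolding CARAT_DERIV .
  then obtain g where g: "arctan z - arctan w = g w z * (z - w)"
    "isCont (g w) w" "g w w = inverse (1 + w\<^sup>2)" for w z :: real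
    by metis
  define q where "q v s = g (k t v * ?y t) (k s v * ?y s)" for v s
  have q_lim: "(q v \<longlongrightarrow> inverse (1 + (k t v * ?y t)\<^sup>2)) ?F" if "v \<in> B" for v
    unfolding q_def
    using isCont_tendsto_compose[OF g(2) tendsto_mult[OF k_lim[OF that] y_lim]] g(3) by simp
  have den_lim: "((\<lambda>s. \<Sum>v\<in>B. q v s * k s v) \<longlongrightarrow>
      (\<Sum>v\<in>B. inverse (1 + (k t v * ?y t)\<^sup>2) * k t v)) ?F"
    by (intro tendsto_sum tendsto_mult q_lim k_lim)
  have den_pos: "0 < (\<Sum>v\<in>B. inverse (1 + (k t v * ?y t)\<^sup>2) * k t v)"
    using finite_B B_nonempty post by (intro sum_pos mult_pos_pos) (auto simp: add_pos_nonneg)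
  have "((\<lambda>s. - ?y t * (\<Sum>v\<in>B. q v s * ((k s v - k t v) / (s - t))) / (\<Sum>v\<in>B. q v s * k s v)) \<longlongrightarrow>
     - ?y t * (\<Sum>v\<in>B. inverse (1 + (k t v * ?y t)\<^sup>2) * k' v) /
       (\<Sum>v\<in>B. inverse (1 + (k t v * ?y t)\<^sup>2) * k t v)) ?F"
    using den_pos k by (intro tendsto_intros den_lim q_lim) (auto simp: has_field_derivative_iff)
  moreover have "\<forall>\<^sub>F s in ?F.
      - ?y t * (\<Sum>v\<in>B. q v s * ((k s v - k t v) / (s - t))) / (\<Sum>v\<in>B. q v s * k s v) =
      (?y s - ?y t) / (s - t)"
  proof -
    have "\<forall>\<^sub>F s in ?F. s \<in> T \<and> s \<noteq> t" by (simp add: eventually_at_filter)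
    with order_tendstoD(1)[OF den_lim den_pos] show ?thesis
    proof eventually_elim
      case (elim s)
      \<comment> \<open>Both angle sums equal \<beta>. The quotients \<open>q v s\<close> turn their
        difference into an equation linear in \<open>?y s - ?y t\<close>, which is solved exactly
        before passing to the limit.\<close>
      have "(\<Sum>v\<in>B. 2 * arctan (k s v * ?y s)) = (\<Sum>v\<in>B. 2 * arctan (k t v * ?y t))"
        using dual_sinh_eq[of "k s"] dual_sinh_eq[of "k t"] pos post elim by simp
      then have "0 = (\<Sum>v\<in>B. arctan (k s v * ?y s) - arctan (k t v * ?y t))"
        by (simp add: sum_distrib_left[symmetric] sum_subtractf)
      also have "\<dots> = (\<Sum>v\<in>B. q v s * k s v * (?y s - ?y t) + ?y t * (q v s * (k s v - k t v)))"
        unfolding g(1) q_def by (intro sum.cong) (auto simp: algebra_simps)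
      also have "\<dots> = (\<Sum>v\<in>B. q v s * k s v) * (?y s - ?y t) + ?y t * (\<Sum>v\<in>B. q v s * (k s v - k t v))"
        by (simp add: sum.distrib sum_distrib_left sum_distrib_right)
      finally have "?y s - ?y t = - ?y t * (\<Sum>v\<in>B. q v s * (k s v - k t v)) / (\<Sum>v\<in>B. q v s * k s v)"
        using elim by (simp add: field_simps)
      then show ?case
        by (simp add: sum_divide_distrib[symmetric])
    qed
  qed
  ultimately have "(?y has_real_derivative - ?y t * (\<Sum>v\<in>B. inverse (1 + (k t v * ?y t)\<^sup>2) * k' v) /
       (\<Sum>v\<in>B. inverse (1 + (k t v * ?y t)\<^sup>2) * k t v)) ?F"
    unfolding has_field_derivative_iff by (rule Lim_transform_eventually)
  moreover have "angle_rate (k t v) (?y t) = 2 * ?y t * (inverse (1 + (k t v * ?y t)\<^sup>2) * k t v)" for v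
    by (simp add: angle_rate_def power_mult_distrib field_simps)
  then have "(\<Sum>v\<in>B. angle_rate (k t v) (?y t)) = 2 * ?y t * (\<Sum>v\<in>B. inverse (1 + (k t v * ?y t)\<^sup>2) * k t v)"
    "(\<Sum>v\<in>B. angle_rate (k t v) (?y t) * (k' v / k t v)) =
      2 * ?y t * (\<Sum>v\<in>B. inverse (1 + (k t v * ?y t)\<^sup>2) * k' v)"
    using post by (auto simp: sum_distrib_left less_imp_neq[THEN not_sym] intro!: sum.cong)
  ultimately show ?thesis using yt by simp
qed

text \<open>In logarithmic speeds the dependence on the dual circle appears as the deviation of the
  speed at i from the mean weighted by \<open>angle_rate\<close>. Hence the symmetric off-diagonal
  entries a_i a_j / (cosh r * sum of a), up to sign, and hence the cancellation of these terms when
  summed over the face.\<close>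

lemma DERIV_face_curv:
  fixes k :: "real \<Rightarrow> 'a \<Rightarrow> real"
  assumes k: "\<And>v. v \<in> B \<Longrightarrow> ((\<lambda>s. k s v) has_real_derivative k' v) (at t within T)"
    and pos: "\<And>s v. s \<in> T \<Longrightarrow> v \<in> B \<Longrightarrow> 0 < k s v" and t: "t \<in> T" and i: "i \<in> B"
    and y_def: "y = dual_sinh B \<beta> (k t)"
  shows "((\<lambda>s. perp_curv (k s i) (dual_sinh B \<beta> (k s))) has_real_derivative
      perp_curv_area (k t i) y * (k' i / k t i) +
      angle_rate (k t i) y / sqrt (1 + y\<^sup>2) *
        (k' i / k t i - (\<Sum>v\<in>B. angle_rate (k t v) y * (k' v / k t v)) /
           (\<Sum>v\<in>B. angle_rate (k t v) y))) (at t within T)"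
proof -
  have post: "0 < k t v" if "v \<in> B" for v using pos t that by blast
  let ?q = "(\<Sum>v\<in>B. angle_rate (k t v) y * (k' v / k t v)) / (\<Sum>v\<in>B. angle_rate (k t v) y)"
  have "2 * k t i * y / ((1 + (k t i)\<^sup>2 * y\<^sup>2) * sqrt (1 + y\<^sup>2)) = angle_rate (k t i) y / sqrt (1 + y\<^sup>2)"
    "2 * k t i / ((1 + (k t i)\<^sup>2 * y\<^sup>2) * sqrt (1 + y\<^sup>2)) * (- y * ?q) =
      - (angle_rate (k t i) y / sqrt (1 + y\<^sup>2) * ?q)"
    by (simp_all add: angle_rate_def)
  moreover have "((\<lambda>s. dual_sinh B \<beta> (k s)) has_real_derivative - y * ?q) (at t within T)"
    unfolding y_def by (rule DERIV_dual_sinh) (use k pos t in auto)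
  from DERIV_perp_curv[where x = "\<lambda>s. k s i", OF k[OF i] this post[OF i]]
  have "((\<lambda>s. perp_curv (k s i) (dual_sinh B \<beta> (k s))) has_real_derivative
      (perp_curv_area (k t i) y + 2 * k t i * y / ((1 + (k t i)\<^sup>2 * y\<^sup>2) * sqrt (1 + y\<^sup>2))) / k t i * k' i
      + 2 * k t i / ((1 + (k t i)\<^sup>2 * y\<^sup>2) * sqrt (1 + y\<^sup>2)) * (- y * ?q)) (at t within T)"
    by (simp only: y_def)
  ultimately have "((\<lambda>s. perp_curv (k s i) (dual_sinh B \<beta> (k s))) has_real_derivative
      (perp_curv_area (k t i) y + angle_rate (k t i) y / sqrt (1 + y\<^sup>2)) / k t i * k' i
      + - (angle_rate (k t i) y / sqrt (1 + y\<^sup>2) * ?q)) (at t within T)"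
    by (simp only:)
  moreover have "(A + a) / x * x' + - (a * q) = A * (x' / x) + a * (x' / x - q)" for A a x x' q :: real
    by (simp add: algebra_simps add_divide_distrib)
  ultimately show ?thesis by (simp only:)
qed

text \<open>An envelope argument: \<open>arsinh (1 / y)\<close> has y-derivative -1 / (y sqrt (1 +
  y^2)), the negative of the factor that multiplies the angles in the y-derivative of
  \<open>perp_pot\<close>. The contributions of y' thus add up to a multiple of the angle sum minus
  \<beta>, which is zero.\<close>

lemma DERIV_face_pot:
  fixes k :: "real \<Rightarrow> 'a \<Rightarrow> real"
  assumes k: "\<And>v. v \<in> B \<Longrightarrow> ((\<lambda>s. k s v) has_real_derivative k' v) (at t within T)"
    and pos: "\<And>s v. s \<in> T \<Longrightarrow> v \<in> B \<Longrightarrow> 0 < k s v" and t: "t \<in> T"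
  shows "((\<lambda>s. face_pot B \<beta> (k s)) has_real_derivative
      (\<Sum>v\<in>B. perp_curv (k t v) (dual_sinh B \<beta> (k t)) * (k' v / k t v))) (at t within T)"
proof -
  have post: "0 < k t v" if "v \<in> B" for v using pos t that by blast
  define y where "y = dual_sinh B \<beta> (k t)"
  have y: "0 < y" unfolding y_def using dual_sinh_pos post by blast
  obtain y' where y': "((\<lambda>s. dual_sinh B \<beta> (k s)) has_real_derivative y') (at t within T)"
    using DERIV_dual_sinh[of k k' t T] k pos t by blast
  have ars: "((\<lambda>s. arsinh (1 / dual_sinh B \<beta> (k s))) has_real_derivative
      - y' / (y * sqrt (1 + y\<^sup>2))) (at t within T)"
  proof -
    have "sqrt ((1 / y)\<^sup>2 + 1) = sqrt (1 + y\<^sup>2) / y"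
      using y by (intro real_sqrt_unique) (auto simp: power_divide field_simps)
    moreover have "((\<lambda>s. 1 / dual_sinh B \<beta> (k s)) has_real_derivative - y' / (y * y)) (at t within T)"
      using DERIV_divide[OF DERIV_const y', of 1] y by (simp add: y_def)
    from DERIV_chain2[OF arsinh_real_has_field_derivative this]
    have "((\<lambda>s. arsinh (1 / dual_sinh B \<beta> (k s))) has_real_derivative
      1 / sqrt ((1 / y)\<^sup>2 + 1) * (- y' / (y * y))) (at t within T)"
      by (simp add: y_def)
    ultimately show ?thesis using y by (simp add: mult.commute)
  qed
  have "((\<lambda>s. face_pot B \<beta> (k s)) has_real_derivative
     \<beta> * (- y' / (y * sqrt (1 + y\<^sup>2))) + (\<Sum>v\<in>B. perp_curv (k t v) y / k t v * k' v
      + 2 * arctan (k t v * y) / (y * sqrt (1 + y\<^sup>2)) * y')) (at t within T)"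
    unfolding face_pot_def
  proof (intro DERIV_add DERIV_cmult ars DERIV_sum)
    fix v assume "v \<in> B"
    then show "((\<lambda>s. perp_pot (k s v) (dual_sinh B \<beta> (k s))) has_real_derivative
      perp_curv (k t v) y / k t v * k' v + 2 * arctan (k t v * y) / (y * sqrt (1 + y\<^sup>2)) * y') (at t within T)"
      using DERIV_perp_pot[OF k y'] post y by (simp add: y_def)
  qed
  moreover have "(\<Sum>v\<in>B. 2 * arctan (k t v * y) / (y * sqrt (1 + y\<^sup>2)) * y') =
      \<beta> * (y' / (y * sqrt (1 + y\<^sup>2)))"
    using dual_sinh_eq[of "k t"] post
    by (simp add: y_def[symmetric] sum_divide_distrib[symmetric] sum_distrib_right[symmetric])
  ultimately show ?thesis
    by (simp add: sum.distrib y_def[symmetric])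
qed

text \<open>The witness is given by 1 / sinh \<rho> = \<open>dual_sinh\<close>. It stays hidden
  because the layer-cake argument works with any positive \<rho>.\<close>

lemma face_pot_ge:
  obtains \<rho> where "0 < \<rho>"
    "\<beta> * \<rho> + (\<Sum>v\<in>B. pi * max 0 (s v - \<rho>)) - real (card B) \<le> face_pot B \<beta> (\<lambda>v. exp (s v))"
proof
  define y where "y = dual_sinh B \<beta> (\<lambda>v. exp (s v))"
  have y: "0 < y" unfolding y_def by (rule dual_sinh_pos) simp
  then show \<rho>: "0 < arsinh (1 / y)" by simp
  have "y = 1 / sinh (arsinh (1 / y))" using y by simp
  then have "pi * max 0 (s v - arsinh (1 / y)) - 1 \<le> perp_pot (exp (s v)) y" for v
    using perp_pot_ge[OF \<rho>, of "s v"] by simp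
  then have "(\<Sum>v\<in>B. pi * max 0 (s v - arsinh (1 / y)) - 1) \<le> (\<Sum>v\<in>B. perp_pot (exp (s v)) y)"
    by (intro sum_mono)
  then show "\<beta> * arsinh (1 / y) + (\<Sum>v\<in>B. pi * max 0 (s v - arsinh (1 / y))) - real (card B)
      \<le> face_pot B \<beta> (\<lambda>v. exp (s v))"
    by (simp add: face_pot_def y_def[symmetric] sum_subtractf)
qed

text \<open>By Gauss-Bonnet the difference of the two sides is the area of \<Omega>_f, here positive
  vertex by vertex.\<close>

lemma face_curv_sum_less:
  assumes "\<And>v. v \<in> B \<Longrightarrow> 0 < k v"
  shows "(\<Sum>v\<in>B. perp_curv (k v) (dual_sinh B \<beta> k)) < \<beta>"
  using sum_strict_mono[OF finite_B B_nonempty, of "\<lambda>v. perp_curv (k v) (dual_sinh B \<beta> k)"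
      "\<lambda>v. 2 * arctan (k v * dual_sinh B \<beta> k)"]
    perp_curv_less dual_sinh_pos[of k] dual_sinh_eq[of k] assms
  by simp

text \<open>Compare \<open>k\<close> with the scaled pattern \<open>c k'\<close>, moving \<open>y'\<close> to \<open>y' / c\<close> so that the angles are kept.\<close>

lemma face_curv_max_principle:
  assumes k': "\<And>v. v \<in> B \<Longrightarrow> 0 < k' v" and k: "\<And>v. v \<in> B \<Longrightarrow> 0 < k v"
    and le: "\<And>v. v \<in> B \<Longrightarrow> k v \<le> c * k' v" and "i \<in> B" "k i = c * k' i" "1 < c"
  shows "perp_curv (k' i) (dual_sinh B \<beta> k') < perp_curv (k i) (dual_sinh B \<beta> k)"
proof -
  let ?y = "dual_sinh B \<beta> k" and ?y' = "dual_sinh B \<beta> k'"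
  have y': "0 < ?y'" using dual_sinh_pos[of k'] k' by blast
  have "(\<Sum>v\<in>B. 2 * arctan (k v * (?y' / c))) \<le> (\<Sum>v\<in>B. 2 * arctan (k' v * ?y'))"
  proof (intro sum_mono)
    fix v assume "v \<in> B"
    then have "k v * (?y' / c) \<le> c * k' v * (?y' / c)"
      using le y' \<open>1 < c\<close> by (intro mult_right_mono) auto
    then show "2 * arctan (k v * (?y' / c)) \<le> 2 * arctan (k' v * ?y')"
      using \<open>1 < c\<close> by (simp add: arctan_le_iff)
  qed
  then have "\<not> ?y < ?y' / c"
    using dual_sinh_less_iff(1)[of k] dual_sinh_eq[of k'] k k' by simp
  then have "perp_curv (k i) (?y' / c) \<le> perp_curv (k i) ?y"
    using k \<open>i \<in> B\<close> by (intro perp_curv_mono) auto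
  moreover have "perp_curv (k' i) ?y' < perp_curv (c * k' i) (?y' / c)"
    using perp_curv_scale_less k' y' assms by blast
  ultimately show ?thesis using assms by simp
qed

end

section \<open>Agreement with the formulas for arc lengths and dual curvatures\<close>

lemma arc_length_perp_curv:
  assumes x: "0 < x" and y: "0 < y"
  shows "x * arc_length (sqrt (1 + (1 / y)\<^sup>2)) x = perp_curv x y"
proof -
  define \<kappa> where "\<kappa> = sqrt (1 + (1 / y)\<^sup>2)"
  have \<kappa>0: "0 < \<kappa>" unfolding \<kappa>_def by (rule sqrt_one_plus_square_pos)
  have e: "y / sqrt (1 + y\<^sup>2) = 1 / \<kappa>"
  proof -
    have "sqrt (1 + (1 / y)\<^sup>2) = sqrt (1 + y\<^sup>2) / y"
      using y by (intro real_sqrt_unique) (auto simp: power_divide field_simps)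
    then show ?thesis by (simp add: \<kappa>_def)
  qed
  \<comment> \<open>This quantity has the sign of x - 1, so the positive, zero and negative ranges
    of \<open>atan_quot\<close> reproduce the circle, horocycle and hypercycle branches of
    \<open>arc_length\<close>.\<close>
  have z: "(x\<^sup>2 - 1) * (y / sqrt (1 + y\<^sup>2))\<^sup>2 = (x\<^sup>2 - 1) / \<kappa>\<^sup>2"
    unfolding e by (simp add: power_divide)
  have pc: "perp_curv x y = 2 * x * (1 / \<kappa>) * atan_quot ((x\<^sup>2 - 1) / \<kappa>\<^sup>2)"
    unfolding perp_curv_def z unfolding e ..
  consider "1 < x" | "x = 1" | "x < 1" by linarith
  then have "x * arc_length \<kappa> x = perp_curv x y"
  proof cases
    case 1
    then have "1 < x\<^sup>2" by (simp add: one_less_power)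
    then have "atan_quot ((x\<^sup>2 - 1) / \<kappa>\<^sup>2) = arctan (sqrt (x\<^sup>2 - 1) / \<kappa>) / (sqrt (x\<^sup>2 - 1) / \<kappa>)"
      using \<kappa>0 by (subst atan_quot_pos) (auto simp: real_sqrt_divide)
    then show ?thesis unfolding pc using 1 \<kappa>0 by (simp add: arc_length_def)
  next
    case 2
    then show ?thesis unfolding pc by (simp add: arc_length_def atan_quot_0)
  next
    case 3
    then have "x\<^sup>2 < 1" using x by (simp add: power_less_one_iff)
    moreover have "-1 < (x\<^sup>2 - 1) / \<kappa>\<^sup>2" using arg_gt[of x y] unfolding z .
    ultimately have "atan_quot ((x\<^sup>2 - 1) / \<kappa>\<^sup>2) =
        artanh (sqrt (- ((x\<^sup>2 - 1) / \<kappa>\<^sup>2))) / sqrt (- ((x\<^sup>2 - 1) / \<kappa>\<^sup>2))"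
      using \<kappa>0 by (intro atan_quot_neg) (auto simp: divide_neg_pos)
    moreover have "sqrt (- ((x\<^sup>2 - 1) / \<kappa>\<^sup>2)) = sqrt (1 - x\<^sup>2) / \<kappa>"
      using \<kappa>0 by (simp add: real_sqrt_divide[symmetric] minus_divide_left del: real_sqrt_divide)
        (simp add: real_sqrt_divide)
    ultimately show ?thesis unfolding pc using 3 \<kappa>0 by (simp add: arc_length_def)
  qed
  then show ?thesis by (simp add: \<kappa>_def)
qed

text \<open>The substitution y = 1 / sqrt (\<kappa>^2 - 1) is a bijection from \<kappa> > 1 to y >
  0, and arctan (1 / u) = pi / 2 - arctan u turns the equation for the \<open>theta\<close> sum into
  the one defining \<open>dual_sinh\<close>. Existence and uniqueness carry over.\<close>

lemma dual_curv_eq: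
  assumes "face_data (cell_verts S V f) (real (nverts S V f) * pi - cone_angle Y f)"
    and k: "\<And>v. v \<in> cell_verts S V f \<Longrightarrow> 0 < k v"
  shows "dual_curv S V Y k f =
    sqrt (1 + (1 / dual_sinh (cell_verts S V f) (real (nverts S V f) * pi - cone_angle Y f) k)\<^sup>2)"
proof -
  let ?B = "cell_verts S V f" and ?\<beta> = "real (nverts S V f) * pi - cone_angle Y f"
  interpret face_data ?B ?\<beta> by fact
  have th: "(\<Sum>v\<in>?B. theta \<kappa> (k v)) = real (nverts S V f) * pi -
      (\<Sum>v\<in>?B. 2 * arctan (k v * (1 / sqrt (\<kappa>\<^sup>2 - 1))))" if "1 < \<kappa>" for \<kappa>
  proof -
    have s: "0 < sqrt (\<kappa>\<^sup>2 - 1)" using that by (simp add: one_less_power)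
    have "theta \<kappa> (k v) = pi - 2 * arctan (k v * (1 / sqrt (\<kappa>\<^sup>2 - 1)))" if "v \<in> ?B" for v
      using arctan_inverse[of "k v / sqrt (\<kappa>\<^sup>2 - 1)"] k[OF that] s by (simp add: theta_def)
    then show ?thesis by (simp add: sum_subtractf nverts_def)
  qed
  let ?y = "dual_sinh ?B ?\<beta> k" and ?K = "\<lambda>y. sqrt (1 + (1 / y)\<^sup>2)"
  have y: "0 < ?y" using dual_sinh_pos k by blast
  have inv: "1 / sqrt ((?K y)\<^sup>2 - 1) = y" "1 < ?K y" if "0 < y" for y
    using that by (auto simp: real_sqrt_divide power_divide)
  show ?thesis
    unfolding dual_curv_def
  proof (rule the_equality)
    show "1 < ?K ?y \<and> (\<Sum>v\<in>?B. theta (?K ?y) (k v)) = cone_angle Y f"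
      using th[of "?K ?y"] inv[OF y] dual_sinh_eq[of k] k by simp
  next
    fix \<kappa> assume \<kappa>: "1 < \<kappa> \<and> (\<Sum>v\<in>?B. theta \<kappa> (k v)) = cone_angle Y f"
    then have "0 < 1 / sqrt (\<kappa>\<^sup>2 - 1)" by (simp add: one_less_power)
    moreover have "(\<Sum>v\<in>?B. 2 * arctan (k v * (1 / sqrt (\<kappa>\<^sup>2 - 1)))) = ?\<beta>"
      using th \<kappa> by force
    ultimately have "?y = 1 / sqrt (\<kappa>\<^sup>2 - 1)" using dual_sinh_unique k by blast
    moreover have "1 < \<kappa>\<^sup>2" using \<kappa> by (simp add: one_less_power)
    ultimately show "\<kappa> = ?K ?y" using \<kappa> by simp
  qed
qed

section \<open>The potential of a circle pattern\<close>

text \<open>Building block of the layer-cake argument. Half-open steps match the strict condition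
  \<tau> < s v, and adjacent steps do not overlap at the common end.\<close>

lemma integral_step:
  fixes a b c M :: real
  assumes "0 \<le> a" "a \<le> b" "b \<le> M"
  shows "((\<lambda>\<tau>. if a \<le> \<tau> \<and> \<tau> < b then c else 0) has_integral c * (b - a)) {0..M}"
proof -
  have "((\<lambda>\<tau>. if \<tau> \<in> {a..b} then c else 0) has_integral c * (b - a)) {0..M}"
    using has_integral_restrict[of "{a..b}" "{0..M}" "\<lambda>_. c" "c * (b - a)"]
      has_integral_const_real[of c a b] assms
    by (auto simp: mult.commute)
  then show ?thesis
    by (rule has_integral_spike_finite[of "{b}", rotated 2]) auto
qed

text \<open>For p < 2 the power alone blows up at 0, but the product has absolute value |d|^(p - 1),
  which tends to 0 with d. This is where 1 < p enters.\<close>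

lemma tendsto_powr_mult_self:
  fixes d :: "'b \<Rightarrow> real"
  assumes "(d \<longlongrightarrow> l) A" "1 < p"
  shows "((\<lambda>n. \<bar>d n\<bar> powr (p - 2) * d n) \<longlongrightarrow> \<bar>l\<bar> powr (p - 2) * l) A"
proof (cases "l = 0")
  case False
  then show ?thesis by (intro tendsto_intros assms) auto
next
  case True
  have eq: "\<bar>\<bar>z\<bar> powr (p - 2) * z\<bar> = \<bar>z\<bar> powr (p - 1)" for z :: real
    by (cases "z = 0") (auto simp: abs_mult powr_mult_base mult.commute)
  have "((\<lambda>n. \<bar>d n\<bar> powr (p - 1)) \<longlongrightarrow> \<bar>0\<bar> powr (p - 1)) A"
    using assms True by (intro tendsto_powr' tendsto_rabs tendsto_const) auto
  then have "((\<lambda>n. \<bar>\<bar>d n\<bar> powr (p - 2) * d n\<bar>) \<longlongrightarrow> 0) A"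
    unfolding eq by simp
  then show ?thesis using True by (simp add: tendsto_rabs_zero_iff)
qed

text \<open>Discrete Green formula: exchanging i and j and averaging gives minus one half of the sum
  of a_ij (g_j - g_i) \<phi>(g_j - g_i).\<close>

lemma sum_antisymmetric_nonpos:
  fixes a :: "'a \<Rightarrow> 'a \<Rightarrow> real" and \<phi> :: "real \<Rightarrow> real"
  assumes sym: "\<And>i j. i \<in> V \<Longrightarrow> j \<in> V \<Longrightarrow> a i j = a j i"
    and nonneg: "\<And>i j. i \<in> V \<Longrightarrow> j \<in> V \<Longrightarrow> 0 \<le> a i j"
    and odd: "\<And>d. \<phi> (- d) = - \<phi> d" and mono: "\<And>d. 0 \<le> d * \<phi> d"
  shows "(\<Sum>i\<in>V. g i * (\<Sum>j\<in>V. a i j * \<phi> (g j - g i))) \<le> 0"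
proof -
  let ?S = "\<Sum>i\<in>V. \<Sum>j\<in>V. a i j * (g i * \<phi> (g j - g i))"
  have "?S = (\<Sum>i\<in>V. \<Sum>j\<in>V. a j i * (g j * \<phi> (g i - g j)))"
    by (rule sum.swap)
  also have "\<dots> = (\<Sum>i\<in>V. \<Sum>j\<in>V. - (a i j * (g j * \<phi> (g j - g i))))"
    using sym odd[of "g _ - g _"] by (intro sum.cong refl) (metis minus_diff_eq mult_minus_right)
  finally have "2 * ?S = (\<Sum>i\<in>V. \<Sum>j\<in>V. - (a i j * ((g j - g i) * \<phi> (g j - g i))))"
    by (simp add: sum.distrib[symmetric] sum_negf algebra_simps sum_subtractf)
  also have "\<dots> \<le> 0"
    using nonneg mono by (intro sum_nonpos) simp
  finally have "?S \<le> 0" by simp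
  then show ?thesis by (simp add: sum_distrib_left mult_ac)
qed

text \<open>Faces are indexed by a type of their own rather than identified with their vertex sets,
  because distinct faces may have the same vertices.\<close>

locale circle_pattern =
  fixes V :: "'a set" and F :: "'f set" and B :: "'f \<Rightarrow> 'a set" and \<beta> :: "'f \<Rightarrow> real"
  assumes finite_V: "finite V" and finite_F: "finite F"
    and B_subset: "\<And>f. f \<in> F \<Longrightarrow> B f \<subseteq> V"
    and face_data: "\<And>f. f \<in> F \<Longrightarrow> face_data (B f) (\<beta> f)"
begin

abbreviation faces :: "'a \<Rightarrow> 'f set" where
  "faces v \<equiv> {f \<in> F. v \<in> B f}"

text \<open>The value is sinh r for the radius r of the dual circle, not r itself.\<close>

definition rad :: "'f \<Rightarrow> ('a \<Rightarrow> real) \<Rightarrow> real" where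
  "rad f k = dual_sinh (B f) (\<beta> f) k"

definition curv :: "('a \<Rightarrow> real) \<Rightarrow> 'a \<Rightarrow> real" where
  "curv k v = (\<Sum>f\<in>faces v. perp_curv (k v) (rad f k))"

text \<open>For i different from j this is minus the derivative of \<open>curv k i\<close> with
  respect to ln k_j, as read off from \<open>DERIV_face_curv\<close>; the closed form displays its
  symmetry and sign.\<close>

definition conductance :: "('a \<Rightarrow> real) \<Rightarrow> 'a \<Rightarrow> 'a \<Rightarrow> real" where
  "conductance k i j = (\<Sum>f\<in>faces i \<inter> faces j.
     angle_rate (k i) (rad f k) * angle_rate (k j) (rad f k) /
     (sqrt (1 + (rad f k)\<^sup>2) * (\<Sum>v\<in>B f. angle_rate (k v) (rad f k))))"

definition area_rate :: "('a \<Rightarrow> real) \<Rightarrow> 'a \<Rightarrow> real" where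
  "area_rate k i = (\<Sum>f\<in>faces i. perp_curv_area (k i) (rad f k))"

lemma rad_pos: "f \<in> F \<Longrightarrow> (\<And>v. v \<in> V \<Longrightarrow> 0 < k v) \<Longrightarrow> 0 < rad f k"
  unfolding rad_def using face_data.dual_sinh_pos[OF face_data] B_subset by blast

lemma sum_angle_rate_rad_pos:
  "f \<in> F \<Longrightarrow> (\<And>v. v \<in> V \<Longrightarrow> 0 < k v) \<Longrightarrow> 0 < (\<Sum>v\<in>B f. angle_rate (k v) (rad f k))"
  unfolding rad_def using face_data.sum_angle_rate_pos[OF face_data] B_subset by blast

lemma rad_cong: "f \<in> F \<Longrightarrow> (\<And>v. v \<in> V \<Longrightarrow> k v = k' v) \<Longrightarrow> rad f k = rad f k'"
  unfolding rad_def using B_subset by (intro dual_sinh_cong) auto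

lemma curv_cong:
  "v \<in> V \<Longrightarrow> (\<And>v. v \<in> V \<Longrightarrow> k v = k' v) \<Longrightarrow> curv k v = curv k' v"
  unfolding curv_def using rad_cong[of _ k k'] by (intro sum.cong) auto

lemma conductance_cong:
  "i \<in> V \<Longrightarrow> j \<in> V \<Longrightarrow> (\<And>v. v \<in> V \<Longrightarrow> k v = k' v) \<Longrightarrow> conductance k i j = conductance k' i j"
  unfolding conductance_def using rad_cong[of _ k k'] B_subset
  by (intro sum.cong arg_cong2[where f = "(/)"] arg_cong2[where f = "(*)"]) (auto simp: subset_iff)

lemma area_rate_cong:
  "i \<in> V \<Longrightarrow> (\<And>v. v \<in> V \<Longrightarrow> k v = k' v) \<Longrightarrow> area_rate k i = area_rate k' i"
  unfolding area_rate_def using rad_cong[of _ k k'] by (intro sum.cong) auto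

lemma tendsto_rad:
  assumes "f \<in> F" "\<And>v. v \<in> V \<Longrightarrow> ((\<lambda>n. k n v) \<longlongrightarrow> l v) A" "\<And>v. v \<in> V \<Longrightarrow> 0 < l v"
  shows "((\<lambda>n. rad f (k n)) \<longlongrightarrow> rad f l) A"
  unfolding rad_def using B_subset[OF assms(1)] assms(2,3)
  by (intro face_data.tendsto_dual_sinh[OF face_data[OF assms(1)]]) auto

lemma tendsto_curv:
  assumes "i \<in> V" "\<And>v. v \<in> V \<Longrightarrow> ((\<lambda>n. k n v) \<longlongrightarrow> l v) A" "\<And>v. v \<in> V \<Longrightarrow> 0 < l v"
  shows "((\<lambda>n. curv (k n) i) \<longlongrightarrow> curv l i) A"
  unfolding curv_def using assms by (intro tendsto_intros tendsto_rad) auto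

lemma tendsto_area_rate:
  assumes "i \<in> V" "\<And>v. v \<in> V \<Longrightarrow> ((\<lambda>n. k n v) \<longlongrightarrow> l v) A" "\<And>v. v \<in> V \<Longrightarrow> 0 < l v"
  shows "((\<lambda>n. area_rate (k n) i) \<longlongrightarrow> area_rate l i) A"
  unfolding area_rate_def using assms by (intro tendsto_intros tendsto_rad) auto

lemma tendsto_conductance:
  assumes "i \<in> V" "j \<in> V" "\<And>v. v \<in> V \<Longrightarrow> ((\<lambda>n. k n v) \<longlongrightarrow> l v) A"
    "\<And>v. v \<in> V \<Longrightarrow> 0 < l v"
  shows "((\<lambda>n. conductance (k n) i j) \<longlongrightarrow> conductance l i j) A"
  unfolding conductance_def
proof (intro tendsto_sum tendsto_intros)
  fix f assume f: "f \<in> faces i \<inter> faces j"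
  show "((\<lambda>n. k n i) \<longlongrightarrow> l i) A" "((\<lambda>n. k n j) \<longlongrightarrow> l j) A" by (fact assms(3)[OF assms(1)] assms(3)[OF assms(2)])+
  show r: "((\<lambda>n. rad f (k n)) \<longlongrightarrow> rad f l) A"
    using tendsto_rad assms(3,4) f by blast
  show "((\<lambda>n. rad f (k n)) \<longlongrightarrow> rad f l) A" by (fact r)
  show "((\<lambda>n. rad f (k n)) \<longlongrightarrow> rad f l) A" by (fact r)
  show "((\<lambda>n. rad f (k n)) \<longlongrightarrow> rad f l) A" by (fact r)
  show "((\<lambda>n. k n v) \<longlongrightarrow> l v) A" if "v \<in> B f" for v
    using assms(3) that f B_subset by blast
  show "sqrt (1 + (rad f l)\<^sup>2) * (\<Sum>v\<in>B f. angle_rate (l v) (rad f l)) \<noteq> 0"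
    using sum_angle_rate_rad_pos[of f l] f assms(4) by (auto simp: add_nonneg_eq_0_iff)
qed

lemma conductance_sym: "conductance k i j = conductance k j i"
  unfolding conductance_def by (simp add: Int_commute mult.commute)

lemma conductance_nonneg:
  assumes "i \<in> V" "j \<in> V" "\<And>v. v \<in> V \<Longrightarrow> 0 < k v"
  shows "0 \<le> conductance k i j"
  unfolding conductance_def
proof (rule sum_nonneg)
  fix f assume "f \<in> faces i \<inter> faces j"
  then show "0 \<le> angle_rate (k i) (rad f k) * angle_rate (k j) (rad f k) /
     (sqrt (1 + (rad f k)\<^sup>2) * (\<Sum>v\<in>B f. angle_rate (k v) (rad f k)))"
    using sum_angle_rate_rad_pos[of f k] rad_pos[of f k] assms
    by (intro divide_nonneg_nonneg mult_nonneg_nonneg less_imp_le[OF angle_rate_pos]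
        less_imp_le[OF sqrt_one_plus_square_pos]) (auto intro: less_imp_le)
qed

lemma area_rate_pos:
  assumes "i \<in> V" "faces i \<noteq> {}" "\<And>v. v \<in> V \<Longrightarrow> 0 < k v"
  shows "0 < area_rate k i"
  unfolding area_rate_def using assms finite_F rad_pos[of _ k]
  by (intro sum_pos perp_curv_area_pos) auto

lemma area_rate_nonneg:
  assumes "i \<in> V" "\<And>v. v \<in> V \<Longrightarrow> 0 < k v"
  shows "0 \<le> area_rate k i"
proof (cases "faces i = {}")
  case True
  then show ?thesis unfolding area_rate_def by (simp only: sum.empty)
next
  case False
  then show ?thesis using area_rate_pos[of i k] assms by (auto intro: less_imp_le)
qed

lemma DERIV_face_curv_coord:
  assumes pos: "\<And>v. v \<in> V \<Longrightarrow> 0 < k v" and j: "j \<in> V" and f: "f \<in> F" and i: "i \<in> B f"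
  defines "y \<equiv> rad f k"
  defines "Q \<equiv> (if j \<in> B f then angle_rate (k j) y / (\<Sum>v\<in>B f. angle_rate (k v) y) else 0)"
  shows "((\<lambda>s. perp_curv ((k(j := s)) i) (rad f (k(j := s)))) has_real_derivative
      (if i = j then perp_curv_area (k i) y + angle_rate (k i) y / sqrt (1 + y\<^sup>2) else 0) / k j
      - angle_rate (k i) y / sqrt (1 + y\<^sup>2) * Q / k j) (at (k j))"
proof -
  have kj: "0 < k j" using pos j by blast
  \<comment> \<open>Working within {0<..} keeps the varied coordinate positive, and that set being
    open restores the two-sided derivative at the end. The terms \<open>k(j := k j)\<close> keep the
    shape of the rule until they are collapsed to k.\<close>
  have "((\<lambda>s. perp_curv ((k(j := s)) i) (dual_sinh (B f) (\<beta> f) (k(j := s)))) has_real_derivative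
      perp_curv_area ((k(j := k j)) i) y * ((if i = j then 1 else 0) / (k(j := k j)) i) +
      angle_rate ((k(j := k j)) i) y / sqrt (1 + y\<^sup>2) *
        ((if i = j then 1 else 0) / (k(j := k j)) i
          - (\<Sum>v\<in>B f. angle_rate ((k(j := k j)) v) y * ((if v = j then 1 else 0) / (k(j := k j)) v)) /
           (\<Sum>v\<in>B f. angle_rate ((k(j := k j)) v) y))) (at (k j) within {0<..})"
  proof (rule face_data.DERIV_face_curv[OF face_data[OF f]])
    show "((\<lambda>s. (k(j := s)) v) has_real_derivative (if v = j then 1 else 0)) (at (k j) within {0<..})"
      for v by (cases "v = j") auto
    show "0 < (k(j := s)) v" if "s \<in> {0<..}" "v \<in> B f" for s v
      using that pos B_subset[OF f] by (cases "v = j") auto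
    show "y = dual_sinh (B f) (\<beta> f) (k(j := k j))" by (simp add: y_def rad_def)
  qed (use kj i in auto)
  then have "((\<lambda>s. perp_curv ((k(j := s)) i) (rad f (k(j := s)))) has_real_derivative
      perp_curv_area (k i) y * ((if i = j then 1 else 0) / k i) +
      angle_rate (k i) y / sqrt (1 + y\<^sup>2) *
        ((if i = j then 1 else 0) / k i
          - (\<Sum>v\<in>B f. angle_rate (k v) y * ((if v = j then 1 else 0) / k v)) /
           (\<Sum>v\<in>B f. angle_rate (k v) y))) (at (k j) within {0<..})"
    by (simp only: fun_upd_triv rad_def)
  moreover have "(\<Sum>v\<in>B f. angle_rate (k v) y * ((if v = j then 1 else 0) / k v)) =
      (if j \<in> B f then angle_rate (k j) y / k j else 0)"
  proof -
    have "(\<Sum>v\<in>B f. angle_rate (k v) y * ((if v = j then 1 else 0) / k v)) =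
      (\<Sum>v\<in>B f. if v = j then angle_rate (k j) y / k j else 0)"
      by (intro sum.cong) auto
    then show ?thesis
      using face_data.finite_B[OF face_data[OF f]] by simp
  qed
  moreover have "at (k j) within {0<..} = at (k j)"
    using kj by (intro at_within_open) auto
  ultimately show ?thesis
    unfolding Q_def by (auto simp: algebra_simps add_divide_distrib elim!: DERIV_cong)
qed

lemma DERIV_curv_coord:
  assumes pos: "\<And>v. v \<in> V \<Longrightarrow> 0 < k v" and "i \<in> V" "j \<in> V" "i \<noteq> j"
  shows "((\<lambda>s. curv (k(j := s)) i) has_real_derivative - conductance k i j / k j) (at (k j))"
proof -
  have "((\<lambda>s. curv (k(j := s)) i) has_real_derivative
    (\<Sum>f\<in>faces i. - (angle_rate (k i) (rad f k) / sqrt (1 + (rad f k)\<^sup>2) *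
      (if j \<in> B f then angle_rate (k j) (rad f k) / (\<Sum>v\<in>B f. angle_rate (k v) (rad f k)) else 0)
      / k j))) (at (k j))"
    unfolding curv_def
  proof (rule DERIV_sum)
    fix f assume "f \<in> faces i"
    then show "((\<lambda>s. perp_curv ((k(j := s)) i) (rad f (k(j := s)))) has_real_derivative
      - (angle_rate (k i) (rad f k) / sqrt (1 + (rad f k)\<^sup>2) *
      (if j \<in> B f then angle_rate (k j) (rad f k) / (\<Sum>v\<in>B f. angle_rate (k v) (rad f k)) else 0)
      / k j)) (at (k j))"
      using DERIV_face_curv_coord[of k j f i] assms by simp
  qed
  moreover have "(\<Sum>f\<in>faces i. - (angle_rate (k i) (rad f k) / sqrt (1 + (rad f k)\<^sup>2) *
      (if j \<in> B f then angle_rate (k j) (rad f k) / (\<Sum>v\<in>B f. angle_rate (k v) (rad f k)) else 0)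
      / k j)) = - conductance k i j / k j"
  proof -
    have "(\<Sum>f\<in>faces i. - (angle_rate (k i) (rad f k) / sqrt (1 + (rad f k)\<^sup>2) *
      (if j \<in> B f then angle_rate (k j) (rad f k) / (\<Sum>v\<in>B f. angle_rate (k v) (rad f k)) else 0)
      / k j)) = (\<Sum>f\<in>faces i \<inter> faces j. - (angle_rate (k i) (rad f k) * angle_rate (k j) (rad f k) /
     (sqrt (1 + (rad f k)\<^sup>2) * (\<Sum>v\<in>B f. angle_rate (k v) (rad f k)))) / k j)"
      by (intro sum.mono_neutral_cong_right) (use finite_F in auto)
    then show ?thesis
      by (simp add: conductance_def sum_divide_distrib sum_negf)
  qed
  ultimately show ?thesis by simp
qed

text \<open>Summed over all vertices of a face, the deviations from the weighted mean cancel, so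
  only the \<open>perp_curv_area\<close> of the moved vertex remains.\<close>

lemma DERIV_area_coord:
  assumes pos: "\<And>v. v \<in> V \<Longrightarrow> 0 < k v" and "i \<in> V"
  shows "((\<lambda>s. \<Sum>f\<in>faces i. \<Sum>v\<in>B f. perp_curv ((k(i := s)) v) (rad f (k(i := s))))
      has_real_derivative area_rate k i / k i) (at (k i))"
  unfolding area_rate_def sum_divide_distrib
proof (rule DERIV_sum)
  fix f assume f: "f \<in> faces i"
  let ?y = "rad f k" and ?S = "\<Sum>v\<in>B f. angle_rate (k v) (rad f k)"
  have fin: "finite (B f)" using face_data.finite_B[OF face_data] f by blast
  have S: "0 < ?S" using sum_angle_rate_rad_pos[of f k] f pos by blast
  have "((\<lambda>s. \<Sum>v\<in>B f. perp_curv ((k(i := s)) v) (rad f (k(i := s)))) has_real_derivative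
     (\<Sum>v\<in>B f. (if v = i then perp_curv_area (k i) ?y + angle_rate (k i) ?y / sqrt (1 + ?y\<^sup>2) else 0) / k i
      - angle_rate (k v) ?y / sqrt (1 + ?y\<^sup>2) * (angle_rate (k i) ?y / ?S) / k i)) (at (k i))"
  proof (rule DERIV_sum)
    fix v assume "v \<in> B f"
    then show "((\<lambda>s. perp_curv ((k(i := s)) v) (rad f (k(i := s)))) has_real_derivative
      (if v = i then perp_curv_area (k i) ?y + angle_rate (k i) ?y / sqrt (1 + ?y\<^sup>2) else 0) / k i
      - angle_rate (k v) ?y / sqrt (1 + ?y\<^sup>2) * (angle_rate (k i) ?y / ?S) / k i) (at (k i))"
      using DERIV_face_curv_coord[of k i f v] assms f by (cases "v = i") (auto simp: mult_ac)
  qed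
  moreover have "(\<Sum>v\<in>B f. angle_rate (k v) ?y / sqrt (1 + ?y\<^sup>2) * (angle_rate (k i) ?y / ?S) / k i) =
      angle_rate (k i) ?y / sqrt (1 + ?y\<^sup>2) / k i"
  proof -
    have "(\<Sum>v\<in>B f. angle_rate (k v) ?y / sqrt (1 + ?y\<^sup>2) * (angle_rate (k i) ?y / ?S) / k i) =
      ?S / sqrt (1 + ?y\<^sup>2) * (angle_rate (k i) ?y / ?S) / k i"
      by (simp only: sum_divide_distrib sum_distrib_right)
    also have "\<dots> = angle_rate (k i) ?y / sqrt (1 + ?y\<^sup>2) / k i"
      using S by simp
    finally show ?thesis .
  qed
  ultimately show "((\<lambda>s. \<Sum>v\<in>B f. perp_curv ((k(i := s)) v) (rad f (k(i := s)))) has_real_derivative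
      perp_curv_area (k i) ?y / k i) (at (k i))"
    using f fin
    by (simp add: sum_subtractf sum_divide_distrib[symmetric] sum.delta add_divide_distrib)
qed

text \<open>At a vertex where k / k' has its maximum c > 1, \<open>face_curv_max_principle\<close>
  makes every face term strictly larger for k than for k', contradicting equal curvatures. The
  vertex must lie on some face for the strict inequality to survive summation. This takes the place
  of a convexity argument.\<close>

lemma curv_inj:
  assumes pos: "\<And>v. v \<in> V \<Longrightarrow> 0 < k v" "\<And>v. v \<in> V \<Longrightarrow> 0 < k' v"
    and eq: "\<And>v. v \<in> V \<Longrightarrow> curv k v = curv k' v"
    and faces: "\<And>v. v \<in> V \<Longrightarrow> faces v \<noteq> {}"
    and "v \<in> V"
  shows "k v = k' v"
proof -
  have le: "k v \<le> k' v"
    if pos: "\<And>v. v \<in> V \<Longrightarrow> 0 < k v" "\<And>v. v \<in> V \<Longrightarrow> 0 < k' v"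
    and eq: "\<And>v. v \<in> V \<Longrightarrow> curv k v = curv k' v" and v: "v \<in> V" for k k' v
  proof (rule ccontr)
    assume less: "\<not> k v \<le> k' v"
    define c where "c = Max ((\<lambda>v. k v / k' v) ` V)"
    have "c \<in> (\<lambda>v. k v / k' v) ` V"
      unfolding c_def using finite_V v by (intro Max_in) auto
    then obtain i where i: "i \<in> V" "c = k i / k' i" by blast
    have c: "k w / k' w \<le> c" if "w \<in> V" for w
      unfolding c_def using finite_V that by simp
    have "1 < k v / k' v" using less pos(2)[OF v] by simp
    then have "1 < c" using c[OF v] by linarith
    have "curv k' i < curv k i"
      unfolding curv_def
    proof (rule sum_strict_mono)
      fix f assume f: "f \<in> faces i"
      show "perp_curv (k' i) (rad f k') < perp_curv (k i) (rad f k)"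
        unfolding rad_def
      proof (rule face_data.face_curv_max_principle[OF face_data])
        fix w assume "w \<in> B f"
        then have w: "w \<in> V" using f B_subset by blast
        then show "k w \<le> c * k' w" using c[OF w] pos(2)[OF w] by (simp add: field_simps)
      qed (use f i pos B_subset \<open>1 < c\<close> in \<open>auto simp: less_imp_neq[THEN not_sym]\<close>)
    qed (use finite_F faces i in auto)
    then show False using eq[OF i(1)] by simp
  qed
  show ?thesis
    using le[of k k' v] le[of k' k v] assms by (metis order_antisym)
qed

text \<open>Exchanging the sums groups the arcs by faces, and on each face meeting W both bounds
  hold at once. Positivity of the arcs allows W to be enlarged to the whole face for the bound by
  \<beta>.\<close>

lemma curv_sum_less:
  assumes pos: "\<And>v. v \<in> V \<Longrightarrow> 0 < k v" and W: "W \<subseteq> V" "{f \<in> F. B f \<inter> W \<noteq> {}} \<noteq> {}"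
  shows "(\<Sum>w\<in>W. curv k w) <
    (\<Sum>f\<in>{f \<in> F. B f \<inter> W \<noteq> {}}. min (pi * real (card (W \<inter> B f))) (\<beta> f))"
proof -
  have finW: "finite W" using W finite_V finite_subset by blast
  have "(\<Sum>w\<in>W. curv k w) = (\<Sum>f\<in>F. \<Sum>w\<in>{w \<in> W. w \<in> B f}. perp_curv (k w) (rad f k))"
    unfolding curv_def using sum.swap_restrict[OF finW finite_F, of "\<lambda>w f. perp_curv (k w) (rad f k)" "\<lambda>w f. w \<in> B f"]
    by simp
  also have "\<dots> = (\<Sum>f\<in>{f \<in> F. B f \<inter> W \<noteq> {}}. \<Sum>w\<in>W \<inter> B f. perp_curv (k w) (rad f k))"
  proof (rule sum.mono_neutral_cong_right)
    show "\<forall>f\<in>F - {f \<in> F. B f \<inter> W \<noteq> {}}. (\<Sum>w\<in>{w \<in> W. w \<in> B f}. perp_curv (k w) (rad f k)) = 0"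
      by (intro ballI sum.neutral) auto
    show "(\<Sum>w\<in>{w \<in> W. w \<in> B f}. perp_curv (k w) (rad f k)) = (\<Sum>w\<in>W \<inter> B f. perp_curv (k w) (rad f k))"
      for f by (intro sum.cong) auto
  qed (use finite_F in auto)
  also have "\<dots> < (\<Sum>f\<in>{f \<in> F. B f \<inter> W \<noteq> {}}. min (pi * real (card (W \<inter> B f))) (\<beta> f))"
  proof (rule sum_strict_mono)
    fix f assume "f \<in> {f \<in> F. B f \<inter> W \<noteq> {}}"
    then have f: "f \<in> F" "W \<inter> B f \<noteq> {}" by auto
    interpret face_data "B f" "\<beta> f" using face_data f by blast
    have posB: "0 < k v" if "v \<in> B f" for v using pos B_subset f that by blast
    have y: "0 < rad f k" using rad_pos f pos by blast
    have "(\<Sum>w\<in>W \<inter> B f. perp_curv (k w) (rad f k)) < (\<Sum>w\<in>W \<inter> B f. pi)"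
    proof (rule sum_strict_mono)
      fix w assume "w \<in> W \<inter> B f"
      then show "perp_curv (k w) (rad f k) < pi"
        using perp_curv_less[of "k w" "rad f k"] posB y arctan_ubound[of "k w * rad f k"] by fastforce
    qed (use f finW in auto)
    moreover have "(\<Sum>w\<in>W \<inter> B f. perp_curv (k w) (rad f k)) \<le> (\<Sum>w\<in>B f. perp_curv (k w) (rad f k))"
      using posB y finite_B by (intro sum_mono2) (auto intro!: less_imp_le[OF perp_curv_pos])
    moreover have "\<dots> < \<beta> f"
      unfolding rad_def using face_curv_sum_less posB by blast
    ultimately show "(\<Sum>w\<in>W \<inter> B f. perp_curv (k w) (rad f k)) < min (pi * real (card (W \<inter> B f))) (\<beta> f)"
      by (simp add: mult.commute)
  qed (use finite_F W in auto)
  finally show ?thesis .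
qed

end

section \<open>The flow in logarithmic coordinates\<close>

locale prescribed_curv = circle_pattern V F B \<beta>
  for V :: "'a set" and F :: "'f set" and B :: "'f \<Rightarrow> 'a set" and \<beta> :: "'f \<Rightarrow> real" +
  fixes adj :: "'a \<Rightarrow> 'a \<Rightarrow> bool" and p :: real and Lhat :: "'a \<Rightarrow> real"
  assumes adj_sym: "adj i j \<Longrightarrow> adj j i" and p_gt: "1 < p"
    and Lhat_pos: "\<And>v. v \<in> V \<Longrightarrow> 0 < Lhat v"
begin

definition pot :: "('a \<Rightarrow> real) \<Rightarrow> real" where
  "pot s = (\<Sum>f\<in>F. face_pot (B f) (\<beta> f) (\<lambda>v. exp (s v))) - (\<Sum>v\<in>V. Lhat v * s v)"

definition grad :: "('a \<Rightarrow> real) \<Rightarrow> 'a \<Rightarrow> real" where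
  "grad s v = curv (\<lambda>v. exp (s v)) v - Lhat v"

text \<open>The Calabi field divided by k_i. It is set to 0 off V because the existence theorem
  works on functions over the whole type, whose coordinates outside V then stay constant. The power
  is multiplied by the difference first, as only this product is continuous for every p > 1.\<close>

definition log_field :: "('a \<Rightarrow> real) \<Rightarrow> 'a \<Rightarrow> real" where
  "log_field s i = (if i \<in> V then
     (\<Sum>j\<in>{j \<in> V. adj i j}. conductance (\<lambda>v. exp (s v)) i j *
       (\<bar>grad s j - grad s i\<bar> powr (p - 2) * (grad s j - grad s i)))
     - area_rate (\<lambda>v. exp (s v)) i * grad s i else 0)"

lemma grad_cong: "v \<in> V \<Longrightarrow> (\<And>v. v \<in> V \<Longrightarrow> s v = s' v) \<Longrightarrow> grad s v = grad s' v"
  unfolding grad_def by (simp cong: curv_cong)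

lemma log_field_cong:
  assumes "\<And>v. v \<in> V \<Longrightarrow> s v = s' v"
  shows "log_field s = log_field s'"
proof
  fix i
  show "log_field s i = log_field s' i"
  proof (cases "i \<in> V")
    case True
    then have "grad s v = grad s' v"
        "conductance (\<lambda>v. exp (s v)) i v = conductance (\<lambda>v. exp (s' v)) i v"
        "area_rate (\<lambda>v. exp (s v)) v = area_rate (\<lambda>v. exp (s' v)) v" if "v \<in> V" for v
      using that assms by (auto intro!: grad_cong conductance_cong area_rate_cong)
    then show ?thesis using True by (simp add: log_field_def)
  qed (simp add: log_field_def)
qed

lemma pot_cong:
  assumes "\<And>v. v \<in> V \<Longrightarrow> s v = s' v"
  shows "pot s = pot s'"
proof -
  have "face_pot (B f) (\<beta> f) (\<lambda>v. exp (s v)) = face_pot (B f) (\<beta> f) (\<lambda>v. exp (s' v))" if "f \<in> F" for f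
    using assms B_subset[OF that] rad_cong[OF that, of "\<lambda>v. exp (s v)" "\<lambda>v. exp (s' v)"]
    by (auto simp: face_pot_def rad_def intro!: sum.cong arg_cong2[where f = "(+)"])
  then show ?thesis using assms by (simp add: pot_def)
qed

lemma tendsto_exp_coord:
  "(\<And>v. v \<in> V \<Longrightarrow> ((\<lambda>n. u n v) \<longlongrightarrow> s v) A) \<Longrightarrow> v \<in> V \<Longrightarrow>
   ((\<lambda>n. exp (u n v)) \<longlongrightarrow> exp (s v :: real)) A"
  by (intro tendsto_intros)

lemma tendsto_grad:
  assumes "\<And>v. v \<in> V \<Longrightarrow> ((\<lambda>n. u n v) \<longlongrightarrow> s v) A" "i \<in> V"
  shows "((\<lambda>n. grad (u n) i) \<longlongrightarrow> grad s i) A"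
  unfolding grad_def using assms by (intro tendsto_diff tendsto_const tendsto_curv tendsto_exp_coord) auto

lemma tendsto_log_field:
  assumes "\<And>v. v \<in> V \<Longrightarrow> ((\<lambda>n. u n v) \<longlongrightarrow> s v) A"
  shows "((\<lambda>n. log_field (u n) i) \<longlongrightarrow> log_field s i) A"
proof (cases "i \<in> V")
  case True
  have e: "((\<lambda>n. exp (u n v)) \<longlongrightarrow> exp (s v)) A" if "v \<in> V" for v
    using tendsto_exp_coord assms that by blast
  have "((\<lambda>n. (\<Sum>j\<in>{j \<in> V. adj i j}. conductance (\<lambda>v. exp (u n v)) i j *
       (\<bar>grad (u n) j - grad (u n) i\<bar> powr (p - 2) * (grad (u n) j - grad (u n) i)))
     - area_rate (\<lambda>v. exp (u n v)) i * grad (u n) i) \<longlongrightarrow>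
     (\<Sum>j\<in>{j \<in> V. adj i j}. conductance (\<lambda>v. exp (s v)) i j *
       (\<bar>grad s j - grad s i\<bar> powr (p - 2) * (grad s j - grad s i)))
     - area_rate (\<lambda>v. exp (s v)) i * grad s i) A"
    using True assms e p_gt
    by (intro tendsto_diff tendsto_sum tendsto_mult tendsto_powr_mult_self tendsto_grad
        tendsto_conductance tendsto_area_rate) auto
  then show ?thesis using True by (simp add: log_field_def)
qed (simp add: log_field_def)

lemma tendsto_pot:
  assumes "\<And>v. v \<in> V \<Longrightarrow> ((\<lambda>n. u n v) \<longlongrightarrow> s v) A"
  shows "((\<lambda>n. pot (u n)) \<longlongrightarrow> pot s) A"
  unfolding pot_def face_pot_def rad_def[symmetric]
  using assms B_subset rad_pos[of _ "\<lambda>v. exp (s v)"]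
  by (intro tendsto_intros tendsto_rad tendsto_exp_coord) (auto simp: less_imp_neq[THEN not_sym])

text \<open>The gradient property is phrased along curves, with only the coordinates in V
  differentiated; this is the form in which the energy estimate uses it.\<close>

lemma DERIV_pot:
  assumes u: "\<And>v. v \<in> V \<Longrightarrow> ((\<lambda>t. u t v) has_real_derivative u' v) (at t within T)" and t: "t \<in> T"
  shows "((\<lambda>t. pot (u t)) has_real_derivative (\<Sum>v\<in>V. grad (u t) v * u' v)) (at t within T)"
proof -
  have "((\<lambda>t. pot (u t)) has_real_derivative
    (\<Sum>f\<in>F. \<Sum>v\<in>{v \<in> V. v \<in> B f}. perp_curv (exp (u t v)) (rad f (\<lambda>v. exp (u t v))) * u' v)
    - (\<Sum>v\<in>V. Lhat v * u' v)) (at t within T)"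
    unfolding pot_def
  proof (intro DERIV_diff DERIV_sum DERIV_cmult u)
    fix f assume f: "f \<in> F"
    have BV: "{v \<in> V. v \<in> B f} = B f" using B_subset[OF f] by auto
    have "((\<lambda>t. face_pot (B f) (\<beta> f) (\<lambda>v. exp (u t v))) has_real_derivative
      (\<Sum>v\<in>B f. perp_curv (exp (u t v)) (dual_sinh (B f) (\<beta> f) (\<lambda>v. exp (u t v))) *
        (exp (u t v) * u' v / exp (u t v)))) (at t within T)"
      using B_subset[OF f] t
      by (intro face_data.DERIV_face_pot[OF face_data[OF f]])
        (auto intro!: DERIV_chain2[OF DERIV_exp u])
    then show "((\<lambda>t. face_pot (B f) (\<beta> f) (\<lambda>v. exp (u t v))) has_real_derivative
      (\<Sum>v\<in>{v \<in> V. v \<in> B f}. perp_curv (exp (u t v)) (rad f (\<lambda>v. exp (u t v))) * u' v)) (at t within T)"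
      unfolding BV rad_def by simp
  qed
  moreover have "(\<Sum>f\<in>F. \<Sum>v\<in>{v \<in> V. v \<in> B f}. perp_curv (exp (u t v)) (rad f (\<lambda>v. exp (u t v))) * u' v) =
    (\<Sum>v\<in>V. curv (\<lambda>v. exp (u t v)) v * u' v)"
    unfolding curv_def sum_distrib_right
    using sum.swap_restrict[OF finite_F finite_V,
      of "\<lambda>f v. perp_curv (exp (u t v)) (rad f (\<lambda>v. exp (u t v))) * u' v" "\<lambda>f v. v \<in> B f"] by simp
  ultimately show ?thesis
    by (simp add: grad_def left_diff_distrib sum_subtractf)
qed

text \<open>Extending the neighbour sum to all of V with weight 0 off the edges makes it accessible
  to the discrete Green formula; the resulting nonpositive edge part is dropped and the area part
  kept.\<close>

lemma dissipation:
  shows "(\<Sum>i\<in>V. grad s i * log_field s i) \<le> - (\<Sum>i\<in>V. area_rate (\<lambda>v. exp (s v)) i * (grad s i)\<^sup>2)"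
proof -
  let ?\<phi> = "\<lambda>d. \<bar>d\<bar> powr (p - 2) * d :: real"
  let ?a = "\<lambda>i j. if adj i j then conductance (\<lambda>v. exp (s v)) i j else 0"
  have "(\<Sum>i\<in>V. grad s i * (\<Sum>j\<in>V. ?a i j * ?\<phi> (grad s j - grad s i))) \<le> 0"
    by (rule sum_antisymmetric_nonpos[where \<phi> = ?\<phi>])
      (use conductance_sym conductance_nonneg[of _ _ "\<lambda>v. exp (s v)"] adj_sym in \<open>auto simp: mult.left_commute[of _ "_ powr _"]\<close>)
  moreover have "log_field s i = (\<Sum>j\<in>V. ?a i j * ?\<phi> (grad s j - grad s i))
      - area_rate (\<lambda>v. exp (s v)) i * grad s i" if "i \<in> V" for i
  proof -
    have "(\<Sum>j\<in>V. ?a i j * ?\<phi> (grad s j - grad s i)) =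
      (\<Sum>j\<in>{j \<in> V. adj i j}. conductance (\<lambda>v. exp (s v)) i j * ?\<phi> (grad s j - grad s i))"
      by (intro sum.mono_neutral_cong_right) (use finite_V in auto)
    then show ?thesis using that by (simp add: log_field_def)
  qed
  then have "(\<Sum>i\<in>V. grad s i * log_field s i) =
    (\<Sum>i\<in>V. grad s i * (\<Sum>j\<in>V. ?a i j * ?\<phi> (grad s j - grad s i)))
    - (\<Sum>i\<in>V. area_rate (\<lambda>v. exp (s v)) i * (grad s i)\<^sup>2)"
    by (simp add: right_diff_distrib sum_subtractf power2_eq_square mult_ac)
  ultimately show ?thesis by simp
qed

context
  assumes admissible: "\<And>W. W \<subseteq> V \<Longrightarrow> W \<noteq> {} \<Longrightarrow>
    (\<Sum>w\<in>W. Lhat w) < (\<Sum>f\<in>{f \<in> F. B f \<inter> W \<noteq> {}}. min (pi * real (card (W \<inter> B f))) (\<beta> f))"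
begin

lemma faces_nonempty:
  assumes "v \<in> V"
  shows "faces v \<noteq> {}"
proof
  assume "faces v = {}"
  then have "{f \<in> F. B f \<inter> {v} \<noteq> {}} = {}" by auto
  then have "(\<Sum>w\<in>{v}. Lhat w) < 0"
    using admissible[of "{v}"] assms by (simp only: sum.empty) simp
  then show False using Lhat_pos[OF assms] by simp
qed

lemma area_rate_exp_pos: "i \<in> V \<Longrightarrow> 0 < area_rate (\<lambda>v. exp (s v)) i"
  using area_rate_pos[of i] faces_nonempty by simp

lemma grad_eq_0:
  assumes "0 \<le> (\<Sum>i\<in>V. grad s i * log_field s i)" "i \<in> V"
  shows "grad s i = 0"
proof -
  have nn: "0 \<le> area_rate (\<lambda>v. exp (s v)) i * (grad s i)\<^sup>2" if "i \<in> V" for i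
    using area_rate_exp_pos[OF that, of s] by simp
  have "(\<Sum>i\<in>V. area_rate (\<lambda>v. exp (s v)) i * (grad s i)\<^sup>2) \<le> 0"
    using assms dissipation[of s] by linarith
  then have "(\<Sum>i\<in>V. area_rate (\<lambda>v. exp (s v)) i * (grad s i)\<^sup>2) = 0"
    using nn by (intro order_antisym sum_nonneg) auto
  then have "area_rate (\<lambda>v. exp (s v)) i * (grad s i)\<^sup>2 = 0"
    using sum_nonneg_eq_0_iff[OF finite_V nn] assms(2) by simp
  then show ?thesis using area_rate_exp_pos[OF assms(2), of s] by simp
qed

lemma grad_inj:
  assumes "\<And>v. v \<in> V \<Longrightarrow> grad s v = 0" "\<And>v. v \<in> V \<Longrightarrow> grad s' v = 0" "v \<in> V"
  shows "s v = s' v"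
  using curv_inj[of "\<lambda>v. exp (s v)" "\<lambda>v. exp (s' v)" v] faces_nonempty assms by (simp add: grad_def)

text \<open>Layer-cake argument: with \<open>W \<tau> = {v \<in> V. \<tau> < s v}\<close> the bound of \<open>face_pot_ge\<close> dominates the
  integral over \<open>\<tau> \<ge> 0\<close> of the right-hand side of the admissibility condition for \<open>W \<tau>\<close>.\<close>

lemma pot_coercive:
  obtains \<epsilon> C where "0 < \<epsilon>" "\<And>s v. v \<in> V \<Longrightarrow> \<epsilon> * \<bar>s v\<bar> \<le> pot s + C"
proof (cases "V = {}")
  case True
  then show ?thesis using that[of 1 0] by simp
next
  case False
  define h where "h f W = min (pi * real (card (W \<inter> B f))) (\<beta> f)" for f W
  define slack where "slack W = (\<Sum>f\<in>F. h f W) - (\<Sum>w\<in>W. Lhat w)" for W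
  \<comment> \<open>A face missing W contributes min 0 \<beta> = 0. Summing over all faces makes the
    index set independent of W, which varies with \<tau> below.\<close>
  have h_outside: "(\<Sum>f\<in>{f \<in> F. B f \<inter> W \<noteq> {}}. h f W) = (\<Sum>f\<in>F. h f W)" for W
    using face_data.\<beta>_pos[OF face_data] finite_F
    by (intro sum.mono_neutral_left) (auto simp: h_def Int_commute less_imp_le)
  have slack_pos: "0 < slack W" if "W \<subseteq> V" "W \<noteq> {}" for W
    using admissible[OF that] h_outside[of W] by (simp add: slack_def h_def)
  have finP: "finite (Pow V - {{}})" "Pow V - {{}} \<noteq> {}" using finite_V False by auto
  define \<epsilon>1 where "\<epsilon>1 = Min (slack ` (Pow V - {{}}))"
  have \<epsilon>1: "0 < \<epsilon>1" unfolding \<epsilon>1_def using finP slack_pos by (subst Min_gr_iff) auto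
  have \<epsilon>1_le: "\<epsilon>1 \<le> slack W" if "W \<subseteq> V" "W \<noteq> {}" for W
    unfolding \<epsilon>1_def using finP that by (intro Min_le) auto
  define \<epsilon>2 where "\<epsilon>2 = Min (Lhat ` V)"
  have \<epsilon>2: "0 < \<epsilon>2" "\<And>v. v \<in> V \<Longrightarrow> \<epsilon>2 \<le> Lhat v"
    unfolding \<epsilon>2_def using finite_V False Lhat_pos by auto
  define C where "C = (\<Sum>f\<in>F. real (card (B f)))"
  have "min \<epsilon>1 \<epsilon>2 * \<bar>s v\<bar> \<le> pot s + C" if v: "v \<in> V" for s v
  proof -
    have "\<exists>\<rho>. 0 < \<rho> \<and> \<beta> f * \<rho> + (\<Sum>v\<in>B f. pi * max 0 (s v - \<rho>)) - real (card (B f))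
        \<le> face_pot (B f) (\<beta> f) (\<lambda>v. exp (s v))" if "f \<in> F" for f
      using face_data.face_pot_ge[OF face_data[OF that]] by metis
    then obtain \<rho> where \<rho>: "\<And>f. f \<in> F \<Longrightarrow> 0 < \<rho> f"
      "\<And>f. f \<in> F \<Longrightarrow> \<beta> f * \<rho> f + (\<Sum>v\<in>B f. pi * max 0 (s v - \<rho> f)) - real (card (B f))
        \<le> face_pot (B f) (\<beta> f) (\<lambda>v. exp (s v))"
      by metis
    obtain M where M: "\<And>v. v \<in> V \<Longrightarrow> max 0 (s v) \<le> M" "\<And>f. f \<in> F \<Longrightarrow> \<rho> f \<le> M"
    proof -
      let ?X = "(\<lambda>v. max 0 (s v)) ` V \<union> \<rho> ` F"
      have "finite ?X" using finite_V finite_F by simp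
      then have "x \<le> Max ?X" if "x \<in> ?X" for x using that by (rule Max_ge)
      then show ?thesis using that[of "Max ?X"] by blast
    qed
    let ?step = "\<lambda>a b c \<tau>. if a \<le> \<tau> \<and> \<tau> < b then c else (0::real)"
    \<comment> \<open>As long as \<tau> < s v, the set W is nonempty and its admissibility
      inequality has room for the extra \<epsilon>1. Integrated over \<tau>, this gives the gain
      \<epsilon>1 * max 0 (s v).\<close>
    let ?lo = "\<lambda>\<tau>. (\<Sum>w\<in>V. ?step 0 (max 0 (s w)) (Lhat w) \<tau>) + ?step 0 (max 0 (s v)) \<epsilon>1 \<tau>"
    \<comment> \<open>The threshold \<rho> f decides which entry of the min is used: \<beta> f below
      it, pi for each vertex with \<tau> < s u above it. Either one dominates
      \<open>h f W\<close>.\<close>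
    let ?hi = "\<lambda>\<tau>. \<Sum>f\<in>F. ?step 0 (\<rho> f) (\<beta> f) \<tau> +
      (\<Sum>u\<in>B f. ?step (\<rho> f) (max (\<rho> f) (s u)) pi \<tau>)"
    have lo: "(?lo has_integral (\<Sum>w\<in>V. Lhat w * (max 0 (s w) - 0)) + \<epsilon>1 * (max 0 (s v) - 0)) {0..M}"
      using M v by (intro has_integral_add has_integral_sum finite_V integral_step) auto
    have hi: "(?hi has_integral (\<Sum>f\<in>F. \<beta> f * (\<rho> f - 0) + (\<Sum>u\<in>B f. pi * (max (\<rho> f) (s u) - \<rho> f)))) {0..M}"
    proof (intro has_integral_add has_integral_sum finite_F integral_step)
      fix f assume f: "f \<in> F"
      show "finite (B f)" using face_data.finite_B[OF face_data[OF f]] .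
      show "\<rho> f \<le> M" "0 \<le> \<rho> f" using M \<rho> f by (auto intro: less_imp_le)
      fix u assume "u \<in> B f"
      then have "u \<in> V" using B_subset f by blast
      then show "max (\<rho> f) (s u) \<le> M" using M f by fastforce
    qed (use \<rho> in \<open>auto intro: less_imp_le\<close>)
    have "?lo \<tau> \<le> ?hi \<tau>" if "\<tau> \<in> {0..M}" for \<tau>
    proof -
      define W where "W = {w \<in> V. \<tau> < s w}"
      have \<tau>: "0 \<le> \<tau>" using that by simp
      have "(\<Sum>w\<in>V. ?step 0 (max 0 (s w)) (Lhat w) \<tau>) = (\<Sum>w\<in>W. Lhat w)"
        unfolding W_def using \<tau> finite_V by (intro sum.mono_neutral_cong_right) auto
      moreover have "(\<Sum>w\<in>W. Lhat w) + ?step 0 (max 0 (s v)) \<epsilon>1 \<tau> \<le> (\<Sum>f\<in>F. h f W)"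
      proof (cases "W = {}")
        case True
        then have "\<not> \<tau> < max 0 (s v)" using v \<tau> by (auto simp: W_def)
        moreover have "0 \<le> h f W" if "f \<in> F" for f
          using face_data.\<beta>_pos[OF face_data[OF that]] by (simp add: h_def)
        ultimately show ?thesis using True by (simp add: sum_nonneg)
      next
        case False
        have "\<epsilon>1 \<le> slack W" using \<epsilon>1_le[of W] False by (auto simp: W_def)
        then show ?thesis using \<epsilon>1 by (simp add: slack_def)
      qed
      moreover have "h f W \<le> ?step 0 (\<rho> f) (\<beta> f) \<tau> + (\<Sum>u\<in>B f. ?step (\<rho> f) (max (\<rho> f) (s u)) pi \<tau>)"
        if f: "f \<in> F" for f
      proof (cases "\<tau> < \<rho> f")
        case True
        then show ?thesis using \<tau> by (simp add: h_def)
      next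
        case False
        have "(\<Sum>u\<in>B f. ?step (\<rho> f) (max (\<rho> f) (s u)) pi \<tau>) = (\<Sum>u\<in>W \<inter> B f. pi)"
          unfolding W_def using False B_subset[OF f] face_data.finite_B[OF face_data[OF f]]
          by (intro sum.mono_neutral_cong_right) auto
        then show ?thesis using False by (simp add: h_def mult.commute)
      qed
      then have "(\<Sum>f\<in>F. h f W) \<le> ?hi \<tau>" by (intro sum_mono)
      ultimately show ?thesis by linarith
    qed
    from has_integral_le[OF lo hi this]
    have 1: "(\<Sum>w\<in>V. Lhat w * max 0 (s w)) + \<epsilon>1 * max 0 (s v) \<le>
        (\<Sum>f\<in>F. \<beta> f * \<rho> f + (\<Sum>u\<in>B f. pi * (max (\<rho> f) (s u) - \<rho> f)))"
      by simp
    have "max (\<rho> f) (s u) - \<rho> f = max 0 (s u - \<rho> f)" for f u by simp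
    then have "(\<Sum>f\<in>F. \<beta> f * \<rho> f + (\<Sum>u\<in>B f. pi * (max (\<rho> f) (s u) - \<rho> f)) - real (card (B f)))
        \<le> (\<Sum>f\<in>F. face_pot (B f) (\<beta> f) (\<lambda>v. exp (s v)))"
      using \<rho>(2) by (intro sum_mono) simp
    with 1 have 2: "(\<Sum>w\<in>V. Lhat w * max 0 (s w)) + \<epsilon>1 * max 0 (s v) - C \<le>
        (\<Sum>f\<in>F. face_pot (B f) (\<beta> f) (\<lambda>v. exp (s v)))"
      by (simp add: C_def sum_subtractf)
    \<comment> \<open>Negative coordinates are controlled by the linear term itself, since every
      Lhat w is positive.\<close>
    have "(\<Sum>w\<in>V. Lhat w * s w) = (\<Sum>w\<in>V. Lhat w * max 0 (s w)) - (\<Sum>w\<in>V. Lhat w * max 0 (- s w))"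
      unfolding sum_subtractf[symmetric] by (intro sum.cong refl) (auto simp: max_def)
    moreover have "Lhat v * max 0 (- s v) \<le> (\<Sum>w\<in>V. Lhat w * max 0 (- s w))"
      using v finite_V Lhat_pos by (intro member_le_sum) (auto simp: less_imp_le)
    ultimately have "\<epsilon>1 * max 0 (s v) + Lhat v * max 0 (- s v) \<le> pot s + C"
      using 2 by (simp add: pot_def)
    moreover have "min \<epsilon>1 \<epsilon>2 * max 0 (s v) \<le> \<epsilon>1 * max 0 (s v)"
      by (intro mult_right_mono) auto
    moreover have "min \<epsilon>1 \<epsilon>2 * max 0 (- s v) \<le> Lhat v * max 0 (- s v)"
      using \<epsilon>2(2)[OF v] by (intro mult_right_mono) auto
    moreover have "\<bar>s v\<bar> = max 0 (s v) + max 0 (- s v)" by auto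
    ultimately show ?thesis by (simp add: distrib_left)
  qed
  moreover have "0 < min \<epsilon>1 \<epsilon>2" using \<epsilon>1 \<epsilon>2 by simp
  ultimately show ?thesis using that by blast
qed

end

end

section \<open>Peano's theorem\<close>

lemma tendsto_fun:
  fixes w :: "'b \<Rightarrow> 'a \<Rightarrow> 'c::topological_space"
  assumes "\<And>v. ((\<lambda>n. w n v) \<longlongrightarrow> s v) A"
  shows "(w \<longlongrightarrow> s) A"
proof -
  have "limitin (product_topology (\<lambda>_. euclidean) UNIV) w s A"
    unfolding limitin_componentwise using assms by simp
  then show ?thesis by (simp add: euclidean_product_topology)
qed

text \<open>Arzela-Ascoli is applied to one coordinate at a time, refining the subsequence at each
  step of the induction on V. Pointwise convergence is recorded because dominated convergence asks
  for no more.\<close>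

lemma Lipschitz_convergent_subseq:
  fixes u :: "nat \<Rightarrow> real \<Rightarrow> 'a \<Rightarrow> real"
  assumes "finite V" "0 \<le> M"
    and u0: "\<And>n v. u n 0 v = s0 v"
    and lip: "\<And>n v t t'. t \<in> {0..1} \<Longrightarrow> t' \<in> {0..1} \<Longrightarrow> \<bar>u n t v - u n t' v\<bar> \<le> M * \<bar>t - t'\<bar>"
  shows "\<exists>r l. strict_mono (r :: nat \<Rightarrow> nat) \<and>
    (\<forall>v\<in>V. \<forall>t\<in>{0..1}. (\<lambda>n. u (r n) t v) \<longlonglongrightarrow> l t v)"
  using assms(1)
proof induction
  case empty
  show ?case by (intro exI[of _ id]) (auto simp: strict_mono_def)
next
  case (insert w V)
  then obtain r l where r: "strict_mono (r :: nat \<Rightarrow> nat)"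
    and l: "\<And>v t. v \<in> V \<Longrightarrow> t \<in> {0..1} \<Longrightarrow> (\<lambda>n. u (r n) t v) \<longlonglongrightarrow> l t v"
    by blast
  obtain g k where "continuous_on {0..1} g" and k: "strict_mono (k :: nat \<Rightarrow> nat)"
    and g: "\<And>e. 0 < e \<Longrightarrow> \<exists>N. \<forall>n t. n \<ge> N \<and> t \<in> {0..1} \<longrightarrow> norm (u (r (k n)) t w - g t) < e"
  proof (rule Arzela_Ascoli[of "{0..1::real}" "\<lambda>n t. u (r n) t w" "\<bar>s0 w\<bar> + M"])
    fix n t assume t: "t \<in> {0..1::real}"
    have "M * \<bar>t - 0\<bar> \<le> M * 1" using t assms(2) by (intro mult_left_mono) auto
    then show "norm (u (r n) t w) \<le> \<bar>s0 w\<bar> + M"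
      using lip[of t 0 "r n" w] t u0[of "r n" w] by auto
  next
    fix t e :: real assume "t \<in> {0..1}" "0 < e"
    show "\<exists>d>0. \<forall>n y. y \<in> {0..1} \<and> norm (t - y) < d \<longrightarrow> norm (u (r n) t w - u (r n) y w) < e"
    proof (intro exI[of _ "e / (M + 1)"] conjI allI impI)
      fix n y assume y: "y \<in> {0..1} \<and> norm (t - y) < e / (M + 1)"
      have "norm (u (r n) t w - u (r n) y w) \<le> M * \<bar>t - y\<bar>"
        using lip \<open>t \<in> {0..1}\<close> y by auto
      also have "\<dots> \<le> (M + 1) * \<bar>t - y\<bar>" by (intro mult_right_mono) auto
      also have "\<dots> < e" using y assms(2) by (simp add: field_simps)
      finally show "norm (u (r n) t w - u (r n) y w) < e" .
    qed (use \<open>0 < e\<close> assms(2) in auto)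
  qed auto
  have "(\<lambda>n. u ((r \<circ> k) n) t v) \<longlonglongrightarrow> (if v = w then g t else l t v)"
    if "v \<in> insert w V" "t \<in> {0..1}" for v t
  proof (cases "v = w")
    case True
    have "(\<lambda>n. u (r (k n)) t w) \<longlonglongrightarrow> g t"
    proof (rule LIMSEQ_I)
      fix e :: real assume "0 < e"
      from g[OF this] that(2) show "\<exists>N. \<forall>n\<ge>N. norm (u (r (k n)) t w - g t) < e" by blast
    qed
    then show ?thesis using True by simp
  next
    case False
    then show ?thesis
      using LIMSEQ_subseq_LIMSEQ[OF l k] that by (auto simp: o_def)
  qed
  moreover have "strict_mono (r \<circ> k)" using r k by (rule strict_mono_o)
  ultimately show ?case
    by (intro exI[of _ "r \<circ> k"] exI[of _ "\<lambda>t v. if v = w then g t else l t v"]) blast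
qed

text \<open>The approximate solutions are Tonelli's, with the field evaluated at a delayed time.\<close>

theorem Peano_integral:
  fixes X :: "('a \<Rightarrow> real) \<Rightarrow> 'a \<Rightarrow> real"
  assumes V: "finite V"
    and cont: "\<And>v. continuous_on UNIV (\<lambda>s. X s v)"
    and bound: "\<And>s v. \<bar>X s v\<bar> \<le> M"
    and outside: "\<And>s v. v \<notin> V \<Longrightarrow> X s v = 0"
  shows "\<exists>u :: real \<Rightarrow> 'a \<Rightarrow> real. u 0 = s0 \<and> (\<forall>v. continuous_on {0..1} (\<lambda>t. u t v)) \<and>
    (\<forall>v. \<forall>t\<in>{0..1}. ((\<lambda>\<tau>. X (u \<tau>) v) has_integral (u t v - s0 v)) {0..t})"
proof -
  have M: "0 \<le> M" using bound[of undefined undefined] by linarith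
  have contX: "continuous_on A (\<lambda>t. X (w t) v)" if "\<And>v. continuous_on A (\<lambda>t. w t v)"
    for w :: "real \<Rightarrow> 'a \<Rightarrow> real" and A v
  proof -
    have "continuous_on A w" using that by (rule continuous_on_coordinatewise_then_product)
    then show ?thesis by (rule continuous_on_compose2[OF cont]) auto
  qed
  have intX: "(\<lambda>t. X (w t) v) integrable_on {a..b}" if "\<And>v. continuous_on UNIV (\<lambda>t. w t v)"
    for w :: "real \<Rightarrow> 'a \<Rightarrow> real" and a b v
    by (rule integrable_continuous_real[OF contX]) (use that continuous_on_subset in blast)
  have int_bound: "\<bar>integral {a..b} (\<lambda>t. X (w t) v)\<bar> \<le> M * \<bar>b - a\<bar>"
    if "(\<lambda>t. X (w t) v) integrable_on {a..b}" for w :: "real \<Rightarrow> 'a \<Rightarrow> real" and a b v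
  proof (cases "a \<le> b")
    case True
    then show ?thesis
      using has_integral_bound_real[OF M _ integrable_integral[OF that], of "{}"] bound by auto
  qed (use M in auto)
  have approx: "\<exists>w. (\<forall>v. w 0 v = s0 v) \<and> (\<forall>v. continuous_on UNIV (\<lambda>t. w t v)) \<and>
      (\<forall>t\<in>{0..1}. \<forall>t'\<in>{0..1}. \<forall>v. \<bar>w t v - w t' v\<bar> \<le> M * \<bar>t - t'\<bar>) \<and>
      (\<forall>t\<in>{0..1}. \<forall>v. w t v = s0 v + integral {0..t - h} (\<lambda>\<tau>. X (w \<tau>) v))" if h: "0 < h" for h :: real
  proof -
    \<comment> \<open>Picard iteration for the delayed equation. For t < h the interval {0..t - h}
      is empty, so the value is s0; each further iteration settles another time span of length h,
      and once K h > 1 the iterate solves the equation exactly on [0, 1].\<close>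
    define W where "W = rec_nat (\<lambda>t. s0)
      (\<lambda>_ w t v. s0 v + integral {0..t - h} (\<lambda>\<tau>. X (w \<tau>) v))"
    have W: "W 0 t = s0" "W (Suc k) t v = s0 v + integral {0..t - h} (\<lambda>\<tau>. X (W k \<tau>) v)" for k t v
      by (simp_all add: W_def)
    have step: "continuous_on UNIV (\<lambda>t. W (Suc k) t v) \<and>
        (\<forall>t t'. \<bar>W (Suc k) t v - W (Suc k) t' v\<bar> \<le> M * \<bar>t - t'\<bar>)"
      if c: "\<And>v. continuous_on UNIV (\<lambda>t. W k t v)" for k v
    proof -
      have lip: "\<bar>W (Suc k) t v - W (Suc k) t' v\<bar> \<le> M * \<bar>t - t'\<bar>" if "t \<le> t'" for t t'
      proof (cases "h \<le> t")
        case True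
        have "integral {0..t - h} (\<lambda>\<tau>. X (W k \<tau>) v) + integral {t - h..t' - h} (\<lambda>\<tau>. X (W k \<tau>) v) =
          integral {0..t' - h} (\<lambda>\<tau>. X (W k \<tau>) v)"
          by (rule Henstock_Kurzweil_Integration.integral_combine) (use True that intX[OF c] in auto)
        then have "\<bar>W (Suc k) t v - W (Suc k) t' v\<bar> = \<bar>integral {t - h..t' - h} (\<lambda>\<tau>. X (W k \<tau>) v)\<bar>"
          by (simp add: W)
        also have "\<dots> \<le> M * \<bar>(t' - h) - (t - h)\<bar>" by (rule int_bound[OF intX[OF c]])
        finally show ?thesis by (simp add: abs_minus_commute)
      next
        case False
        then have "{0..t - h} = {}" by auto
        then have "\<bar>W (Suc k) t v - W (Suc k) t' v\<bar> = \<bar>integral {0..t' - h} (\<lambda>\<tau>. X (W k \<tau>) v)\<bar>"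
          by (simp add: W)
        also have "\<dots> \<le> M * \<bar>t - t'\<bar>"
        proof (cases "h \<le> t'")
          case True
          have "\<bar>integral {0..t' - h} (\<lambda>\<tau>. X (W k \<tau>) v)\<bar> \<le> M * \<bar>(t' - h) - 0\<bar>"
            by (rule int_bound[OF intX[OF c]])
          also have "\<dots> \<le> M * \<bar>t - t'\<bar>" using M True False that by (intro mult_left_mono) auto
          finally show ?thesis .
        qed (use M in auto)
        finally show ?thesis .
      qed
      have lip': "\<bar>W (Suc k) t v - W (Suc k) t' v\<bar> \<le> M * \<bar>t - t'\<bar>" for t t'
      proof (cases "t \<le> t'")
        case False
        then show ?thesis using lip[of t' t] by (simp add: abs_minus_commute)
      qed (rule lip)
      then have "M-lipschitz_on UNIV (\<lambda>t. W (Suc k) t v)"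
        using M by (intro lipschitz_onI) (auto simp: dist_real_def)
      then show ?thesis using lip' lipschitz_on_continuous_on by blast
    qed
    have contW: "continuous_on UNIV (\<lambda>t. W k t v)" for k v
      by (induction k arbitrary: v) (use step in \<open>auto simp: W(1)\<close>)
    have stable: "W (Suc k) t v = W k t v" if "t \<le> real k * h" for k t v
      using that
    proof (induction k arbitrary: t v)
      case 0
      then have "{0..t - h} = {}" using h by auto
      then show ?case by (simp add: W)
    next
      case (Suc k)
      have "integral {0..t - h} (\<lambda>\<tau>. X (W (Suc k) \<tau>) v) = integral {0..t - h} (\<lambda>\<tau>. X (W k \<tau>) v)"
      proof (rule integral_cong)
        fix \<tau> assume "\<tau> \<in> {0..t - h}"
        then have "\<tau> \<le> real k * h" using Suc.prems by (simp add: algebra_simps)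
        then have "W (Suc k) \<tau> = W k \<tau>" using Suc.IH by blast
        then show "X (W (Suc k) \<tau>) v = X (W k \<tau>) v" by simp
      qed
      then show ?case by (simp add: W(2))
    qed
    obtain K where K: "1 < real K * h" using reals_Archimedean3[OF h] by blast
    have "W (Suc K) t v = s0 v + integral {0..t - h} (\<lambda>\<tau>. X (W (Suc K) \<tau>) v)" if t: "t \<in> {0..1}" for t v
    proof -
      have "integral {0..t - h} (\<lambda>\<tau>. X (W K \<tau>) v) = integral {0..t - h} (\<lambda>\<tau>. X (W (Suc K) \<tau>) v)"
      proof (rule integral_cong)
        fix \<tau> assume "\<tau> \<in> {0..t - h}"
        then have "\<tau> \<le> real K * h" using K t h by simp
        then have "W (Suc K) \<tau> = W K \<tau>" using stable by blast
        then show "X (W K \<tau>) v = X (W (Suc K) \<tau>) v" by simp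
      qed
      then show ?thesis by (simp add: W(2)[of K t])
    qed
    moreover have "W (Suc K) 0 v = s0 v" for v
    proof -
      have "{0..0 - h} = {}" using h by auto
      then show ?thesis by (simp add: W(2))
    qed
    ultimately show ?thesis using step[OF contW] by blast
  qed
  define h where "h n = inverse (real (Suc n))" for n
  have hpos: "0 < h n" for n by (simp add: h_def)
  have "\<forall>n. \<exists>w. (\<forall>v. w 0 v = s0 v) \<and> (\<forall>v. continuous_on UNIV (\<lambda>t. w t v)) \<and>
      (\<forall>t\<in>{0..1}. \<forall>t'\<in>{0..1}. \<forall>v. \<bar>w t v - w t' v\<bar> \<le> M * \<bar>t - t'\<bar>) \<and>
      (\<forall>t\<in>{0..1}. \<forall>v. w t v = s0 v + integral {0..t - h n} (\<lambda>\<tau>. X (w \<tau>) v))"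
    by (intro allI approx[OF hpos])
  from choice[OF this] obtain w where w: "\<forall>n. (\<forall>v. w n 0 v = s0 v) \<and>
      (\<forall>v. continuous_on UNIV (\<lambda>t. w n t v)) \<and>
      (\<forall>t\<in>{0..1}. \<forall>t'\<in>{0..1}. \<forall>v. \<bar>w n t v - w n t' v\<bar> \<le> M * \<bar>t - t'\<bar>) \<and>
      (\<forall>t\<in>{0..1}. \<forall>v. w n t v = s0 v + integral {0..t - h n} (\<lambda>\<tau>. X (w n \<tau>) v))" ..
  have w0: "w n 0 v = s0 v" and wc: "continuous_on UNIV (\<lambda>t. w n t v)" for n v
    using conjunct1[OF spec[OF w, of n]] conjunct1[OF conjunct2[OF spec[OF w, of n]]] by auto
  have wl: "\<bar>w n t v - w n t' v\<bar> \<le> M * \<bar>t - t'\<bar>" if "t \<in> {0..1}" "t' \<in> {0..1}" for n t t' v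
    using conjunct1[OF conjunct2[OF conjunct2[OF spec[OF w, of n]]]] that by auto
  have wi: "w n t v = s0 v + integral {0..t - h n} (\<lambda>\<tau>. X (w n \<tau>) v)" if "t \<in> {0..1}" for n t v
    using bspec[OF conjunct2[OF conjunct2[OF conjunct2[OF spec[OF w, of n]]]] that] by (rule spec)
  obtain r l where r: "strict_mono (r :: nat \<Rightarrow> nat)"
    and "\<forall>v\<in>V. \<forall>t\<in>{0..1}. (\<lambda>n. w (r n) t v) \<longlonglongrightarrow> l t v"
  proof -
    have "\<exists>r l. strict_mono (r :: nat \<Rightarrow> nat) \<and>
        (\<forall>v\<in>V. \<forall>t\<in>{0..1}. (\<lambda>n. w (r n) t v) \<longlonglongrightarrow> l t v)"
      by (rule Lipschitz_convergent_subseq[OF V M w0 wl])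
    then show ?thesis by (elim exE conjE) (rule that)
  qed
  then have l: "(\<lambda>n. w (r n) t v) \<longlonglongrightarrow> l t v" if "v \<in> V" "t \<in> {0..1}" for v t
    using that by (elim ballE) auto
  \<comment> \<open>Off V the approximations are constantly s0 v, so they converge to u in every
    coordinate, as continuity of X in the product topology requires.\<close>
  define u where "u t v = (if v \<in> V then l t v else s0 v)" for t v
  have w_out: "w n t v = s0 v" if "v \<notin> V" "t \<in> {0..1}" for n t v
    using wi[OF that(2)] outside[OF that(1)] by simp
  have lim: "(\<lambda>n. w (r n) t v) \<longlonglongrightarrow> u t v" if "t \<in> {0..1}" for t v
    using l that w_out by (cases "v \<in> V") (auto simp: u_def)
  have X_lim: "(\<lambda>n. X (w (r n) t) v) \<longlonglongrightarrow> X (u t) v" if "t \<in> {0..1}" for t v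
  proof -
    have "(\<lambda>n. w (r n) t) \<longlonglongrightarrow> u t"
      using lim[OF that] by (rule tendsto_fun)
    then show ?thesis by (rule continuous_on_tendsto_compose[OF cont]) auto
  qed
  have ul: "\<bar>u t v - u t' v\<bar> \<le> M * \<bar>t - t'\<bar>" if "t \<in> {0..1}" "t' \<in> {0..1}" for t t' v
  proof (rule LIMSEQ_le_const2)
    show "(\<lambda>n. \<bar>w (r n) t v - w (r n) t' v\<bar>) \<longlonglongrightarrow> \<bar>u t v - u t' v\<bar>"
      by (intro tendsto_intros lim that)
    show "\<exists>N. \<forall>n\<ge>N. \<bar>w (r n) t v - w (r n) t' v\<bar> \<le> M * \<bar>t - t'\<bar>"
      using wl[OF that] by simp
  qed
  then have "M-lipschitz_on {0..1} (\<lambda>t. u t v)" for v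
    using M by (intro lipschitz_onI) (auto simp: dist_real_def)
  then have uc: "continuous_on {0..1} (\<lambda>t. u t v)" for v
    using lipschitz_on_continuous_on by blast
  have "((\<lambda>\<tau>. X (u \<tau>) v) has_integral (u t v - s0 v)) {0..t}" if t: "t \<in> {0..1}" for v t
  proof -
    have X_lim_t: "(\<lambda>n. X (w (r n) \<tau>) v) \<longlonglongrightarrow> X (u \<tau>) v" if "\<tau> \<in> {0..t}" for \<tau>
      by (rule X_lim) (use that t in auto)
    have bound': "norm (X (w (r n) \<tau>) v) \<le> M" for n \<tau> using bound by simp
    note dc = dominated_convergence[where h = "\<lambda>_. M" and f = "\<lambda>n \<tau>. X (w (r n) \<tau>) v"
        and S = "{0..t}", OF intX[OF wc] integrable_const_ivl bound' X_lim_t]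
    have "(\<lambda>n. s0 v + integral {0..t} (\<lambda>\<tau>. X (w (r n) \<tau>) v) - w (r n) t v) \<longlonglongrightarrow> 0"
    proof (rule Lim_null_comparison)
      \<comment> \<open>The delay omits at most a final piece of length h n from the
        integral.\<close>
      have "\<bar>s0 v + integral {0..t} (\<lambda>\<tau>. X (w n \<tau>) v) - w n t v\<bar> \<le> M * h n" for n
      proof (cases "h n \<le> t")
        case True
        have "integral {0..t - h n} (\<lambda>\<tau>. X (w n \<tau>) v) + integral {t - h n..t} (\<lambda>\<tau>. X (w n \<tau>) v) =
          integral {0..t} (\<lambda>\<tau>. X (w n \<tau>) v)"
          by (rule Henstock_Kurzweil_Integration.integral_combine)
            (use True hpos[of n] intX[of "w n", OF wc] in auto)
        then have "s0 v + integral {0..t} (\<lambda>\<tau>. X (w n \<tau>) v) - w n t v = integral {t - h n..t} (\<lambda>\<tau>. X (w n \<tau>) v)"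
          using wi[OF t] by simp
        then show ?thesis
          using int_bound[of "w n" v "t - h n" t, OF intX[of "w n", OF wc]] hpos[of n] by simp
      next
        case False
        then have "{0..t - h n} = {}" by auto
        then have "s0 v + integral {0..t} (\<lambda>\<tau>. X (w n \<tau>) v) - w n t v = integral {0..t} (\<lambda>\<tau>. X (w n \<tau>) v)"
          using wi[OF t, of n v] by simp
        moreover have "\<bar>integral {0..t} (\<lambda>\<tau>. X (w n \<tau>) v)\<bar> \<le> M * \<bar>t - 0\<bar>"
          by (rule int_bound[of "w n", OF intX[of "w n", OF wc]])
        moreover have "M * \<bar>t - 0\<bar> \<le> M * h n" using False t M by (intro mult_left_mono) auto
        ultimately show ?thesis by simp
      qed
      then show "\<forall>\<^sub>F n in sequentially. norm (s0 v + integral {0..t} (\<lambda>\<tau>. X (w (r n) \<tau>) v) - w (r n) t v) \<le> M * h (r n)"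
        by simp
      have "(\<lambda>n. M * h n) \<longlonglongrightarrow> M * 0"
        unfolding h_def by (intro tendsto_mult tendsto_const LIMSEQ_inverse_real_of_nat)
      from LIMSEQ_subseq_LIMSEQ[OF this r]
      show "(\<lambda>n. M * h (r n)) \<longlonglongrightarrow> 0" by (simp add: o_def)
    qed
    moreover have "(\<lambda>n. s0 v + integral {0..t} (\<lambda>\<tau>. X (w (r n) \<tau>) v) - w (r n) t v) \<longlonglongrightarrow>
        s0 v + integral {0..t} (\<lambda>\<tau>. X (u \<tau>) v) - u t v"
      by (intro tendsto_intros dc lim t)
    ultimately have "s0 v + integral {0..t} (\<lambda>\<tau>. X (u \<tau>) v) - u t v = 0"
      by (rule LIMSEQ_unique[rotated])
    then have "u t v - s0 v = integral {0..t} (\<lambda>\<tau>. X (u \<tau>) v)" by simp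
    then show ?thesis using integrable_integral[OF dc(1)] by (simp only:)
  qed
  moreover have "u 0 = s0"
  proof
    fix v
    have "(\<lambda>n. s0 v) \<longlonglongrightarrow> u 0 v" using lim[of 0 v] by (simp add: w0)
    then show "u 0 v = s0 v" by (simp add: LIMSEQ_const_iff)
  qed
  ultimately show ?thesis using uc by (intro exI[of _ u]) simp
qed

section \<open>Flows with a proper Lyapunov function\<close>

text \<open>X is merely a continuous descent direction for \<Psi>, not minus its gradient g;
  \<open>inj\<close> stands in for strict convexity.\<close>

locale lyapunov_flow =
  fixes V :: "'a set" and \<Psi> :: "('a \<Rightarrow> real) \<Rightarrow> real" and g X :: "('a \<Rightarrow> real) \<Rightarrow> 'a \<Rightarrow> real"
  assumes finite_V: "finite V"
    and X_cont: "\<And>v. continuous_on UNIV (\<lambda>s. X s v)"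
    and \<Psi>_cont: "continuous_on UNIV \<Psi>"
    and g_cont: "\<And>v. v \<in> V \<Longrightarrow> continuous_on UNIV (\<lambda>s. g s v)"
    and X_outside: "\<And>s v. v \<notin> V \<Longrightarrow> X s v = 0"
    and X_cong: "\<And>s s'. (\<And>v. v \<in> V \<Longrightarrow> s v = s' v) \<Longrightarrow> X s = X s'"
    and \<Psi>_cong: "\<And>s s'. (\<And>v. v \<in> V \<Longrightarrow> s v = s' v) \<Longrightarrow> \<Psi> s = \<Psi> s'"
    and chain: "\<And>u u' t T. (\<And>v. v \<in> V \<Longrightarrow> ((\<lambda>t. u t v) has_real_derivative u' v) (at t within T)) \<Longrightarrow>
      t \<in> T \<Longrightarrow> ((\<lambda>t. \<Psi> (u t)) has_real_derivative (\<Sum>v\<in>V. g (u t) v * u' v)) (at t within T)"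
    and dissipative: "\<And>s. (\<Sum>v\<in>V. g s v * X s v) \<le> 0"
    and strict: "\<And>s v. 0 \<le> (\<Sum>v\<in>V. g s v * X s v) \<Longrightarrow> v \<in> V \<Longrightarrow> g s v = 0"
    and inj: "\<And>s s' v. (\<And>v. v \<in> V \<Longrightarrow> g s v = 0) \<Longrightarrow> (\<And>v. v \<in> V \<Longrightarrow> g s' v = 0) \<Longrightarrow> v \<in> V \<Longrightarrow>
      s v = s' v"
    and coercive: "\<And>c. \<exists>R. \<forall>s. \<Psi> s \<le> c \<longrightarrow> (\<forall>v\<in>V. \<bar>s v\<bar> \<le> R)"
begin

definition is_sol :: "real set \<Rightarrow> (real \<Rightarrow> 'a \<Rightarrow> real) \<Rightarrow> bool" where
  "is_sol T u \<longleftrightarrow>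
     (\<forall>t\<in>T. \<forall>v\<in>V. ((\<lambda>t. u t v) has_real_derivative X (u t) v) (at t within T))"

text \<open>Coordinates off V are normalised to 0, since sublevel sets of \<Psi> in the full
  function space could not be compact otherwise.\<close>

definition restr :: "('a \<Rightarrow> real) \<Rightarrow> 'a \<Rightarrow> real" where
  "restr s v = (if v \<in> V then s v else 0)"

definition sublevel :: "real \<Rightarrow> ('a \<Rightarrow> real) set" where
  "sublevel c = {s. \<Psi> s \<le> c \<and> (\<forall>v. v \<notin> V \<longrightarrow> s v = 0)}"

lemma is_sol_subset: "is_sol T u \<Longrightarrow> T' \<subseteq> T \<Longrightarrow> is_sol T' u"
  unfolding is_sol_def by (meson DERIV_subset subsetD)

lemma X_restr: "X (restr s) = X s"
  by (rule X_cong) (simp add: restr_def)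

lemma \<Psi>_restr: "\<Psi> (restr s) = \<Psi> s"
  by (rule \<Psi>_cong) (simp add: restr_def)

lemma restr_in_sublevel: "restr s \<in> sublevel c \<longleftrightarrow> \<Psi> s \<le> c"
  by (simp add: sublevel_def \<Psi>_restr) (simp add: restr_def)

text \<open>Tychonoff: coercivity puts the set inside a product of intervals over V and singletons
  elsewhere.\<close>

lemma compact_sublevel: "compact (sublevel c)"
proof -
  obtain R where R: "\<And>s v. \<Psi> s \<le> c \<Longrightarrow> v \<in> V \<Longrightarrow> \<bar>s v\<bar> \<le> R" using coercive[of c] by blast
  define K where "K = Pi\<^sub>E UNIV (\<lambda>v. if v \<in> V then {-R..R} else {0::real})"
  have "compactin (product_topology (\<lambda>_. euclidean) UNIV) K"
    unfolding K_def compactin_PiE by auto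
  then have "compact K" by (simp add: euclidean_product_topology)
  moreover have "closed {s. \<Psi> s \<le> c}"
    by (intro closed_Collect_le \<Psi>_cont continuous_on_const)
  ultimately have "compact (K \<inter> {s. \<Psi> s \<le> c})" by (rule compact_Int_closed)
  moreover have "sublevel c = K \<inter> {s. \<Psi> s \<le> c}"
    unfolding sublevel_def K_def by (auto simp: PiE_iff abs_le_iff dest: R split: if_splits)
  ultimately show ?thesis by simp
qed

lemma X_bounded:
  obtains M where "0 \<le> M" "\<And>s v. \<Psi> s \<le> c \<Longrightarrow> \<bar>X s v\<bar> \<le> M"
proof (cases "sublevel c = {}")
  case True
  then have "\<not> \<Psi> s \<le> c" for s using restr_in_sublevel[of s c] by blast
  then show ?thesis using that[of 0] by blast
next
  case False
  have "continuous_on (sublevel c) (\<lambda>s. \<Sum>v\<in>V. \<bar>X s v\<bar>)"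
    by (intro continuous_intros continuous_on_subset[OF X_cont]) auto
  from continuous_attains_sup[OF compact_sublevel False this] obtain m where
    m: "\<And>s. s \<in> sublevel c \<Longrightarrow> (\<Sum>v\<in>V. \<bar>X s v\<bar>) \<le> (\<Sum>v\<in>V. \<bar>X m v\<bar>)" by blast
  have "\<bar>X s v\<bar> \<le> (\<Sum>v\<in>V. \<bar>X m v\<bar>)" if "\<Psi> s \<le> c" for s v
  proof (cases "v \<in> V")
    case True
    have "\<bar>X s v\<bar> \<le> (\<Sum>v\<in>V. \<bar>X s v\<bar>)" using True finite_V by (intro member_le_sum) auto
    also have "\<dots> \<le> (\<Sum>v\<in>V. \<bar>X m v\<bar>)"
      using m[of "restr s"] restr_in_sublevel that by (simp add: X_restr)
    finally show ?thesis .
  qed (simp add: X_outside sum_nonneg)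
  then show ?thesis using that[of "\<Sum>v\<in>V. \<bar>X m v\<bar>"] by (simp add: sum_nonneg)
qed

lemma nonincreasing_of_deriv:
  fixes f :: "real \<Rightarrow> real"
  assumes "\<And>t. t \<in> {a..b} \<Longrightarrow> (f has_real_derivative f' t) (at t within {a..b})"
    "\<And>t. t \<in> {a..b} \<Longrightarrow> f' t \<le> 0" "a \<le> b"
  shows "f b \<le> f a"
proof (rule DERIV_nonpos_imp_decreasing_open[where f = f and a = a and b = b])
  fix t assume t: "a < t" "t < b"
  then have "(f has_real_derivative f' t) (at t)"
    using assms(1)[of t] by (simp add: at_within_Icc_at)
  then show "\<exists>y. (f has_real_derivative y) (at t) \<and> y \<le> 0" using assms(2) t by force
qed (use assms DERIV_continuous_on in blast)+

lemma \<Psi>_nonincreasing: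
  assumes "is_sol T u" "{a..b} \<subseteq> T" "a \<le> b"
  shows "\<Psi> (u b) \<le> \<Psi> (u a)"
proof (rule nonincreasing_of_deriv[where f = "\<lambda>t. \<Psi> (u t)"
      and f' = "\<lambda>t. \<Sum>v\<in>V. g (u t) v * X (u t) v"])
  fix t assume t: "t \<in> {a..b}"
  then show "((\<lambda>t. \<Psi> (u t)) has_real_derivative (\<Sum>v\<in>V. g (u t) v * X (u t) v)) (at t within {a..b})"
    using is_sol_subset[OF assms(1,2)] by (intro chain) (auto simp: is_sol_def)
qed (use dissipative assms in auto)

text \<open>Peano's theorem is applied to the field cut off outside a sublevel set of \<open>\<Psi>\<close>; the cut-off
  field is still dissipative, so its solutions never see the cut-off.\<close>

lemma local_existence:
  obtains u where "\<And>v. v \<in> V \<Longrightarrow> u 0 v = s0 v" "\<And>v. continuous_on {0..1} (\<lambda>t. u t v)" "is_sol {0..1} u"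
proof -
  \<comment> \<open>Equal to 1 where \<Psi> is at most \<Psi> s0 and to 0 where it is at least
    \<Psi> s0 + 1, so the product with X is bounded everywhere; being nonnegative, it preserves the
    sign of the dissipation.\<close>
  define \<eta> where "\<eta> s = max 0 (min 1 (\<Psi> s0 + 1 - \<Psi> s))" for s
  have \<eta>_cont: "continuous_on UNIV \<eta>"
    unfolding \<eta>_def by (intro continuous_intros \<Psi>_cont)
  have \<eta>: "0 \<le> \<eta> s" "\<eta> s \<le> 1" for s by (auto simp: \<eta>_def)
  obtain M where M: "0 \<le> M" "\<And>s v. \<Psi> s \<le> \<Psi> s0 + 1 \<Longrightarrow> \<bar>X s v\<bar> \<le> M" using X_bounded by blast
  define X' where "X' s v = \<eta> s * X s v" for s v
  have X'_cont: "continuous_on UNIV (\<lambda>s. X' s v)" for v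
    unfolding X'_def by (intro continuous_intros \<eta>_cont X_cont)
  have X'_bound: "\<bar>X' s v\<bar> \<le> M" for s v
  proof (cases "\<Psi> s \<le> \<Psi> s0 + 1")
    case True
    have "\<bar>X' s v\<bar> \<le> 1 * M"
      unfolding X'_def abs_mult using \<eta> M(2)[OF True] by (intro mult_mono) auto
    then show ?thesis by simp
  next
    case False
    then show ?thesis using M(1) by (simp add: X'_def \<eta>_def)
  qed
  have X'_out: "X' s v = 0" if "v \<notin> V" for s v using that by (simp add: X'_def X_outside)
  have "\<exists>u :: real \<Rightarrow> 'a \<Rightarrow> real. u 0 = s0 \<and> (\<forall>v. continuous_on {0..1} (\<lambda>t. u t v)) \<and>
      (\<forall>v. \<forall>t\<in>{0..1}. ((\<lambda>\<tau>. X' (u \<tau>) v) has_integral (u t v - s0 v)) {0..t})"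
    by (rule Peano_integral[OF finite_V X'_cont X'_bound X'_out])
  then obtain u :: "real \<Rightarrow> 'a \<Rightarrow> real" where u': "u 0 = s0 \<and> (\<forall>v. continuous_on {0..1} (\<lambda>t. u t v)) \<and>
      (\<forall>v. \<forall>t\<in>{0..1}. ((\<lambda>\<tau>. X' (u \<tau>) v) has_integral (u t v - s0 v)) {0..t})" ..
  have u: "u 0 = s0" "continuous_on {0..1} (\<lambda>t. u t v)"
    "t \<in> {0..1} \<Longrightarrow> ((\<lambda>\<tau>. X' (u \<tau>) v) has_integral (u t v - s0 v)) {0..t}" for v t
    using u' by auto
  have "continuous_on {0..1} u" using u(2) by (rule continuous_on_coordinatewise_then_product)
  then have Xu_cont: "continuous_on {0..1} (\<lambda>t. X' (u t) v)" for v
    by (rule continuous_on_compose2[OF X'_cont]) auto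
  have der: "((\<lambda>t. u t v) has_real_derivative X' (u t) v) (at t within {0..1})" if t: "t \<in> {0..1}" for t v
  proof -
    have "((\<lambda>t. s0 v + integral {0..t} (\<lambda>\<tau>. X' (u \<tau>) v)) has_real_derivative 0 + X' (u t) v) (at t within {0..1})"
      by (intro DERIV_add DERIV_const integral_has_real_derivative Xu_cont t)
    moreover have "s0 v + integral {0..\<tau>} (\<lambda>\<tau>. X' (u \<tau>) v) = u \<tau> v" if "\<tau> \<in> {0..1}" for \<tau>
      using integral_unique[OF u(3)[OF that]] by simp
    ultimately show ?thesis
      using has_field_derivative_transform_within[where d = 1, OF _ _ t] by simp
  qed
  have "\<Psi> (u t) \<le> \<Psi> s0" if t: "t \<in> {0..1}" for t
  proof -
    have "\<Psi> (u t) \<le> \<Psi> (u 0)"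
    proof (rule nonincreasing_of_deriv[where f = "\<lambda>t. \<Psi> (u t)"
          and f' = "\<lambda>t. \<Sum>v\<in>V. g (u t) v * X' (u t) v"])
      fix \<tau> assume "\<tau> \<in> {0..t}"
      then have \<tau>: "\<tau> \<in> {0..1}" "\<tau> \<in> {0..t}" "{0..t} \<subseteq> {0..1}" using t by auto
      show "((\<lambda>t. \<Psi> (u t)) has_real_derivative (\<Sum>v\<in>V. g (u \<tau>) v * X' (u \<tau>) v)) (at \<tau> within {0..t})"
        by (rule chain[OF DERIV_subset[OF der[OF \<tau>(1)] \<tau>(3)] \<tau>(2)])
      have "(\<Sum>v\<in>V. g (u \<tau>) v * X' (u \<tau>) v) = \<eta> (u \<tau>) * (\<Sum>v\<in>V. g (u \<tau>) v * X (u \<tau>) v)"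
        by (simp add: X'_def sum_distrib_left mult_ac)
      also have "\<dots> \<le> 0" using \<eta> dissipative by (intro mult_nonneg_nonpos) auto
      finally show "(\<Sum>v\<in>V. g (u \<tau>) v * X' (u \<tau>) v) \<le> 0" .
    qed (use t in auto)
    then show ?thesis by (simp add: u(1))
  qed
  then have "X' (u t) v = X (u t) v" if "t \<in> {0..1}" for t v
    using that by (force simp: X'_def \<eta>_def)
  then have "is_sol {0..1} u" using der by (simp add: is_sol_def)
  then show ?thesis using u by (intro that[of u]) auto
qed

text \<open>Passing through the integral equation bridges the exceptional times, in particular a
  gluing point, and the continuous field then gives the derivative there and at the
  endpoints.\<close>

lemma is_sol_of_interior:
  assumes cont: "\<And>v. continuous_on {0..b} (\<lambda>t. w t v)" and "finite S"
    and der: "\<And>t v. t \<in> {0<..<b} - S \<Longrightarrow> v \<in> V \<Longrightarrow> ((\<lambda>t. w t v) has_real_derivative X (w t) v) (at t)"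
  shows "is_sol {0..b} w"
  unfolding is_sol_def
proof (intro ballI)
  fix t v assume t: "t \<in> {0..b}" and v: "v \<in> V"
  have "continuous_on {0..b} w" using cont by (rule continuous_on_coordinatewise_then_product)
  then have Xw: "continuous_on {0..b} (\<lambda>t. X (w t) v)"
    by (rule continuous_on_compose2[OF X_cont]) auto
  have int: "((\<lambda>\<tau>. X (w \<tau>) v) has_integral w \<tau> v - w 0 v) {0..\<tau>}" if "\<tau> \<in> {0..b}" for \<tau>
  proof (rule fundamental_theorem_of_calculus_interior_strong[OF \<open>finite S\<close>])
    fix x assume "x \<in> {0<..<\<tau>} - S"
    then show "((\<lambda>t. w t v) has_vector_derivative X (w x) v) (at x)"
      using der[of x v] v that by (simp add: has_real_derivative_iff_has_vector_derivative)
  next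
    show "continuous_on {0..\<tau>} (\<lambda>t. w t v)" using cont by (rule continuous_on_subset) (use that in auto)
  qed (use that in auto)
  have "((\<lambda>t. w 0 v + integral {0..t} (\<lambda>\<tau>. X (w \<tau>) v)) has_real_derivative 0 + X (w t) v) (at t within {0..b})"
    by (intro DERIV_add DERIV_const integral_has_real_derivative Xw t)
  moreover have "w 0 v + integral {0..\<tau>} (\<lambda>\<tau>. X (w \<tau>) v) = w \<tau> v" if "\<tau> \<in> {0..b}" for \<tau>
    using integral_unique[OF int[OF that]] by simp
  ultimately show "((\<lambda>t. w t v) has_real_derivative X (w t) v) (at t within {0..b})"
    using has_field_derivative_transform_within[where d = 1, OF _ _ t] by simp
qed

text \<open>Since \<Psi> does not increase, the field is bounded along u, so u is Lipschitz and has
  a limit at r; a local solution restarted from this limit lasts one more unit of time.\<close>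

lemma is_sol_extend:
  assumes u: "is_sol {0..<r} u" and r: "0 < r"
  obtains w where "is_sol {0..<r + 1} w" "\<And>t v. t \<in> {0..<r} \<Longrightarrow> v \<in> V \<Longrightarrow> w t v = u t v"
proof -
  obtain M where M: "0 \<le> M" "\<And>s v. \<Psi> s \<le> \<Psi> (u 0) \<Longrightarrow> \<bar>X s v\<bar> \<le> M" using X_bounded by blast
  have bd: "\<bar>X (u t) v\<bar> \<le> M" if "t \<in> {0..<r}" for t v
  proof -
    have "{0..t} \<subseteq> {0..<r}" using that by auto
    then show ?thesis using \<Psi>_nonincreasing[OF u, of 0 t] that M(2) by auto
  qed
  have "\<exists>f. continuous_on {0..r} f \<and> (\<forall>t\<in>{0..<r}. f t = u t v)" if v: "v \<in> V" for v
  proof -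
    have "\<bar>u t v - u t' v\<bar> \<le> M * \<bar>t - t'\<bar>" if "t \<in> {0..<r}" "t' \<in> {0..<r}" for t t'
      using field_differentiable_bound[of "{0..<r}" "\<lambda>t. u t v" "\<lambda>t. X (u t) v" M t t'] u v bd that
      by (auto simp: is_sol_def)
    then have "M-lipschitz_on {0..<r} (\<lambda>t. u t v)"
      using M(1) by (intro lipschitz_onI) (auto simp: dist_real_def)
    from lipschitz_on_uniformly_continuous[OF this]
    obtain f where f: "uniformly_continuous_on (closure {0..<r}) f" "\<And>t. t \<in> {0..<r} \<Longrightarrow> u t v = f t"
      by (rule uniformly_continuous_on_extension_on_closure) (rule that)
    have "continuous_on {0..r} f"
      using uniformly_continuous_imp_continuous[OF f(1)] r by simp
    then show ?thesis using f(2) by (intro exI[of _ f]) simp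
  qed
  then obtain f where f: "\<And>v. v \<in> V \<Longrightarrow> continuous_on {0..r} (f v)"
    "\<And>v t. v \<in> V \<Longrightarrow> t \<in> {0..<r} \<Longrightarrow> f v t = u t v" by metis
  obtain z where z: "\<And>v. v \<in> V \<Longrightarrow> z 0 v = f v r" "\<And>v. continuous_on {0..1} (\<lambda>t. z t v)" "is_sol {0..1} z"
    using local_existence[of "\<lambda>v. f v r"] by blast
  define w where "w t v = (if v \<in> V then if t \<le> r then f v t else z (t - r) v else 0)" for t v
  have w_u: "w t v = u t v" if "t \<in> {0..<r}" "v \<in> V" for t v
    using that f(2) by (simp add: w_def)
  have "is_sol {0..r + 1} w"
  proof (rule is_sol_of_interior)
    fix v
    show "continuous_on {0..r + 1} (\<lambda>t. w t v)"
    proof (cases "v \<in> V")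
      case True
      have "continuous_on {0..r + 1} (\<lambda>t. if t \<le> r then f v t else z (t - r) v)"
      proof (rule continuous_on_cases_le)
        show "continuous_on {t \<in> {0..r + 1}. t \<le> r} (f v)"
          using f(1)[OF True] by (rule continuous_on_subset) auto
        show "continuous_on {t \<in> {0..r + 1}. r \<le> t} (\<lambda>t. z (t - r) v)"
          by (rule continuous_on_compose2[OF z(2)]) (auto intro!: continuous_intros)
      qed (use z(1)[OF True] in \<open>auto intro: continuous_intros\<close>)
      then show ?thesis using True by (simp add: w_def)
    qed (simp add: w_def)
  next
    fix t v assume t: "t \<in> {0<..<r + 1} - {r}" and v: "v \<in> V"
    show "((\<lambda>t. w t v) has_real_derivative X (w t) v) (at t)"
    proof (cases "t < r")
      case True
      then have "((\<lambda>t. u t v) has_real_derivative X (u t) v) (at t within {0..<r})"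
        using u t v by (simp add: is_sol_def)
      then have "((\<lambda>t. u t v) has_real_derivative X (u t) v) (at t)"
        using t True at_within_interior[of t "{0..<r}"] by simp
      then have "((\<lambda>t. w t v) has_real_derivative X (u t) v) (at t)"
        by (rule has_field_derivative_transform_within_open[of _ _ _ "{0<..<r}"])
          (use t True w_u v in auto)
      moreover have "X (w t) = X (u t)" by (rule X_cong) (use t True w_u in auto)
      ultimately show ?thesis by simp
    next
      case False
      then have "((\<lambda>t. z t v) has_real_derivative X (z (t - r)) v) (at (t - r) within {0..1})"
        using z(3) t v by (simp add: is_sol_def)
      then have "((\<lambda>t. z t v) has_real_derivative X (z (t - r)) v) (at (t - r))"
        using t False at_within_Icc_at[of 0 "t - r" 1] by simp
      then have "((\<lambda>t. z (t - r) v) has_real_derivative X (z (t - r)) v) (at t)"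
      proof -
        have "((\<lambda>t. t - r) has_real_derivative 1) (at t)" by (auto intro!: derivative_eq_intros)
        with \<open>((\<lambda>t. z t v) has_real_derivative X (z (t - r)) v) (at (t - r))\<close>
        show ?thesis using DERIV_chain2 by fastforce
      qed
      then have "((\<lambda>t. w t v) has_real_derivative X (z (t - r)) v) (at t)"
        by (rule has_field_derivative_transform_within_open[of _ _ _ "{r<..}"])
          (use t False v in \<open>auto simp: w_def\<close>)
      moreover have "X (w t) = X (z (t - r))" by (rule X_cong) (use t False in \<open>auto simp: w_def\<close>)
      ultimately show ?thesis by simp
    qed
  qed simp
  then have "is_sol {0..<r + 1} w" by (rule is_sol_subset) auto
  then show ?thesis using that w_u by blast
qed

text \<open>Extensions are not unique, so each piece must be chosen to agree with the previous one;
  hence dependent choice instead of a union of arbitrary local solutions.\<close>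

lemma global_existence:
  obtains u where "\<And>v. v \<in> V \<Longrightarrow> u 0 v = s0 v" "is_sol {0..} u"
proof -
  have "\<exists>U. \<forall>n. (is_sol {0..<real n + 1} (U n) \<and> (\<forall>v\<in>V. U n 0 v = s0 v)) \<and>
      (\<forall>t\<in>{0..<real n + 1}. \<forall>v\<in>V. U (Suc n) t v = U n t v)"
  proof (rule dependent_nat_choice[where P = "\<lambda>n u. is_sol {0..<real n + 1} u \<and> (\<forall>v\<in>V. u 0 v = s0 v)"
        and Q = "\<lambda>n u w. \<forall>t\<in>{0..<real n + 1}. \<forall>v\<in>V. w t v = u t v"])
    obtain u where u: "\<And>v. v \<in> V \<Longrightarrow> u 0 v = s0 v" "is_sol {0..1} u"
      by (rule local_existence[of s0]) (rule that)
    then show "\<exists>u. is_sol {0..<real 0 + 1} u \<and> (\<forall>v\<in>V. u 0 v = s0 v)"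
      using is_sol_subset[OF u(2), of "{0..<1}"] u(1)
      by (intro exI[of _ u]) (simp add: subset_eq)
  next
    fix u n assume u: "is_sol {0..<real n + 1} u \<and> (\<forall>v\<in>V. u 0 v = s0 v)"
    then have "is_sol {0..<real n + 1} u" "0 < real n + 1" by auto
    then obtain w where w: "is_sol {0..<real n + 1 + 1} w"
      "\<And>t v. t \<in> {0..<real n + 1} \<Longrightarrow> v \<in> V \<Longrightarrow> w t v = u t v"
      using is_sol_extend[of "real n + 1" u] by blast
    have "is_sol {0..<real (Suc n) + 1} w" using w(1) by (simp add: add_ac)
    moreover have "w 0 v = s0 v" if "v \<in> V" for v using w(2)[of 0 v] u that by simp
    ultimately show "\<exists>w. (is_sol {0..<real (Suc n) + 1} w \<and> (\<forall>v\<in>V. w 0 v = s0 v)) \<and>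
        (\<forall>t\<in>{0..<real n + 1}. \<forall>v\<in>V. w t v = u t v)"
      using w(2) by blast
  qed
  then obtain U where U': "\<forall>n. (is_sol {0..<real n + 1} (U n) \<and> (\<forall>v\<in>V. U n 0 v = s0 v)) \<and>
      (\<forall>t\<in>{0..<real n + 1}. \<forall>v\<in>V. U (Suc n) t v = U n t v)" ..
  have U: "is_sol {0..<real n + 1} (U n)" "v \<in> V \<Longrightarrow> U n 0 v = s0 v"
    "t \<in> {0..<real n + 1} \<Longrightarrow> v \<in> V \<Longrightarrow> U (Suc n) t v = U n t v" for n t v
    using spec[OF U', of n] by (elim conjE, fast)+
  have mono: "U m t v = U n t v" if "n \<le> m" "t \<in> {0..<real n + 1}" "v \<in> V" for m n t v
    using that(1)
  proof (induction m rule: dec_induct)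
    case (step m)
    then have "t \<in> {0..<real m + 1}" using that(2) by auto
    then show ?case using U(3) step.IH that(3) by simp
  qed simp
  \<comment> \<open>The piece with index floor t lives on [0, floor t + 1), which contains
    t.\<close>
  define u where "u t = U (nat \<lfloor>t\<rfloor>) t" for t
  have u_U: "u t v = U n t v" if t: "t \<in> {0..<real n + 1}" and v: "v \<in> V" for t v n
  proof -
    have "nat \<lfloor>t\<rfloor> \<le> n" using t by (simp add: nat_le_iff floor_le_iff)
    moreover have "t \<in> {0..<real (nat \<lfloor>t\<rfloor>) + 1}" using t by simp
    ultimately show ?thesis using mono[of "nat \<lfloor>t\<rfloor>" n t v] v by (simp add: u_def)
  qed
  have "is_sol {0..} u"
    unfolding is_sol_def
  proof (intro ballI)
    fix t v assume t: "t \<in> {0::real..}" and v: "v \<in> V"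
    obtain n :: nat where n: "t < real n" using reals_Archimedean2 by blast
    have "((\<lambda>t. U n t v) has_real_derivative X (U n t) v) (at t within {0..<real n + 1})"
      using U(1)[of n] t n v by (simp add: is_sol_def)
    then have "((\<lambda>t. u t v) has_real_derivative X (U n t) v) (at t within {0..<real n + 1})"
      by (rule has_field_derivative_transform_within[of _ _ _ _ 1])
        (use t n v u_U[where n = n, symmetric] in auto)
    moreover have "at t within {0..<real n + 1} = at t within {0..}"
      by (rule at_within_nhd[of _ "{..<real n + 1}"]) (use n in auto)
    moreover have "X (u t) = X (U n t)" by (rule X_cong, rule u_U) (use t n in auto)
    ultimately show "((\<lambda>t. u t v) has_real_derivative X (u t) v) (at t within {0..})" by simp
  qed
  moreover have "u 0 v = s0 v" if "v \<in> V" for v using U(2)[OF that] by (simp add: u_def)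
  ultimately show ?thesis using that by blast
qed

text \<open>If g did not vanish, a small step along X, rather than along minus the gradient, would
  lower \<Psi> by \<open>strict\<close> and stay in the sublevel set.\<close>

lemma minimizer_critical:
  assumes s: "s \<in> sublevel c" and min: "\<And>s'. s' \<in> sublevel c \<Longrightarrow> \<Psi> s \<le> \<Psi> s'" and "v \<in> V"
  shows "g s v = 0"
proof (rule ccontr)
  assume "g s v \<noteq> 0"
  then have neg: "(\<Sum>v\<in>V. g s v * X s v) < 0" using strict[of s v] \<open>v \<in> V\<close> by force
  let ?u = "\<lambda>h v. s v + h * X s v"
  have "((\<lambda>h. \<Psi> (?u h)) has_real_derivative (\<Sum>v\<in>V. g (?u 0) v * X s v)) (at 0)"
    by (rule chain) (auto intro!: derivative_eq_intros)
  then have "((\<lambda>h. \<Psi> (?u h)) has_real_derivative (\<Sum>v\<in>V. g s v * X s v)) (at 0)" by simp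
  from DERIV_neg_dec_right[OF this neg] obtain d where d: "0 < d"
    "\<And>h. 0 < h \<Longrightarrow> h < d \<Longrightarrow> \<Psi> (?u h) < \<Psi> (?u 0)" by auto
  then have less: "\<Psi> (?u (d / 2)) < \<Psi> s" using d(2)[of "d / 2"] by simp
  then have "restr (?u (d / 2)) \<in> sublevel c" using s by (simp add: restr_in_sublevel) (simp add: sublevel_def)
  from min[OF this] less show False by (simp add: \<Psi>_restr)
qed

text \<open>A LaSalle argument for an arbitrary global solution: uniqueness of the critical point
  upgrades decay of \<Psi> to convergence of the whole trajectory, with no rate of decay near the
  limit.\<close>

theorem convergence:
  assumes u: "is_sol {0..} u"
  obtains s where "\<And>v. v \<in> V \<Longrightarrow> g s v = 0" "\<And>v. v \<in> V \<Longrightarrow> ((\<lambda>t. u t v) \<longlongrightarrow> s v) at_top"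
proof -
  define c where "c = \<Psi> (u 0)"
  let ?K = "sublevel c"
  have dec: "\<Psi> (u b) \<le> \<Psi> (u a)" if "0 \<le> a" "a \<le> b" for a b
    using \<Psi>_nonincreasing[OF u, of a b] that by auto
  have uK: "restr (u t) \<in> ?K" if "0 \<le> t" for t
    using dec[of 0 t] that by (simp add: restr_in_sublevel c_def)
  have K_ne: "?K \<noteq> {}" using uK[of 0] by auto
  obtain s where s: "s \<in> ?K" "\<And>s'. s' \<in> ?K \<Longrightarrow> \<Psi> s \<le> \<Psi> s'"
    using continuous_attains_inf[OF compact_sublevel K_ne continuous_on_subset[OF \<Psi>_cont]] by auto
  have gs: "g s v = 0" if "v \<in> V" for v using minimizer_critical[OF s that] .
  let ?D = "\<lambda>s. \<Sum>v\<in>V. g s v * X s v"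
  have D_cont: "continuous_on UNIV ?D" by (intro continuous_intros g_cont X_cont)
  have near: "\<exists>t\<ge>0. \<Psi> (u t) < \<Psi> s + \<epsilon>" if "0 < \<epsilon>" for \<epsilon>
  proof (rule ccontr)
    assume "\<not> ?thesis"
    then have far: "\<Psi> s + \<epsilon> \<le> \<Psi> (u t)" if "0 \<le> t" for t using that by force
    \<comment> \<open>On this compact set, which is free of critical points, the dissipation rate
      has a negative maximum. Remaining there would make \<Psi> fall at least linearly, below its
      minimum.\<close>
    define K' where "K' = ?K \<inter> {s'. \<Psi> s + \<epsilon> \<le> \<Psi> s'}"
    have "closed {s'. \<Psi> s + \<epsilon> \<le> \<Psi> s'}" by (intro closed_Collect_le \<Psi>_cont continuous_on_const)
    then have "compact K'" unfolding K'_def by (rule compact_Int_closed[OF compact_sublevel])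
    moreover have uK': "restr (u t) \<in> K'" if "0 \<le> t" for t
      using uK[OF that] far[OF that] by (simp add: K'_def \<Psi>_restr)
    then have "K' \<noteq> {}" by force
    ultimately obtain m where m: "m \<in> K'" "\<And>s'. s' \<in> K' \<Longrightarrow> ?D s' \<le> ?D m"
      using continuous_attains_sup[of K' ?D] continuous_on_subset[OF D_cont] by blast
    have "?D m < 0"
    proof (rule ccontr)
      assume "\<not> ?D m < 0"
      then have "g m v = 0" if "v \<in> V" for v using strict[of m v] that by simp
      then have "m v = s v" if "v \<in> V" for v using inj[of m s v] gs that by blast
      then have "\<Psi> m = \<Psi> s" by (rule \<Psi>_cong)
      then show False using m(1) \<open>0 < \<epsilon>\<close> by (simp add: K'_def)
    qed
    have "\<Psi> (u t) - ?D m * t \<le> \<Psi> (u 0) - ?D m * 0" if t: "0 \<le> t" for t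
    proof (rule nonincreasing_of_deriv[where f = "\<lambda>t. \<Psi> (u t) - ?D m * t"
          and f' = "\<lambda>\<tau>. ?D (u \<tau>) - ?D m"])
      fix \<tau> assume \<tau>: "\<tau> \<in> {0..t}"
      have "is_sol {0..t} u" using is_sol_subset[OF u, of "{0..t}"] by auto
      then have "((\<lambda>t. \<Psi> (u t)) has_real_derivative ?D (u \<tau>)) (at \<tau> within {0..t})"
        using \<tau> by (intro chain) (auto simp: is_sol_def)
      then show "((\<lambda>t. \<Psi> (u t) - ?D m * t) has_real_derivative ?D (u \<tau>) - ?D m) (at \<tau> within {0..t})"
        by (auto intro!: derivative_eq_intros)
      have "?D (restr (u \<tau>)) \<le> ?D m" using m(2) uK' \<tau> by simp
      \<comment> \<open>Independence of the values off V is assumed for \<Psi> and X but not for g;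
        for ?D it follows because ?D is the derivative of \<Psi> in the direction X.\<close>
      moreover have "?D (restr (u \<tau>)) = ?D (u \<tau>)"
      proof -
        have D_eq: "((\<lambda>h. \<Psi> (\<lambda>v. s' v + h * X (u \<tau>) v)) has_real_derivative
            (\<Sum>v\<in>V. g s' v * X (u \<tau>) v)) (at 0)" for s'
        proof -
          have "((\<lambda>h. \<Psi> (\<lambda>v. s' v + h * X (u \<tau>) v)) has_real_derivative
            (\<Sum>v\<in>V. g (\<lambda>v. s' v + 0 * X (u \<tau>) v) v * X (u \<tau>) v)) (at 0)"
            by (rule chain) (auto intro!: derivative_eq_intros)
          then show ?thesis by simp
        qed
        have "(\<lambda>h. \<Psi> (\<lambda>v. restr (u \<tau>) v + h * X (u \<tau>) v)) = (\<lambda>h. \<Psi> (\<lambda>v. u \<tau> v + h * X (u \<tau>) v))"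
          by (intro ext \<Psi>_cong) (simp add: restr_def)
        then show ?thesis
          using DERIV_unique[OF D_eq[of "restr (u \<tau>)"]] D_eq[of "u \<tau>"] by (simp add: X_restr)
      qed
      ultimately show "?D (u \<tau>) - ?D m \<le> 0" by simp
    qed (use t in auto)
    moreover have "\<Psi> s \<le> \<Psi> (u t)" if "0 \<le> t" for t using far[OF that] \<open>0 < \<epsilon>\<close> by simp
    ultimately have bd: "- ?D m * t \<le> \<Psi> (u 0) - \<Psi> s" if "0 \<le> t" for t using that by force
    obtain n :: nat where "\<Psi> (u 0) - \<Psi> s < real n * (- ?D m)"
      using reals_Archimedean3[of "- ?D m"] \<open>?D m < 0\<close> by auto
    then show False using bd[of "real n"] by (simp add: mult.commute)
  qed
  have "((\<lambda>t. u t v) \<longlongrightarrow> s v) at_top" if v: "v \<in> V" for v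
  proof (rule tendstoI)
    fix e :: real assume "0 < e"
    \<comment> \<open>The least value of \<Psi> on this set exceeds \<Psi> s, as a further minimizer
      would be critical and hence agree with s at v. Once \<Psi> along u has dropped below that
      value, u cannot return.\<close>
    define K' where "K' = ?K \<inter> {s'. e \<le> \<bar>s' v - s v\<bar>}"
    have "\<exists>t0\<ge>0. \<forall>t\<ge>t0. restr (u t) \<notin> K'"
    proof (cases "K' = {}")
      case True
      then show ?thesis by auto
    next
      case False
      have "closed {s'. e \<le> \<bar>s' v - s v\<bar>}" by (intro closed_Collect_le continuous_intros) simp
      then have "compact K'" unfolding K'_def by (rule compact_Int_closed[OF compact_sublevel])
      from continuous_attains_inf[OF this False continuous_on_subset[OF \<Psi>_cont]]
      obtain m where m: "m \<in> K'" "\<And>s'. s' \<in> K' \<Longrightarrow> \<Psi> m \<le> \<Psi> s'" by auto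
      have "\<Psi> s < \<Psi> m"
      proof (rule ccontr)
        assume "\<not> \<Psi> s < \<Psi> m"
        then have "\<Psi> m \<le> \<Psi> s'" if "s' \<in> ?K" for s' using s(2)[OF that] by simp
        then have "g m v = 0" if "v \<in> V" for v using minimizer_critical[of m c v] m(1) that by (simp add: K'_def)
        then have "m v = s v" using inj[of m s v] gs v by blast
        then show False using m(1) \<open>0 < e\<close> by (simp add: K'_def)
      qed
      then obtain t0 where t0: "0 \<le> t0" "\<Psi> (u t0) < \<Psi> m" using near[of "\<Psi> m - \<Psi> s"] by auto
      have "restr (u t) \<notin> K'" if "t0 \<le> t" for t
      proof
        assume "restr (u t) \<in> K'"
        then have "\<Psi> m \<le> \<Psi> (u t)" using m(2) \<Psi>_restr by metis
        then show False using dec[OF t0(1) that] t0(2) by simp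
      qed
      then show ?thesis using t0(1) by blast
    qed
    then obtain t0 where t0: "0 \<le> t0" "\<And>t. t0 \<le> t \<Longrightarrow> restr (u t) \<notin> K'" by blast
    have "dist (u t v) (s v) < e" if "t0 \<le> t" for t
      using t0(2)[OF that] uK[of t] t0(1) that v by (auto simp: K'_def dist_real_def restr_def)
    then show "\<forall>\<^sub>F t in at_top. dist (u t v) (s v) < e"
      using eventually_at_top_linorder by blast
  qed
  then show ?thesis using that gs by blast
qed

end

section \<open>The combinatorial Calabi flow\<close>

locale packing_data =
  fixes S :: "'a topology" and V :: "'a set" and E F :: "'a set set"
    and Y :: "'a set \<Rightarrow> real" and p :: real and Lhat :: "'a \<Rightarrow> real"
  assumes decomposition: "polygonal_decomposition S V E F"
    and Y_bounds: "\<And>f. f \<in> F \<Longrightarrow> (2 - real (nverts S V f)) * pi < Y f \<and> Y f < 2 * pi"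
    and p_gt_1: "p > 1"
    and Lhat_gt_0: "\<And>i. i \<in> V \<Longrightarrow> Lhat i > 0"

sublocale packing_data \<subseteq> prescribed_curv V F "cell_verts S V"
  "\<lambda>f. real (nverts S V f) * pi - cone_angle Y f" "adjacent S V E" p Lhat
proof (intro prescribed_curv.intro circle_pattern.intro prescribed_curv_axioms.intro)
  show V: "finite V" and "finite F" using decomposition by (auto simp: polygonal_decomposition_def)
  fix f assume f: "f \<in> F"
  show sub: "cell_verts S V f \<subseteq> V" by (simp add: cell_verts_def)
  show "face_data (cell_verts S V f) (real (nverts S V f) * pi - cone_angle Y f)"
  proof
    show "finite (cell_verts S V f)" using V sub finite_subset by blast
    show "0 < real (nverts S V f) * pi - cone_angle Y f"
      using Y_bounds[OF f] by (simp add: cone_angle_def algebra_simps)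
    show "real (nverts S V f) * pi - cone_angle Y f < pi * real (card (cell_verts S V f))"
      using Y_bounds[OF f] by (simp add: cone_angle_def nverts_def algebra_simps)
  qed
next
  show "adjacent S V E j i" if "adjacent S V E i j" for i j
    using that by (auto simp: adjacent_def insert_commute)
qed (use p_gt_1 Lhat_gt_0 in auto)

context packing_data
begin

section \<open>Identification of the geometric quantities with the analytic ones\<close>

lemma faces_at_single: "faces_at S V F {v} = faces v"
  by (auto simp: faces_at_def)

lemma face_geod_curv_eq:
  assumes "f \<in> F" "v \<in> cell_verts S V f" "\<And>v. v \<in> V \<Longrightarrow> 0 < k v"
  shows "face_geod_curv S V Y k v f = perp_curv (k v) (rad f k)"
proof -
  have "0 < k v" "0 < rad f k" using assms rad_pos[of f k] B_subset by auto
  then show ?thesis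
    using dual_curv_eq[OF face_data[OF assms(1)], of k] assms B_subset[OF assms(1)]
      arc_length_perp_curv[of "k v" "rad f k"]
    unfolding face_geod_curv_def rad_def by fastforce
qed

lemma total_geod_curv_eq:
  assumes "\<And>v. v \<in> V \<Longrightarrow> 0 < k v"
  shows "total_geod_curv S V F Y k v = curv k v"
  unfolding total_geod_curv_def faces_at_single curv_def
  using assms by (intro sum.cong refl face_geod_curv_eq) auto

lemma region_area_eq:
  assumes "f \<in> F" "\<And>v. v \<in> V \<Longrightarrow> 0 < k v"
  shows "region_area S V Y k f = real (nverts S V f) * pi - cone_angle Y f
    - (\<Sum>v\<in>cell_verts S V f. perp_curv (k v) (rad f k))"
  unfolding region_area_def using face_geod_curv_eq assms by (simp cong: sum.cong)

text \<open>The geometric quantities are identified with their closed forms for positive vectors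
  only; varying one coordinate near a positive value stays among these, so the derivatives
  agree.\<close>

lemma partial_deriv_eqI:
  assumes k: "\<And>v. v \<in> V \<Longrightarrow> 0 < k v" and j: "j \<in> V"
    and der: "((\<lambda>s. \<psi> (k(j := s))) has_real_derivative d) (at (k j))"
    and eq: "\<And>k. (\<And>v. v \<in> V \<Longrightarrow> 0 < k v) \<Longrightarrow> \<phi> k = \<psi> k"
  shows "partial_deriv \<phi> j k = d"
  unfolding partial_deriv_def
proof (rule DERIV_imp_deriv)
  show "((\<lambda>s. \<phi> (k(j := s))) has_real_derivative d) (at (k j))"
  proof (rule has_field_derivative_transform_within_open[OF der, of "{0<..}"])
    fix s :: real assume "s \<in> {0<..}"
    then show "\<psi> (k(j := s)) = \<phi> (k(j := s))" using k by (intro eq[symmetric]) auto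
  qed (use k j in auto)
qed

lemma weight_eq:
  assumes k: "\<And>v. v \<in> V \<Longrightarrow> 0 < k v" and "i \<in> V" "j \<in> V" "i \<noteq> j"
  shows "weight S V F Y k i j = conductance k i j"
proof -
  have "partial_deriv (\<lambda>k'. total_geod_curv S V F Y k' i) j k = - conductance k i j / k j"
  proof (rule partial_deriv_eqI[where \<psi> = "\<lambda>k'. curv k' i", OF k \<open>j \<in> V\<close>])
    show "((\<lambda>s. curv (k(j := s)) i) has_real_derivative - conductance k i j / k j) (at (k j))"
      by (rule DERIV_curv_coord) (use assms in auto)
  qed (auto intro: total_geod_curv_eq)
  then show ?thesis using k[OF \<open>j \<in> V\<close>] by (simp add: weight_def)
qed

lemma area_coeff_eq:
  assumes k: "\<And>v. v \<in> V \<Longrightarrow> 0 < k v" and i: "i \<in> V"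
  shows "area_coeff S V F Y k i = area_rate k i"
proof -
  let ?c = "\<Sum>f\<in>faces i. real (nverts S V f) * pi - cone_angle Y f"
  have der: "((\<lambda>s. ?c - (\<Sum>f\<in>faces i. \<Sum>v\<in>cell_verts S V f. perp_curv ((k(i := s)) v) (rad f (k(i := s)))))
      has_real_derivative 0 - area_rate k i / k i) (at (k i))"
    by (intro DERIV_diff DERIV_const DERIV_area_coord k i)
  have "partial_deriv (\<lambda>k'. \<Sum>f\<in>faces_at S V F {i}. region_area S V Y k' f) i k =
      0 - area_rate k i / k i"
  proof (rule partial_deriv_eqI[where \<psi> = "\<lambda>k. ?c - (\<Sum>f\<in>faces i. \<Sum>v\<in>cell_verts S V f. perp_curv (k v) (rad f k))",
        OF k i der])
    fix k :: "'a \<Rightarrow> real" assume "\<And>v. v \<in> V \<Longrightarrow> 0 < k v"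
    then show "(\<Sum>f\<in>faces_at S V F {i}. region_area S V Y k f) =
        ?c - (\<Sum>f\<in>faces i. \<Sum>v\<in>cell_verts S V f. perp_curv (k v) (rad f k))"
      unfolding faces_at_single sum_subtractf[symmetric]
      by (intro sum.cong refl region_area_eq) auto
  qed
  then show ?thesis using k[OF i] by (simp add: area_coeff_def)
qed

lemma calabi_field_eq:
  assumes k: "\<And>v. v \<in> V \<Longrightarrow> 0 < k v" and i: "i \<in> V" and s: "\<And>v. v \<in> V \<Longrightarrow> s v = ln (k v)"
  shows "calabi_field p S V E F Y Lhat k i = k i * log_field s i"
proof -
  have e: "exp (s v) = k v" if "v \<in> V" for v using that k s by simp
  have g: "total_geod_curv S V F Y k j - Lhat j = grad s j" if "j \<in> V" for j
    using that curv_cong[OF that e] total_geod_curv_eq[OF k] by (simp add: grad_def)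
  have c: "weight S V F Y k i j = conductance (\<lambda>v. exp (s v)) i j" if "j \<in> V" "adjacent S V E i j" for j
    using weight_eq[OF k i that(1)] conductance_cong[OF i that(1) e] that(2) by (simp add: adjacent_def)
  have a: "area_coeff S V F Y k i = area_rate (\<lambda>v. exp (s v)) i"
    using area_coeff_eq[OF k i] area_rate_cong[OF i e] by simp
  show ?thesis
    unfolding calabi_field_def p_laplacian_def log_field_def Let_def using i
    by (simp add: a g[OF i] mult.assoc) (auto intro!: sum.cong simp: g c)
qed

lemma admissible_curvs_iff:
  "Lhat \<in> admissible_curvs S V F Y \<longleftrightarrow>
    (\<forall>W. W \<subseteq> V \<and> W \<noteq> {} \<longrightarrow> (\<Sum>w\<in>W. Lhat w) < (\<Sum>f\<in>{f \<in> F. cell_verts S V f \<inter> W \<noteq> {}}.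
       min (pi * real (card (W \<inter> cell_verts S V f))) (real (nverts S V f) * pi - cone_angle Y f)))"
proof -
  have "pi * min (real (nverts_in S V f W)) (real (nverts S V f) - 2 + Y f / pi) =
      min (pi * real (card (W \<inter> cell_verts S V f))) (real (nverts S V f) * pi - cone_angle Y f)" for f W
  proof -
    have "pi * (real (nverts S V f) - 2 + Y f / pi) = real (nverts S V f) * pi - cone_angle Y f"
      by (simp add: cone_angle_def algebra_simps)
    moreover have "pi * min a b = min (pi * a) (pi * b)" for a b :: real
      by (simp add: min_def)
    ultimately show ?thesis by (simp add: nverts_in_def)
  qed
  then show ?thesis using Lhat_gt_0 by (simp add: admissible_curvs_def faces_at_def)
qed

text \<open>Positivity of Lhat forces every vertex to lie on a face, so the sum over faces meeting W
  is nonempty and the strict inequality of \<open>curv_sum_less\<close> applies.\<close>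

lemma admissible_of_realized:
  assumes k: "\<And>v. v \<in> V \<Longrightarrow> 0 < k v"
    and L: "\<And>v. v \<in> V \<Longrightarrow> total_geod_curv S V F Y k v = Lhat v"
  shows "Lhat \<in> admissible_curvs S V F Y"
  unfolding admissible_curvs_iff
proof (intro allI impI)
  fix W assume W: "W \<subseteq> V \<and> W \<noteq> {}"
  then obtain w where w: "w \<in> W" "w \<in> V" by blast
  have curv: "curv k v = Lhat v" if "v \<in> V" for v
    using L[OF that] total_geod_curv_eq[OF k] by simp
  have "faces w \<noteq> {}"
  proof
    assume "faces w = {}"
    then have "curv k w = 0" unfolding curv_def by (simp only: sum.empty)
    then show False using curv[OF w(2)] Lhat_gt_0[OF w(2)] by simp
  qed
  then have ne: "{f \<in> F. cell_verts S V f \<inter> W \<noteq> {}} \<noteq> {}" using w by blast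
  have "(\<Sum>w\<in>W. curv k w) < (\<Sum>f\<in>{f \<in> F. cell_verts S V f \<inter> W \<noteq> {}}.
      min (pi * real (card (W \<inter> cell_verts S V f))) (real (nverts S V f) * pi - cone_angle Y f))"
    by (rule curv_sum_less) (use k W ne in auto)
  moreover have "(\<Sum>w\<in>W. curv k w) = (\<Sum>w\<in>W. Lhat w)"
    using W curv by (intro sum.cong) auto
  ultimately show "(\<Sum>w\<in>W. Lhat w) < (\<Sum>f\<in>{f \<in> F. cell_verts S V f \<inter> W \<noteq> {}}.
      min (pi * real (card (W \<inter> cell_verts S V f))) (real (nverts S V f) * pi - cone_angle Y f))"
    by simp
qed

lemma lyapunov_flow:
  assumes "Lhat \<in> admissible_curvs S V F Y"
  shows "lyapunov_flow V pot grad log_field"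
proof -
  have adm: "(\<Sum>w\<in>W. Lhat w) < (\<Sum>f\<in>{f \<in> F. cell_verts S V f \<inter> W \<noteq> {}}.
       min (pi * real (card (W \<inter> cell_verts S V f))) (real (nverts S V f) * pi - cone_angle Y f))"
    if "W \<subseteq> V" "W \<noteq> {}" for W using assms that unfolding admissible_curvs_iff by blast
  have coord: "((\<lambda>s. s v) \<longlongrightarrow> a v) (at a within UNIV)" for v and a :: "'a \<Rightarrow> real"
  proof -
    have "continuous_on UNIV (\<lambda>s :: 'a \<Rightarrow> real. s v)" by simp
    then show ?thesis unfolding continuous_on_def by blast
  qed
  show ?thesis
  proof
    show "continuous_on UNIV (\<lambda>s. log_field s v)" for v
      unfolding continuous_on_def by (intro ballI tendsto_log_field coord)
    show "continuous_on UNIV pot"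
      unfolding continuous_on_def by (intro ballI tendsto_pot coord)
    show "continuous_on UNIV (\<lambda>s. grad s v)" if "v \<in> V" for v
      unfolding continuous_on_def by (intro ballI tendsto_grad coord that)
    show "(\<Sum>v\<in>V. grad s v * log_field s v) \<le> 0" for s
    proof -
      have "0 \<le> (\<Sum>i\<in>V. area_rate (\<lambda>v. exp (s v)) i * (grad s i)\<^sup>2)"
        by (intro sum_nonneg mult_nonneg_nonneg area_rate_nonneg) auto
      then show ?thesis using dissipation[of s] by linarith
    qed
    show "\<exists>R. \<forall>s. pot s \<le> c \<longrightarrow> (\<forall>v\<in>V. \<bar>s v\<bar> \<le> R)" for c
    proof -
      obtain \<epsilon> C where \<epsilon>: "0 < \<epsilon>" "\<And>s v. v \<in> V \<Longrightarrow> \<epsilon> * \<bar>s v\<bar> \<le> pot s + C"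
        using pot_coercive[OF adm] by blast
      have "\<bar>s v\<bar> \<le> (c + C) / \<epsilon>" if "pot s \<le> c" "v \<in> V" for s v
        using \<epsilon>(2)[OF that(2), of s] that(1) \<epsilon>(1) by (simp add: field_simps)
      then show ?thesis by blast
    qed
    show "log_field s v = 0" if "v \<notin> V" for s v using that by (simp add: log_field_def)
    show "log_field s = log_field s'" if "\<And>v. v \<in> V \<Longrightarrow> s v = s' v" for s s'
      using that by (rule log_field_cong)
    show "pot s = pot s'" if "\<And>v. v \<in> V \<Longrightarrow> s v = s' v" for s s'
      using that by (rule pot_cong)
    show "((\<lambda>t. pot (u t)) has_real_derivative (\<Sum>v\<in>V. grad (u t) v * u' v)) (at t within T)"
      if "\<And>v. v \<in> V \<Longrightarrow> ((\<lambda>t. u t v) has_real_derivative u' v) (at t within T)" "t \<in> T" for u u' t T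
      using that by (rule DERIV_pot)
    show "grad s v = 0" if "0 \<le> (\<Sum>v\<in>V. grad s v * log_field s v)" "v \<in> V" for s v
      using adm that by (rule grad_eq_0)
    show "s v = s' v" if "\<And>v. v \<in> V \<Longrightarrow> grad s v = 0" "\<And>v. v \<in> V \<Longrightarrow> grad s' v = 0" "v \<in> V" for s s' v
      using adm that by (rule grad_inj)
  qed (rule finite_V)
qed

end

lemma time_interval_ereal: "time_interval (ereal r) = {0..<r}"
  by (auto simp: time_interval_def)

lemma time_interval_infinity: "time_interval \<infinity> = {0..}"
  by (auto simp: time_interval_def)

section \<open>Solutions for admissible curvatures\<close>

locale admissible_packing_data = packing_data +
  assumes admissible_Lhat: "Lhat \<in> admissible_curvs S V F Y"

sublocale admissible_packing_data \<subseteq> lyapunov_flow V pot grad log_field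
  using lyapunov_flow admissible_Lhat .

context admissible_packing_data
begin

lemma calabi_solution_exp:
  assumes "is_sol (time_interval T) u" "0 < T"
  shows "calabi_solution p S V E F Y Lhat T (\<lambda>t v. exp (u t v))"
  unfolding calabi_solution_def
proof (intro conjI ballI)
  fix t i assume t: "t \<in> time_interval T" and i: "i \<in> V"
  have "calabi_field p S V E F Y Lhat (\<lambda>v. exp (u t v)) i = exp (u t i) * log_field (u t) i"
    using i by (intro calabi_field_eq) auto
  moreover have "((\<lambda>t. u t i) has_real_derivative log_field (u t) i) (at t within time_interval T)"
    using assms(1) t i by (simp add: is_sol_def)
  ultimately show "((\<lambda>t. exp (u t i)) has_real_derivative
      calabi_field p S V E F Y Lhat (\<lambda>v. exp (u t v)) i) (at t within time_interval T)"
    using DERIV_chain2[OF DERIV_exp] by simp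
qed (use assms in \<open>auto simp: packing_metrics_def\<close>)

lemma is_sol_ln:
  assumes "calabi_solution p S V E F Y Lhat T x"
  shows "is_sol (time_interval T) (\<lambda>t v. ln (x t v))"
  unfolding is_sol_def
proof (intro ballI)
  fix t i assume t: "t \<in> time_interval T" and i: "i \<in> V"
  have pos: "0 < x t v" if "v \<in> V" for v
    using assms t that by (auto simp: calabi_solution_def packing_metrics_def)
  have "calabi_field p S V E F Y Lhat (x t) i = x t i * log_field (\<lambda>v. ln (x t v)) i"
    using pos i by (intro calabi_field_eq) auto
  moreover have "((\<lambda>t. x t i) has_real_derivative calabi_field p S V E F Y Lhat (x t) i)
      (at t within time_interval T)"
    using assms t i by (simp add: calabi_solution_def)
  ultimately show "((\<lambda>t. ln (x t i)) has_real_derivative log_field (\<lambda>v. ln (x t v)) i)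
      (at t within time_interval T)"
    using DERIV_chain2[of ln "1 / x t i" "\<lambda>t. x t i", OF DERIV_ln_divide[OF pos[OF i]]] pos[OF i]
    by fastforce
qed

lemma maximal_solution_exists:
  assumes "k0 \<in> packing_metrics V"
  shows "\<exists>x. maximal_calabi_solution p S V E F Y Lhat k0 \<infinity> x"
proof -
  obtain u where u: "\<And>v. v \<in> V \<Longrightarrow> u 0 v = ln (k0 v)" "is_sol {0..} u"
    using global_existence[of "\<lambda>v. ln (k0 v)"] by blast
  have "calabi_solution p S V E F Y Lhat \<infinity> (\<lambda>t v. exp (u t v))"
    by (rule calabi_solution_exp) (use u(2) in \<open>auto simp: time_interval_infinity\<close>)
  then have "maximal_calabi_solution p S V E F Y Lhat k0 \<infinity> (\<lambda>t v. exp (u t v))"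
    using u(1) assms by (auto simp: maximal_calabi_solution_def packing_metrics_def)
  then show ?thesis by blast
qed

text \<open>Any solution ending at a finite time r extends to r + 1 by \<open>is_sol_extend\<close>,
  in contradiction to maximality.\<close>

lemma maximal_solution_global:
  assumes "maximal_calabi_solution p S V E F Y Lhat k0 T x"
  shows "T = \<infinity>"
proof (rule ccontr)
  assume "T \<noteq> \<infinity>"
  have sol: "calabi_solution p S V E F Y Lhat T x" and T: "0 < T"
    using assms by (auto simp: maximal_calabi_solution_def calabi_solution_def)
  obtain r where r: "T = ereal r" "0 < r" using \<open>T \<noteq> \<infinity>\<close> T by (cases T) auto
  have "is_sol {0..<r} (\<lambda>t v. ln (x t v))"
    using is_sol_ln[OF sol] unfolding r(1) time_interval_ereal .
  then obtain w where w: "is_sol {0..<r + 1} w"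
    "\<And>t v. t \<in> {0..<r} \<Longrightarrow> v \<in> V \<Longrightarrow> w t v = ln (x t v)"
    using is_sol_extend[of r "\<lambda>t v. ln (x t v)"] r(2) by blast
  have "calabi_solution p S V E F Y Lhat (ereal (r + 1)) (\<lambda>t v. exp (w t v))"
    by (rule calabi_solution_exp) (use w(1) r(2) in \<open>auto simp: time_interval_ereal\<close>)
  moreover have "exp (w t i) = x t i" if "t \<in> time_interval T" "i \<in> V" for t i
    using that w(2)[of t i] sol unfolding r(1)
    by (auto simp: time_interval_ereal calabi_solution_def packing_metrics_def)
  moreover have "T < ereal (r + 1)" using r by simp
  ultimately show False using assms unfolding maximal_calabi_solution_def by blast
qed

lemma solution_converges:
  assumes sol: "calabi_solution p S V E F Y Lhat \<infinity> x"
  obtains k where "k \<in> packing_metrics V" "\<And>i. i \<in> V \<Longrightarrow> ((\<lambda>t. x t i) \<longlongrightarrow> k i) at_top"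
    "\<And>i. i \<in> V \<Longrightarrow> total_geod_curv S V F Y k i = Lhat i"
proof -
  have "is_sol {0..} (\<lambda>t v. ln (x t v))" using is_sol_ln[OF sol] by (simp add: time_interval_infinity)
  then obtain s where s: "\<And>v. v \<in> V \<Longrightarrow> grad s v = 0"
    "\<And>v. v \<in> V \<Longrightarrow> ((\<lambda>t. ln (x t v)) \<longlongrightarrow> s v) at_top"
    using convergence[of "\<lambda>t v. ln (x t v)"] by blast
  have "((\<lambda>t. x t i) \<longlongrightarrow> exp (s i)) at_top" if i: "i \<in> V" for i
  proof (rule Lim_transform_eventually[OF tendsto_exp[OF s(2)[OF i]]])
    have pos: "0 < x t i" if "0 \<le> t" for t
      using sol i that by (auto simp: calabi_solution_def packing_metrics_def time_interval_infinity)
    from eventually_ge_at_top[of 0] show "\<forall>\<^sub>F t in at_top. exp (ln (x t i)) = x t i"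
      by eventually_elim (simp add: pos)
  qed
  moreover have "total_geod_curv S V F Y (\<lambda>v. exp (s v)) i = Lhat i" if "i \<in> V" for i
    using total_geod_curv_eq[of "\<lambda>v. exp (s v)" i] s(1)[OF that] by (simp add: grad_def)
  ultimately show ?thesis
    using that[of "\<lambda>v. exp (s v)"] by (simp add: packing_metrics_def)
qed

end

theorem theorem1p7:
  fixes S :: "'a topology" and V :: "'a set" and E F :: "'a set set"
    and Y :: "'a set \<Rightarrow> real" and p :: real and Lhat :: "'a \<Rightarrow> real"
  assumes "surface S"
    and "polygonal_decomposition S V E F"
    and "\<And>f. f \<in> F \<Longrightarrow> (2 - real (nverts S V f)) * pi < Y f \<and> Y f < 2 * pi"
    and "p > 1"
    and "\<And>i. i \<in> V \<Longrightarrow> Lhat i > 0"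
  shows "Lhat \<in> admissible_curvs S V F Y \<longleftrightarrow>
    (\<forall>k0\<in>packing_metrics V.
       (\<exists>T x. maximal_calabi_solution p S V E F Y Lhat k0 T x) \<and>
       (\<forall>T x. maximal_calabi_solution p S V E F Y Lhat k0 T x \<longrightarrow>
          T = \<infinity> \<and>
          (\<exists>k\<in>packing_metrics V.
             (\<forall>i\<in>V. ((\<lambda>t. x t i) \<longlongrightarrow> k i) at_top) \<and>
             (\<forall>i\<in>V. total_geod_curv S V F Y k i = Lhat i))))"
    (is "?adm \<longleftrightarrow> (\<forall>k0\<in>_. ?flow k0)")
proof -
  interpret packing_data S V E F Y p Lhat
    by unfold_locales (use assms in auto)
  show ?thesis
  proof
    assume ?adm
    then interpret admissible_packing_data S V E F Y p Lhat
      by unfold_locales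
    show "\<forall>k0\<in>packing_metrics V. ?flow k0"
    proof (intro ballI conjI allI impI)
      fix k0 assume "k0 \<in> packing_metrics V"
      then show "\<exists>T x. maximal_calabi_solution p S V E F Y Lhat k0 T x"
        using maximal_solution_exists by blast
    next
      fix k0 T x assume max: "maximal_calabi_solution p S V E F Y Lhat k0 T x"
      then show "T = \<infinity>" by (rule maximal_solution_global)
      with max have "calabi_solution p S V E F Y Lhat \<infinity> x"
        by (simp add: maximal_calabi_solution_def)
      then show "\<exists>k\<in>packing_metrics V.
             (\<forall>i\<in>V. ((\<lambda>t. x t i) \<longlongrightarrow> k i) at_top) \<and>
             (\<forall>i\<in>V. total_geod_curv S V F Y k i = Lhat i)"
        by (rule solution_converges) blast
    qed
  next
    assume "\<forall>k0\<in>packing_metrics V. ?flow k0"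
    \<comment> \<open>One initial metric suffices: the existence clause supplies a maximal solution
      starting there, and its limit realizes Lhat.\<close>
    moreover have "(\<lambda>_. 1) \<in> packing_metrics V" by (simp add: packing_metrics_def)
    ultimately obtain k where "k \<in> packing_metrics V"
      "\<And>i. i \<in> V \<Longrightarrow> total_geod_curv S V F Y k i = Lhat i"
      by blast
    then show ?adm by (intro admissible_of_realized[of k]) (auto simp: packing_metrics_def)
  qed
qed

end
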